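(* Let $(\mu_t)_{t<T}$ be a solution to the coagulation-diffusion equation with $\|\langle m,\mu_0\rangle\|_1<\infty$. Let $n$ be a mass function for $K$ with $\|\langle n,\mu_0\rangle\|_1<\infty$. Then $(\mu_t)_{t<T}$ is conservative if and only if it is $n$-conservative, that is to say, if and only if $\|\langle n,\mu_t\rangle\|_1=\|\langle n,\mu_0\rangle\|_1$ for all $t<T$.
   Context: Setting. Fix $d\ge1$. $(E,\mathcal{E})$ is a standard measurable space, with measurable functions $m:E\to(0,\infty)$ (mass) and $a:E\to(0,\infty)$ (diffusivity). $K$ is a finite kernel on $E\times E\times\mathcal{E}$: $K(\cdot,\cdot,A)$ is a finite non-negative measurable function for each $A\in\mathcal{E}$ and $K(y,y',\cdot)$ is a measure for all $y,y'$. $K$ is symmetric in its first two arguments and mass-preserving: $m(z)=m(y)+m(y')$ for $K(y,y',\cdot)$-a.e. $z$, for all $y,y'$. A function $f$ on $E$ is locally bounded if it is bounded on $m^{-1}(B)$ for all compact $B\subseteq(0,\infty)$; it is $K$-decreasing if for all $y,y'$, $f(z)\le f(y)$ for $K(y,y',\cdot)$-a.e. $z$. A continuous function $\phi:(0,\infty)\to(0,\infty)$ is given with $\phi(\lambda m)\le\lambda\phi(m)$ for all $\lambda\ge1$, $m>0$, and $w(y)=a(y)^{d/2}\phi(m(y))$. Standing assumptions: $a$ is locally bounded and $K$-decreasing; $a^{-1}$ is locally bounded; $w$ is uniformly positive (bounded below by a positive constant); $K(y,y',E)\le w(y)w(y')$ for all $y,y'\in E$. State space. $\mathcal{M}$ is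 the set of finite measures $\mu$ on $\mathbb{R}^d\times E$ whose first marginal $B\mapsto\mu(B\times E)$ is absolutely continuous with respect to Lebesgue measure. Then $\mu(B\times A)=\int_B\mu(x,A)dx$ for a kernel $\mu(x,dy)$ on $\mathbb{R}^d\times\mathcal{E}$, unique for a.a. $x$. Write $\langle f,\mu\rangle$ for the function $x\mapsto\int_E f(y)\mu(x,dy)$ (defined a.e.), and $\|\cdot\|_p$ for the $L^p(\mathbb{R}^d)$-norm. A process $(\mu_t)_{t<T}$ in $\mathcal{M}$ (with $T\in(0,\infty]$ and $t\in[0,T)$) is a family in $\mathcal{M}$ with $t\mapsto\mu_t(B\times A)$ measurable for all Borel $B$ and $A\in\mathcal{E}$. For $\mu\in\mathcal{M}$ define measures $$K^+(\mu)(B\times A)=\tfrac12\int_{B\times E\times E}K(y,y',A)\mu(x,dy)\mu(x,dy')dx,\quad K^-(\mu)(B\times A)=\int_{B\times A\times E}K(y,y',E)\mu(x,dy)\mu(x,dy')dx.$$ With $p(t,x,x')=(2\pi t)^{-d/2}\exp\{-|x-x'|^2/2t\}$, for a measure $\mu$ on $\mathbb{R}^d\times E$ and $t>0$, $P_t\mu$ is the measure $P_t\mu(B\times A)=\int_B P_t\mu(x',A)dx'$ with $P_t\mu(x',A)=\int_{\mathbb{R}^d\times A}p(a(y)t,x,x')\mu(dx,dy)$, and $P_0\mu=\mu$. Solutions. The coagulation-diffusion equation is formally $\dot\mu_t=\frac12a\Delta\mu_t+K^+(\mu_t)-K^-(\mu_t)$. A process $(\mu_t)_{t<T}$ in $\mathcal{M}$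 is a solution if (1) $\mu_t+\int_0^tP_{t-s}K^-(\mu_s)ds=P_t\mu_0+\int_0^tP_{t-s}K^+(\mu_s)ds$ for $t\in(0,T)$; (2) $\int w(y)\mu_0(dx,dy)<\infty$ and $\mu_0(dx,dy)\le dx\otimes\mu_0^*(dy)$ for some measure $\mu_0^*$ on $E$ for which $w$ is integrable; (3) $\int_0^t\int_Ew^R(y)P_{t-s}K^+(\mu_s)(x,dy)ds<\infty$ for a.a. $x\in\mathbb{R}^d$, all $R\in(0,\infty)$ and $t<T$, where $w^R(y)=a(y)^{d/2}m(y)1_{\{m(y)\le R\}}$. A solution is conservative if $\|\langle m,\mu_t\rangle\|_1=\|\langle m,\mu_0\rangle\|_1<\infty$ for all $t<T$. A mass function for $K$ is a measurable function $n:E\to(0,\infty)$ such that, for all $y,y'\in E$, $n(z)=n(y)+n(y')$ for $K(y,y',\cdot)$-a.e. $z$. *)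

theory Defs
  imports "HOL-Analysis.Analysis"
begin

text \<open>
  Points of Euclidean space have type \<open>'x::euclidean_space\<close>, so \<open>d = DIM('x) \<ge> 1\<close>.
  The type space is a measurable space \<open>E :: 'e measure\<close>, of which only \<open>space E\<close> and
  \<open>sets E\<close> are used. Integrals of nonnegative functions take values in \<open>[0,\<infinity>]\<close>.
\<close>

section \<open>The coagulation kernel\<close>

text \<open>Standard means measurably isomorphic to a Borel subset of the real line, as a space with its trace of the Borel sets.\<close>

definition standard_measurable_space :: "'e measure \<Rightarrow> bool" where
  "standard_measurable_space E \<longleftrightarrow>
     (\<exists>S \<in> sets (borel :: real measure).
        \<exists>f \<in> E \<rightarrow>\<^sub>M restrict_space borel S. \<exists>g \<in> restrict_space borel S \<rightarrow>\<^sub>M E.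
          (\<forall>y\<in>space E. g (f y) = y) \<and> (\<forall>r\<in>S. f (g r) = r))"

definition finite_kernel2 :: "'e measure \<Rightarrow> ('e \<Rightarrow> 'e \<Rightarrow> 'e measure) \<Rightarrow> bool" where
  "finite_kernel2 E K \<longleftrightarrow>
     (\<forall>y\<in>space E. \<forall>y'\<in>space E. sets (K y y') = sets E \<and> finite_measure (K y y')) \<and>
     (\<forall>A\<in>sets E. (\<lambda>(y, y'). emeasure (K y y') A) \<in> borel_measurable (E \<Otimes>\<^sub>M E))"

definition mass_function :: "'e measure \<Rightarrow> ('e \<Rightarrow> 'e \<Rightarrow> 'e measure) \<Rightarrow> ('e \<Rightarrow> real) \<Rightarrow> bool" where
  "mass_function E K n \<longleftrightarrow>
     n \<in> borel_measurable E \<and> (\<forall>y\<in>space E. 0 < n y) \<and>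
     (\<forall>y\<in>space E. \<forall>y'\<in>space E. AE z in K y y'. n z = n y + n y')"

definition locally_bounded :: "'e measure \<Rightarrow> ('e \<Rightarrow> real) \<Rightarrow> ('e \<Rightarrow> real) \<Rightarrow> bool" where
  "locally_bounded E m f \<longleftrightarrow>
     (\<forall>B. compact B \<and> B \<subseteq> {0<..} \<longrightarrow> bounded (f ` {y \<in> space E. m y \<in> B}))"

definition K_decreasing :: "'e measure \<Rightarrow> ('e \<Rightarrow> 'e \<Rightarrow> 'e measure) \<Rightarrow> ('e \<Rightarrow> real) \<Rightarrow> bool" where
  "K_decreasing E K f \<longleftrightarrow> (\<forall>y\<in>space E. \<forall>y'\<in>space E. AE z in K y y'. f z \<le> f y)"

definition weight :: "nat \<Rightarrow> ('e \<Rightarrow> real) \<Rightarrow> ('e \<Rightarrow> real) \<Rightarrow> (real \<Rightarrow> real) \<Rightarrow> 'e \<Rightarrow> real" where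
  "weight d m a \<phi> y = a y powr (real d / 2) * \<phi> (m y)"

definition truncated_weight :: "nat \<Rightarrow> ('e \<Rightarrow> real) \<Rightarrow> ('e \<Rightarrow> real) \<Rightarrow> real \<Rightarrow> 'e \<Rightarrow> real" where
  "truncated_weight d m a R y = a y powr (real d / 2) * m y * indicator {y. m y \<le> R} y"

locale coagulation_setting =
  fixes d :: nat
    and E :: "'e measure"
    and m a :: "'e \<Rightarrow> real"
    and K :: "'e \<Rightarrow> 'e \<Rightarrow> 'e measure"
    and \<phi> :: "real \<Rightarrow> real"
  assumes standard: "standard_measurable_space E"
    and kernel: "finite_kernel2 E K"
    and kernel_symmetric: "\<And>y y'. y \<in> space E \<Longrightarrow> y' \<in> space E \<Longrightarrow> K y y' = K y' y"
    and mass: "mass_function E K m"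
    and a_measurable: "a \<in> borel_measurable E"
    and a_pos: "\<And>y. y \<in> space E \<Longrightarrow> 0 < a y"
    and a_locally_bounded: "locally_bounded E m a"
    and a_decreasing: "K_decreasing E K a"
    and inverse_a_locally_bounded: "locally_bounded E m (\<lambda>y. inverse (a y))"
    and phi_continuous: "continuous_on {0<..} \<phi>"
    and phi_pos: "\<And>r. 0 < r \<Longrightarrow> 0 < \<phi> r"
    and phi_sublinear: "\<And>l r. 1 \<le> l \<Longrightarrow> 0 < r \<Longrightarrow> \<phi> (l * r) \<le> l * \<phi> r"
    and weight_uniformly_pos: "\<exists>c>0. \<forall>y\<in>space E. c \<le> weight d m a \<phi> y"
    and kernel_bound: "\<And>y y'. y \<in> space E \<Longrightarrow> y' \<in> space E \<Longrightarrow>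
      emeasure (K y y') (space E) \<le> ennreal (weight d m a \<phi> y * weight d m a \<phi> y')"

section \<open>The state space and its operators\<close>

definition state_space :: "'e measure \<Rightarrow> ('x::euclidean_space \<times> 'e) measure set" where
  "state_space E =
     {\<mu>. sets \<mu> = sets (borel \<Otimes>\<^sub>M E) \<and> finite_measure \<mu> \<and>
         absolutely_continuous lborel (distr \<mu> borel fst)}"

definition process ::
    "'e measure \<Rightarrow> ereal \<Rightarrow> (real \<Rightarrow> ('x::euclidean_space \<times> 'e) measure) \<Rightarrow> bool" where
  "process E T \<mu> \<longleftrightarrow>
     (\<forall>t. 0 \<le> t \<and> ereal t < T \<longrightarrow> \<mu> t \<in> state_space E) \<and>
     (\<forall>B\<in>sets borel. \<forall>A\<in>sets E.
        (\<lambda>t. emeasure (\<mu> t) (B \<times> A))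
          \<in> borel_measurable (restrict_space borel {t. 0 \<le> t \<and> ereal t < T}))"

text \<open>
  The kernel \<open>\<mu>(x,dy)\<close> is determined for almost every \<open>x\<close> only. We fix some version, and
  take it finite for every \<open>x\<close>: this is no restriction, since \<open>\<mu>\<close> is finite.
\<close>

definition is_disintegration ::
    "'e measure \<Rightarrow> ('x::euclidean_space \<times> 'e) measure \<Rightarrow> ('x \<Rightarrow> 'e measure) \<Rightarrow> bool" where
  "is_disintegration E \<mu> \<kappa> \<longleftrightarrow>
     (\<forall>x. sets (\<kappa> x) = sets E \<and> finite_measure (\<kappa> x)) \<and>
     (\<forall>A\<in>sets E. (\<lambda>x. emeasure (\<kappa> x) A) \<in> borel_measurable borel) \<and>
     (\<forall>B\<in>sets borel. \<forall>A\<in>sets E. emeasure \<mu> (B \<times> A) = (\<integral>\<^sup>+x\<in>B. emeasure (\<kappa> x) A \<partial>lborel))"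

definition disintegration ::
    "'e measure \<Rightarrow> ('x::euclidean_space \<times> 'e) measure \<Rightarrow> 'x \<Rightarrow> 'e measure" where
  "disintegration E \<mu> = (SOME \<kappa>. is_disintegration E \<mu> \<kappa>)"

text \<open>The function \<open>x \<mapsto> \<langle>f,\<mu>\<rangle>(x)\<close>, for \<open>f \<ge> 0\<close>.\<close>

definition pairing ::
    "'e measure \<Rightarrow> ('e \<Rightarrow> real) \<Rightarrow> ('x::euclidean_space \<times> 'e) measure \<Rightarrow> 'x \<Rightarrow> ennreal" where
  "pairing E f \<mu> x = (\<integral>\<^sup>+y. ennreal (f y) \<partial>disintegration E \<mu> x)"

definition L1_norm :: "('x::euclidean_space \<Rightarrow> ennreal) \<Rightarrow> ennreal" where
  "L1_norm f = (\<integral>\<^sup>+x. f x \<partial>lborel)"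

text \<open>The measure \<open>\<kappa>(x,dy) dx\<close>; on a rectangle \<open>B \<times> A\<close> it is \<open>\<integral>\<^sub>B \<kappa>(x,A) dx\<close>.\<close>

definition kernel_measure ::
    "'e measure \<Rightarrow> ('x::euclidean_space \<Rightarrow> 'e measure) \<Rightarrow> ('x \<times> 'e) measure" where
  "kernel_measure E \<kappa> =
     measure_of (UNIV \<times> space E) (sets (borel \<Otimes>\<^sub>M E))
       (\<lambda>C. \<integral>\<^sup>+x. emeasure (\<kappa> x) (Pair x -` C) \<partial>lborel)"

definition K_plus :: "'e measure \<Rightarrow> ('e \<Rightarrow> 'e \<Rightarrow> 'e measure) \<Rightarrow>
    ('x::euclidean_space \<times> 'e) measure \<Rightarrow> ('x \<times> 'e) measure" where
  "K_plus E K \<mu> = kernel_measure E (\<lambda>x. measure_of (space E) (sets E)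
     (\<lambda>A. 1 / 2 * (\<integral>\<^sup>+y. \<integral>\<^sup>+y'. emeasure (K y y') A
                     \<partial>disintegration E \<mu> x \<partial>disintegration E \<mu> x)))"

definition K_minus :: "'e measure \<Rightarrow> ('e \<Rightarrow> 'e \<Rightarrow> 'e measure) \<Rightarrow>
    ('x::euclidean_space \<times> 'e) measure \<Rightarrow> ('x \<times> 'e) measure" where
  "K_minus E K \<mu> = kernel_measure E (\<lambda>x. measure_of (space E) (sets E)
     (\<lambda>A. \<integral>\<^sup>+y\<in>A. (\<integral>\<^sup>+y'. emeasure (K y y') (space E) \<partial>disintegration E \<mu> x)
             \<partial>disintegration E \<mu> x))"

definition heat_kernel :: "real \<Rightarrow> 'x::euclidean_space \<Rightarrow> 'x \<Rightarrow> real" where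
  "heat_kernel t x x' =
     (2 * pi * t) powr (- (real DIM('x) / 2)) * exp (- (norm (x - x'))\<^sup>2 / (2 * t))"

text \<open>The measure \<open>P\<^sub>t\<mu>(x',dy)\<close> on \<open>E\<close>, for \<open>t > 0\<close>.\<close>

definition heat_at :: "'e measure \<Rightarrow> ('e \<Rightarrow> real) \<Rightarrow> real \<Rightarrow>
    ('x::euclidean_space \<times> 'e) measure \<Rightarrow> 'x \<Rightarrow> 'e measure" where
  "heat_at E a t \<mu> x' = measure_of (space E) (sets E)
     (\<lambda>A. \<integral>\<^sup>+(x, y)\<in>UNIV \<times> A. ennreal (heat_kernel (a y * t) x x') \<partial>\<mu>)"

definition heat_flow :: "'e measure \<Rightarrow> ('e \<Rightarrow> real) \<Rightarrow> real \<Rightarrow>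
    ('x::euclidean_space \<times> 'e) measure \<Rightarrow> ('x \<times> 'e) measure" where
  "heat_flow E a t \<mu> = (if t = 0 then \<mu> else kernel_measure E (heat_at E a t \<mu>))"

section \<open>Solutions\<close>

text \<open>
  The equation is an identity between measures, possibly with infinite values. The interval
  \<open>[0,t]\<close> of time integration is replaced by \<open>[0,t)\<close>, as the kernel \<open>P\<^sub>t\<^sub>-\<^sub>s\<nu>(x,dy)\<close> in the
  last condition makes sense for \<open>s < t\<close> only.
\<close>

definition solution :: "'e measure \<Rightarrow> ('e \<Rightarrow> real) \<Rightarrow> ('e \<Rightarrow> real) \<Rightarrow>
    ('e \<Rightarrow> 'e \<Rightarrow> 'e measure) \<Rightarrow> (real \<Rightarrow> real) \<Rightarrow> ereal \<Rightarrow>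
    (real \<Rightarrow> ('x::euclidean_space \<times> 'e) measure) \<Rightarrow> bool" where
  "solution E m a K \<phi> T \<mu> \<longleftrightarrow>
     process E T \<mu> \<and>
     (\<forall>t. 0 < t \<and> ereal t < T \<longrightarrow>
        (\<forall>C \<in> sets (borel \<Otimes>\<^sub>M E).
           emeasure (\<mu> t) C
             + (\<integral>\<^sup>+s\<in>{0..<t}. emeasure (heat_flow E a (t - s) (K_minus E K (\<mu> s))) C \<partial>lborel)
           = emeasure (heat_flow E a t (\<mu> 0)) C
             + (\<integral>\<^sup>+s\<in>{0..<t}. emeasure (heat_flow E a (t - s) (K_plus E K (\<mu> s))) C \<partial>lborel))) \<and>
     (\<integral>\<^sup>+(x, y). ennreal (weight DIM('x) m a \<phi> y) \<partial>\<mu> 0) < \<infinity> \<and>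
     (\<exists>\<mu>0. sets \<mu>0 = sets E \<and>
        (\<integral>\<^sup>+y. ennreal (weight DIM('x) m a \<phi> y) \<partial>\<mu>0) < \<infinity> \<and>
        (\<forall>C \<in> sets (borel \<Otimes>\<^sub>M E). emeasure (\<mu> 0) C \<le> emeasure (lborel \<Otimes>\<^sub>M \<mu>0) C)) \<and>
     (\<forall>R>0. \<forall>t. 0 \<le> t \<and> ereal t < T \<longrightarrow>
        (AE x in lborel.
           (\<integral>\<^sup>+s\<in>{0..<t}.
              (\<integral>\<^sup>+y. ennreal (truncated_weight DIM('x) m a R y)
                 \<partial>heat_at E a (t - s) (K_plus E K (\<mu> s)) x) \<partial>lborel) < \<infinity>))"

definition conservative :: "'e measure \<Rightarrow> ('e \<Rightarrow> real) \<Rightarrow> ereal \<Rightarrow>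
    (real \<Rightarrow> ('x::euclidean_space \<times> 'e) measure) \<Rightarrow> bool" where
  "conservative E m T \<mu> \<longleftrightarrow>
     (\<forall>t. 0 \<le> t \<and> ereal t < T \<longrightarrow>
        L1_norm (pairing E m (\<mu> t)) = L1_norm (pairing E m (\<mu> 0)) \<and>
        L1_norm (pairing E m (\<mu> 0)) < \<infinity>)"

end

theory Submission
  imports Defs "HOL-Probability.Distributions" "HOL-Probability.Distribution_Functions"
begin

text \<open>
  The theorem rests on one monotonicity principle. Call a measurable function
  \<open>g \<ge> 0\<close> on the type space subadditive if \<open>g z \<le> g y + g y'\<close> for
  \<open>K y y'\<close>-almost every \<open>z\<close>. A collision can only decrease the sum of such a \<open>g\<close> over the
  particles, and diffusion does not change it, so that \<open>\<integral> g d\<mu>\<^sub>t \<le> \<integral> g d\<mu>\<^sub>0\<close>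
  (\<open>subadditive_nonincreasing\<close>). Let now \<open>n\<^sub>1\<close> and \<open>n\<^sub>2\<close> be two mass functions, both with a finite
  initial total, and let the total of \<open>n\<^sub>1\<close> be conserved. The positive part of \<open>k n\<^sub>1 - n\<^sub>2\<close> is subadditive, being the maximum of
  two additive functions, and together with \<open>min n\<^sub>2 (k n\<^sub>1)\<close> it makes up \<open>k n\<^sub>1\<close>. As the
  total of \<open>k n\<^sub>1\<close> stays constant and that of the positive part cannot grow, the total of
  \<open>min n\<^sub>2 (k n\<^sub>1)\<close> cannot decrease. For \<open>k \<rightarrow> \<infinity>\<close> the total of \<open>n\<^sub>2\<close> cannot decrease either,
  and it cannot increase since \<open>n\<^sub>2\<close> is itself subadditive (\<open>mass_function_conserved\<close>).
  Applying this to \<open>(m, n)\<close> and to \<open>(n, m)\<close> gives the two directions.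

  To prove the principle one integrates the equation against \<open>g\<close>. The gain term is at most
  the loss term, but the two can be cancelled only if they are finite, and this is where the
  hypotheses on the kernel enter. The weight \<open>w = a\<^sup>d\<^sup>/\<^sup>2 \<phi>(m)\<close> satisfies \<open>K(y,y',E) \<le> w(y)w(y')\<close>.
  Multiplied by \<open>a\<^sup>d\<^sup>/\<^sup>2\<close> the heat kernel \<open>p(a\<tau>,x,x')\<close> is an increasing function of \<open>a\<close>; since \<open>a\<close>
  decreases in collisions and \<open>\<phi>\<close> is subadditive, \<open>z \<mapsto> p(a(z)\<tau>,x,x') w(z)\<close> is subadditive
  for all \<open>x, x'\<close> and \<open>\<tau>\<close>. Hence gain and loss can be compared at each point \<open>x'\<close> of space
  separately. For truncations of \<open>w\<close> the gain at almost every \<open>x'\<close> is finite by the last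
  condition on a solution, so that the density of \<open>w\<close> at time \<open>t\<close> is bounded by the density
  of \<open>w\<close> obtained from \<open>\<mu>\<^sub>0\<close> by diffusion alone (\<open>cut_weight_bound\<close>, \<open>weight_bound\<close>). The latter
  is bounded in \<open>x'\<close> and integrable, so the total collision rate, at most the
  integral over space of the squared density of \<open>w\<close>, is bounded in time (\<open>total_loss_bound\<close>).
  Gain and loss of every bounded \<open>g\<close> are therefore finite, and for unbounded \<open>g\<close> it suffices to
  consider the functions \<open>min g k\<close>, which are again subadditive.

  All of this needs measure-theoretic preparation. The kernels \<open>\<mu>\<^sub>s(x,dy)\<close> exist
  because \<open>E\<close> is standard, but they are chosen for each \<open>s\<close> separately. To integrate over \<open>s\<close> and
  to exchange integrals, one version that is measurable in \<open>(s,x)\<close> is constructed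
  (\<open>joint_disintegration\<close>), and the collision measures are shown not to depend on the version.
\<close>

section \<open>Finite kernels\<close>

definition finite_kernel :: "'a measure \<Rightarrow> 'b measure \<Rightarrow> ('a \<Rightarrow> 'b measure) \<Rightarrow> bool" where
  "finite_kernel X Y k \<longleftrightarrow>
     (\<forall>x\<in>space X. sets (k x) = sets Y \<and> finite_measure (k x)) \<and>
     (\<forall>A\<in>sets Y. (\<lambda>x. emeasure (k x) A) \<in> borel_measurable X)"

lemma finite_kernelD:
  assumes "finite_kernel X Y k" "x \<in> space X"
  shows "sets (k x) = sets Y" "finite_measure (k x)" "sigma_finite_measure (k x)" "space (k x) = space Y"
proof -
  show 1: "sets (k x) = sets Y" "finite_measure (k x)"
    using assms by (auto simp: finite_kernel_def)
  then show "sigma_finite_measure (k x)" by (simp add: finite_measure.axioms(1))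
  show "space (k x) = space Y" using 1(1) by (rule sets_eq_imp_space_eq)
qed

lemma finite_kernel_compose:
  assumes "finite_kernel X Y k" "h \<in> Z \<rightarrow>\<^sub>M X"
  shows "finite_kernel Z Y (\<lambda>z. k (h z))"
  using assms measurable_space[OF assms(2)] unfolding finite_kernel_def
  by (auto intro: measurable_compose[OF assms(2), where g="\<lambda>x. emeasure (k x) _"])

text \<open>
  Requiring the whole space to be a member means that two finite measures which agree on a
  generator have the same total mass, so that Dynkin's argument applies to them directly.
\<close>

definition pi_generator :: "'a measure \<Rightarrow> 'a set set \<Rightarrow> bool" where
  "pi_generator Y G \<longleftrightarrow> Int_stable G \<and> G \<subseteq> Pow (space Y) \<and> space Y \<in> G \<and> sets Y = sigma_sets (space Y) G"

lemma pi_generatorD: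
  assumes "pi_generator Y G"
  shows "Int_stable G" "G \<subseteq> Pow (space Y)" "space Y \<in> G" "sets Y = sigma_sets (space Y) G"
    "A \<in> G \<Longrightarrow> A \<in> sets Y"
  using assms by (auto simp: pi_generator_def)

lemma pi_generator_sets: "pi_generator Y (sets Y)"
  unfolding pi_generator_def
  using sets.Int_stable[of Y] sets.space_closed[of Y] sets.sigma_sets_eq[of Y] by simp

lemma pi_generator_pair:
  assumes G: "pi_generator X G" and H: "pi_generator Y H"
  shows "pi_generator (X \<Otimes>\<^sub>M Y) {a \<times> b |a b. a \<in> G \<and> b \<in> H}"
proof -
  note G = pi_generatorD[OF G] and H = pi_generatorD[OF H]
  let ?P = "{a \<times> b |a b. a \<in> G \<and> b \<in> H}"
  have "Int_stable ?P"
    unfolding Int_stable_def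
  proof (intro ballI)
    fix p q assume "p \<in> ?P" "q \<in> ?P"
    then obtain a b a' b' where *: "p = a \<times> b" "a \<in> G" "b \<in> H" "q = a' \<times> b'" "a' \<in> G" "b' \<in> H" by auto
    then have "p \<inter> q = (a \<inter> a') \<times> (b \<inter> b')" by auto
    moreover have "a \<inter> a' \<in> G" "b \<inter> b' \<in> H" using * G(1) H(1) by (auto simp: Int_stable_def)
    ultimately show "p \<inter> q \<in> ?P" by blast
  qed
  moreover have sub: "?P \<subseteq> Pow (space X \<times> space Y)" using G(2) H(2) by blast
  moreover have "space X \<times> space Y \<in> ?P" using G(3) H(3) by blast
  moreover have "sets (X \<Otimes>\<^sub>M Y) = sigma_sets (space X \<times> space Y) ?P"
    using sets_pair_eq[OF G(2) G(4) _ _ _ H(2) H(4), of "{space X}" "{space Y}"] G(3) H(3) sub by simp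
  ultimately show ?thesis unfolding pi_generator_def space_pair_measure by blast
qed

lemma measure_eqI_pi_generator:
  assumes G: "pi_generator Y G" and sets: "sets M = sets Y" "sets N = sets Y"
    and fin: "finite_measure M"
    and eq: "\<And>A. A \<in> G \<Longrightarrow> emeasure M A = emeasure N A"
  shows "M = N"
  using pi_generatorD[OF G] sets eq finite_measure.emeasure_finite[OF fin, of "space Y"]
  by (intro measure_eqI_generator_eq[where E=G and \<Omega>="space Y" and A="\<lambda>_. space Y"]) auto

text \<open>
  The sets with a measurable mass function form a Dynkin system; complements are where
  finiteness is used.
\<close>

lemma finite_kernel_from_generator:
  assumes G: "pi_generator Y G"
    and k: "\<And>x. x \<in> space X \<Longrightarrow> sets (k x) = sets Y" "\<And>x. x \<in> space X \<Longrightarrow> finite_measure (k x)"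
    and meas: "\<And>A. A \<in> G \<Longrightarrow> (\<lambda>x. emeasure (k x) A) \<in> borel_measurable X"
  shows "finite_kernel X Y k"
proof -
  note G = pi_generatorD[OF G]
  have sp: "space (k x) = space Y" if "x \<in> space X" for x
    using k(1)[OF that] by (rule sets_eq_imp_space_eq)
  have fin: "emeasure (k x) A \<noteq> \<infinity>" if "x \<in> space X" for x A
    using finite_measure.emeasure_finite[OF k(2)[OF that]] by simp
  have "(\<lambda>x. emeasure (k x) A) \<in> borel_measurable X" if "A \<in> sigma_sets (space Y) G" for A
    using G(1,2) that
  proof (induct rule: sigma_sets_induct_disjoint)
    case (basic A) then show ?case by (rule meas)
  next
    case empty then show ?case by simp
  next
    case (compl A)
    have "(\<lambda>x. emeasure (k x) (space Y - A)) \<in> borel_measurable X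
      \<longleftrightarrow> (\<lambda>x. emeasure (k x) (space Y) - emeasure (k x) A) \<in> borel_measurable X"
    proof (rule measurable_cong)
      fix x assume x: "x \<in> space X"
      show "emeasure (k x) (space Y - A) = emeasure (k x) (space Y) - emeasure (k x) A"
        using emeasure_compl[of A "k x"] fin[OF x] k(1)[OF x] sp[OF x] compl(1) G(4) by simp
    qed
    moreover have "(\<lambda>x. emeasure (k x) (space Y) - emeasure (k x) A) \<in> borel_measurable X"
      using meas[OF G(3)] compl(2) by measurable
    ultimately show ?case by simp
  next
    case (union A)
    have "(\<lambda>x. emeasure (k x) (\<Union>i. A i)) \<in> borel_measurable X
      \<longleftrightarrow> (\<lambda>x. \<Sum>i. emeasure (k x) (A i)) \<in> borel_measurable X"
    proof (rule measurable_cong)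
      fix x assume x: "x \<in> space X"
      show "emeasure (k x) (\<Union>i. A i) = (\<Sum>i. emeasure (k x) (A i))"
        using suminf_emeasure[of A "k x"] union(1,2) k(1)[OF x] G(4) by auto
    qed
    moreover have "(\<lambda>x. \<Sum>i. emeasure (k x) (A i)) \<in> borel_measurable X"
      using union(3) by measurable
    ultimately show ?case by simp
  qed
  then show ?thesis using k G(4) by (auto simp: finite_kernel_def)
qed

text \<open>
  The map \<open>x \<mapsto> \<delta>\<^sub>x \<otimes> k x\<close> is again a finite kernel, because its values on rectangles are
  explicit. Its value on \<open>C\<close> is the mass of the section.
\<close>

lemma finite_kernel_sections:
  assumes k: "finite_kernel X Y k" and C: "C \<in> sets (X \<Otimes>\<^sub>M Y)"
  shows "(\<lambda>x. emeasure (k x) (Pair x -` C)) \<in> borel_measurable X"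
proof -
  have fk: "finite_kernel X (X \<Otimes>\<^sub>M Y) (\<lambda>x. distr (k x) (X \<Otimes>\<^sub>M Y) (Pair x))"
  proof (rule finite_kernel_from_generator[OF pi_generator_pair[OF pi_generator_sets pi_generator_sets]])
    fix x assume x: "x \<in> space X"
    note kx = finite_kernelD[OF k x]
    have "Pair x \<in> k x \<rightarrow>\<^sub>M X \<Otimes>\<^sub>M Y"
      using x by (simp cong: measurable_cong_sets add: kx(1))
    then show "finite_measure (distr (k x) (X \<Otimes>\<^sub>M Y) (Pair x))"
      using kx(2) by (simp add: finite_measure.finite_measure_distr)
  next
    fix A assume "A \<in> {a \<times> b |a b. a \<in> sets X \<and> b \<in> sets Y}"
    then obtain a b where A: "A = a \<times> b" and ab[measurable]: "a \<in> sets X" "b \<in> sets Y" by auto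
    have "(\<lambda>x. emeasure (distr (k x) (X \<Otimes>\<^sub>M Y) (Pair x)) A) \<in> borel_measurable X \<longleftrightarrow>
       (\<lambda>x. indicator a x * emeasure (k x) b) \<in> borel_measurable X"
    proof (rule measurable_cong)
      fix x assume x: "x \<in> space X"
      note kx = finite_kernelD[OF k x]
      have "Pair x \<in> k x \<rightarrow>\<^sub>M X \<Otimes>\<^sub>M Y"
        using x by (simp cong: measurable_cong_sets add: kx(1))
      then have "emeasure (distr (k x) (X \<Otimes>\<^sub>M Y) (Pair x)) A = emeasure (k x) (Pair x -` A \<inter> space Y)"
        using ab by (simp add: A emeasure_distr kx(4))
      also have "Pair x -` A \<inter> space Y = (if x \<in> a then b else {})"
        using sets.sets_into_space[OF ab(2)] by (auto simp: A)
      finally show "emeasure (distr (k x) (X \<Otimes>\<^sub>M Y) (Pair x)) A = indicator a x * emeasure (k x) b"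
        by simp
    qed
    moreover have "(\<lambda>x. emeasure (k x) b) \<in> borel_measurable X"
      using k ab by (auto simp: finite_kernel_def)
    ultimately show "(\<lambda>x. emeasure (distr (k x) (X \<Otimes>\<^sub>M Y) (Pair x)) A) \<in> borel_measurable X"
      by simp
  qed simp
  have "(\<lambda>x. emeasure (k x) (Pair x -` C)) \<in> borel_measurable X \<longleftrightarrow>
      (\<lambda>x. emeasure (distr (k x) (X \<Otimes>\<^sub>M Y) (Pair x)) C) \<in> borel_measurable X"
  proof (rule measurable_cong)
    fix x assume x: "x \<in> space X"
    note kx = finite_kernelD[OF k x]
    have "Pair x \<in> k x \<rightarrow>\<^sub>M X \<Otimes>\<^sub>M Y"
      using x by (simp cong: measurable_cong_sets add: kx(1))
    moreover have "Pair x -` C \<inter> space Y = Pair x -` C"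
      using sets.sets_into_space[OF C] by (auto simp: space_pair_measure)
    ultimately show "emeasure (k x) (Pair x -` C) = emeasure (distr (k x) (X \<Otimes>\<^sub>M Y) (Pair x)) C"
      using C by (simp add: emeasure_distr kx(4))
  qed
  then show ?thesis using fk C by (auto simp: finite_kernel_def)
qed

lemma measurable_nn_integral_finite_kernel:
  assumes k: "finite_kernel X Y k"
    and f: "case_prod f \<in> borel_measurable (X \<Otimes>\<^sub>M Y)"
  shows "(\<lambda>x. \<integral>\<^sup>+y. f x y \<partial>k x) \<in> borel_measurable X"
proof -
  have "(\<lambda>x. \<integral>\<^sup>+y. g (x, y) \<partial>k x) \<in> borel_measurable X" if "g \<in> borel_measurable (X \<Otimes>\<^sub>M Y)" for g
    using that
  proof (induct rule: borel_measurable_induct)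
    case (cong f g)
    have "(\<lambda>x. \<integral>\<^sup>+y. f (x, y) \<partial>k x) \<in> borel_measurable X \<longleftrightarrow> (\<lambda>x. \<integral>\<^sup>+y. g (x, y) \<partial>k x) \<in> borel_measurable X"
      by (intro measurable_cong nn_integral_cong cong(3))
        (auto simp: space_pair_measure finite_kernelD(4)[OF k])
    then show ?case using cong by simp
  next
    case (set A)
    have "(\<lambda>x. \<integral>\<^sup>+y. indicator A (x, y) \<partial>k x) \<in> borel_measurable X \<longleftrightarrow>
        (\<lambda>x. emeasure (k x) (Pair x -` A)) \<in> borel_measurable X"
    proof (rule measurable_cong)
      fix x assume x: "x \<in> space X"
      have "(\<integral>\<^sup>+y. indicator A (x, y) \<partial>k x) = (\<integral>\<^sup>+y. indicator (Pair x -` A) y \<partial>k x)"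
        by (intro nn_integral_cong) (auto split: split_indicator)
      also have "\<dots> = emeasure (k x) (Pair x -` A)"
        using sets_Pair1[OF set] finite_kernelD(1)[OF k x] by simp
      finally show "(\<integral>\<^sup>+y. indicator A (x, y) \<partial>k x) = emeasure (k x) (Pair x -` A)" .
    qed
    then show ?case using finite_kernel_sections[OF k set] by simp
  next
    case (mult u c)
    have "(\<lambda>x. \<integral>\<^sup>+y. c * u (x, y) \<partial>k x) \<in> borel_measurable X \<longleftrightarrow>
        (\<lambda>x. c * \<integral>\<^sup>+y. u (x, y) \<partial>k x) \<in> borel_measurable X"
    proof (intro measurable_cong nn_integral_cmult)
      fix x assume x: "x \<in> space X"
      show "(\<lambda>y. u (x, y)) \<in> borel_measurable (k x)"
        using measurable_Pair_compose_split[of "curry u" X Y borel "\<lambda>_. x" Y id] mult(2) x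
        by (simp cong: measurable_cong_sets add: finite_kernelD[OF k x])
    qed
    then show ?case using mult(4) by simp
  next
    case (add u v)
    have "(\<lambda>x. \<integral>\<^sup>+y. v (x, y) + u (x, y) \<partial>k x) \<in> borel_measurable X \<longleftrightarrow>
        (\<lambda>x. (\<integral>\<^sup>+y. v (x, y) \<partial>k x) + (\<integral>\<^sup>+y. u (x, y) \<partial>k x)) \<in> borel_measurable X"
    proof (intro measurable_cong nn_integral_add)
      fix x assume x: "x \<in> space X"
      show "(\<lambda>y. u (x, y)) \<in> borel_measurable (k x)" "(\<lambda>y. v (x, y)) \<in> borel_measurable (k x)"
        using measurable_compose[OF measurable_Pair1'[OF x, of Y]] add x
        by (auto cong: measurable_cong_sets simp: finite_kernelD[OF k x])
    qed
    then show ?case using add by simp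
  next
    case (seq U)
    have "(\<lambda>x. \<integral>\<^sup>+y. (SUP i. U i) (x, y) \<partial>k x) \<in> borel_measurable X \<longleftrightarrow>
        (\<lambda>x. SUP i. \<integral>\<^sup>+y. U i (x, y) \<partial>k x) \<in> borel_measurable X"
    proof (rule measurable_cong)
      fix x assume x: "x \<in> space X"
      have "(\<lambda>y. U i (x, y)) \<in> borel_measurable (k x)" for i
        using measurable_compose[OF measurable_Pair1'[OF x, of Y]] seq x
        by (auto cong: measurable_cong_sets simp: finite_kernelD[OF k x])
      then show "(\<integral>\<^sup>+y. (SUP i. U i) (x, y) \<partial>k x) = (SUP i. \<integral>\<^sup>+y. U i (x, y) \<partial>k x)"
        using seq by (subst nn_integral_monotone_convergence_SUP[symmetric])
          (auto simp: incseq_def le_fun_def image_comp)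
    qed
    then show ?case using seq by simp
  qed
  from this[OF f] show ?thesis by simp
qed

section \<open>Semidirect products\<close>

text \<open>
  The measure \<open>k(x,dy) \<nu>(dx)\<close>. For Lebesgue measure \<open>\<nu>\<close> it is the measure attached to
  a kernel in the definition of the collision measures and of the heat flow. There \<open>k x\<close> may be
  an infinite measure, for which the measurability in \<open>x\<close> of the masses of sections is not automatic; below it
  is a hypothesis.
\<close>

definition semidirect :: "'a measure \<Rightarrow> 'b measure \<Rightarrow> ('a \<Rightarrow> 'b measure) \<Rightarrow> ('a \<times> 'b) measure" where
  "semidirect \<nu> Y k = measure_of (space \<nu> \<times> space Y) (sets (\<nu> \<Otimes>\<^sub>M Y))
     (\<lambda>C. \<integral>\<^sup>+x. emeasure (k x) (Pair x -` C) \<partial>\<nu>)"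

lemma sets_semidirect: "sets (semidirect \<nu> Y k) = sets (\<nu> \<Otimes>\<^sub>M Y)"
  unfolding semidirect_def using sets.space_closed[of "\<nu> \<Otimes>\<^sub>M Y"]
  by (metis sets.sets_measure_of_eq space_pair_measure)

lemma emeasure_semidirect:
  assumes k: "\<And>x. x \<in> space \<nu> \<Longrightarrow> sets (k x) = sets Y"
    and meas: "\<And>C. C \<in> sets (\<nu> \<Otimes>\<^sub>M Y) \<Longrightarrow> (\<lambda>x. emeasure (k x) (Pair x -` C)) \<in> borel_measurable \<nu>"
    and C: "C \<in> sets (\<nu> \<Otimes>\<^sub>M Y)"
  shows "emeasure (semidirect \<nu> Y k) C = (\<integral>\<^sup>+x. emeasure (k x) (Pair x -` C) \<partial>\<nu>)"
proof (rule emeasure_measure_of[OF semidirect_def])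
  show "sets (\<nu> \<Otimes>\<^sub>M Y) \<subseteq> Pow (space \<nu> \<times> space Y)"
    using sets.space_closed[of "\<nu> \<Otimes>\<^sub>M Y"] by (simp add: space_pair_measure)
  show "C \<in> sets (semidirect \<nu> Y k)" using C by (simp add: sets_semidirect)
  show "positive (sets (semidirect \<nu> Y k)) (\<lambda>C. \<integral>\<^sup>+x. emeasure (k x) (Pair x -` C) \<partial>\<nu>)"
    by (simp add: positive_def)
  show "countably_additive (sets (semidirect \<nu> Y k)) (\<lambda>C. \<integral>\<^sup>+x. emeasure (k x) (Pair x -` C) \<partial>\<nu>)"
    unfolding sets_semidirect
  proof (rule countably_additiveI)
    fix A :: "nat \<Rightarrow> _" assume A: "range A \<subseteq> sets (\<nu> \<Otimes>\<^sub>M Y)" "disjoint_family A"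
    have "(\<Sum>i. \<integral>\<^sup>+x. emeasure (k x) (Pair x -` A i) \<partial>\<nu>) = (\<integral>\<^sup>+x. (\<Sum>i. emeasure (k x) (Pair x -` A i)) \<partial>\<nu>)"
      using A by (intro nn_integral_suminf[symmetric] meas) auto
    also have "\<dots> = (\<integral>\<^sup>+x. emeasure (k x) (Pair x -` (\<Union>i. A i)) \<partial>\<nu>)"
    proof (intro nn_integral_cong)
      fix x assume x: "x \<in> space \<nu>"
      have "(\<Sum>i. emeasure (k x) (Pair x -` A i)) = emeasure (k x) (\<Union>i. Pair x -` A i)"
        using A k[OF x] by (intro suminf_emeasure) (auto simp: disjoint_family_on_def intro!: sets_Pair1)
      then show "(\<Sum>i. emeasure (k x) (Pair x -` A i)) = emeasure (k x) (Pair x -` (\<Union>i. A i))"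
        by (simp add: vimage_UN)
    qed
    finally show "(\<Sum>i. \<integral>\<^sup>+x. emeasure (k x) (Pair x -` A i) \<partial>\<nu>) = (\<integral>\<^sup>+x. emeasure (k x) (Pair x -` (\<Union>i. A i)) \<partial>\<nu>)" .
  qed
qed

lemma nn_integral_semidirect:
  assumes k: "\<And>x. x \<in> space \<nu> \<Longrightarrow> sets (k x) = sets Y"
    and meas: "\<And>f. case_prod f \<in> borel_measurable (\<nu> \<Otimes>\<^sub>M Y) \<Longrightarrow> (\<lambda>x. \<integral>\<^sup>+y. f x y \<partial>k x) \<in> borel_measurable \<nu>"
    and f: "f \<in> borel_measurable (\<nu> \<Otimes>\<^sub>M Y)"
  shows "(\<integral>\<^sup>+z. f z \<partial>semidirect \<nu> Y k) = (\<integral>\<^sup>+x. \<integral>\<^sup>+y. f (x, y) \<partial>k x \<partial>\<nu>)"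
proof -
  have sec_eq: "(\<integral>\<^sup>+y. indicator C (x, y) \<partial>k x) = emeasure (k x) (Pair x -` C)"
    if "C \<in> sets (\<nu> \<Otimes>\<^sub>M Y)" "x \<in> space \<nu>" for x C
  proof -
    have "(\<integral>\<^sup>+y. indicator C (x, y) \<partial>k x) = (\<integral>\<^sup>+y. indicator (Pair x -` C) y \<partial>k x)"
      by (intro nn_integral_cong) (auto split: split_indicator)
    then show ?thesis using sets_Pair1[OF that(1)] k[OF that(2)] by simp
  qed
  have sec: "(\<lambda>x. emeasure (k x) (Pair x -` C)) \<in> borel_measurable \<nu>" if C: "C \<in> sets (\<nu> \<Otimes>\<^sub>M Y)" for C
    using meas[of "\<lambda>x y. indicator C (x, y)"] C by (simp add: sec_eq cong: measurable_cong)
  have meas': "(\<lambda>x. \<integral>\<^sup>+y. f (x, y) \<partial>k x) \<in> borel_measurable \<nu>" if "f \<in> borel_measurable (\<nu> \<Otimes>\<^sub>M Y)" for f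
    using meas[of "\<lambda>x y. f (x, y)"] that by simp
  have slice: "(\<lambda>y. f (x, y)) \<in> borel_measurable (k x)" if "f \<in> borel_measurable (\<nu> \<Otimes>\<^sub>M Y)" "x \<in> space \<nu>" for f x
    using measurable_compose[OF measurable_Pair1'[OF that(2), of Y] that(1)] k[OF that(2)]
    by (simp cong: measurable_cong_sets)
  note cong_sets = sets_semidirect[of \<nu> Y k]
  have sp: "space (semidirect \<nu> Y k) = space (\<nu> \<Otimes>\<^sub>M Y)" by (rule sets_eq_imp_space_eq[OF cong_sets])
  have ms: "g \<in> borel_measurable (semidirect \<nu> Y k)" if "g \<in> borel_measurable (\<nu> \<Otimes>\<^sub>M Y)" for g :: "_ \<Rightarrow> ennreal"
    using that by (simp cong: measurable_cong_sets add: cong_sets)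
  from f show ?thesis
  proof (induct rule: borel_measurable_induct)
    case (cong f g)
    have sk: "space (k x) = space Y" if "x \<in> space \<nu>" for x
      using k[OF that] by (rule sets_eq_imp_space_eq)
    have "(\<integral>\<^sup>+z. f z \<partial>semidirect \<nu> Y k) = (\<integral>\<^sup>+z. g z \<partial>semidirect \<nu> Y k)"
      using cong(3) by (intro nn_integral_cong) (simp add: sp)
    moreover have "(\<integral>\<^sup>+x. \<integral>\<^sup>+y. f (x, y) \<partial>k x \<partial>\<nu>) = (\<integral>\<^sup>+x. \<integral>\<^sup>+y. g (x, y) \<partial>k x \<partial>\<nu>)"
      using cong(3) by (intro nn_integral_cong) (simp add: space_pair_measure sk)
    ultimately show ?case using cong(4) by simp
  next
    case (set A)
    then have "(\<integral>\<^sup>+z. indicator A z \<partial>semidirect \<nu> Y k) = (\<integral>\<^sup>+x. emeasure (k x) (Pair x -` A) \<partial>\<nu>)"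
      using emeasure_semidirect[OF k sec set] by (simp add: cong_sets)
    then show ?case using set by (simp add: sec_eq cong: nn_integral_cong)
  next
    case (mult u c)
    have "(\<integral>\<^sup>+x. \<integral>\<^sup>+y. c * u (x, y) \<partial>k x \<partial>\<nu>) = (\<integral>\<^sup>+x. c * \<integral>\<^sup>+y. u (x, y) \<partial>k x \<partial>\<nu>)"
      using mult(2) by (intro nn_integral_cong nn_integral_cmult slice)
    also have "\<dots> = c * (\<integral>\<^sup>+x. \<integral>\<^sup>+y. u (x, y) \<partial>k x \<partial>\<nu>)"
      using mult(2) by (intro nn_integral_cmult meas')
    finally show ?case using nn_integral_cmult[OF ms[OF mult(2)], of c] mult(4) by simp
  next
    case (add u v)
    have "(\<integral>\<^sup>+x. \<integral>\<^sup>+y. v (x, y) + u (x, y) \<partial>k x \<partial>\<nu>) = (\<integral>\<^sup>+x. (\<integral>\<^sup>+y. v (x, y) \<partial>k x) + (\<integral>\<^sup>+y. u (x, y) \<partial>k x) \<partial>\<nu>)"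
      using add by (intro nn_integral_cong nn_integral_add slice)
    also have "\<dots> = (\<integral>\<^sup>+x. \<integral>\<^sup>+y. v (x, y) \<partial>k x \<partial>\<nu>) + (\<integral>\<^sup>+x. \<integral>\<^sup>+y. u (x, y) \<partial>k x \<partial>\<nu>)"
      using add by (intro nn_integral_add meas')
    finally show ?case using nn_integral_add[OF ms[OF add(4)] ms[OF add(1)]] add by simp
  next
    case (seq U)
    have "(\<integral>\<^sup>+z. (SUP i. U i) z \<partial>semidirect \<nu> Y k) = (SUP i. \<integral>\<^sup>+z. U i z \<partial>semidirect \<nu> Y k)"
      unfolding SUP_apply using seq by (intro nn_integral_monotone_convergence_SUP ms) auto
    also have "\<dots> = (SUP i. \<integral>\<^sup>+x. \<integral>\<^sup>+y. U i (x, y) \<partial>k x \<partial>\<nu>)" by (simp add: seq)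
    also have "\<dots> = (\<integral>\<^sup>+x. (SUP i. \<integral>\<^sup>+y. U i (x, y) \<partial>k x) \<partial>\<nu>)"
      using seq by (intro nn_integral_monotone_convergence_SUP[symmetric] meas')
        (auto simp: incseq_def le_fun_def intro!: nn_integral_mono)
    also have "\<dots> = (\<integral>\<^sup>+x. \<integral>\<^sup>+y. (SUP i. U i) (x, y) \<partial>k x \<partial>\<nu>)"
      unfolding SUP_apply using seq
      by (intro nn_integral_cong nn_integral_monotone_convergence_SUP[symmetric] slice)
        (auto simp: incseq_def le_fun_def)
    finally show ?case .
  qed
qed

lemma nn_integral_semidirect_kernel:
  assumes k: "finite_kernel \<nu> Y k" and f: "f \<in> borel_measurable (\<nu> \<Otimes>\<^sub>M Y)"
  shows "(\<integral>\<^sup>+z. f z \<partial>semidirect \<nu> Y k) = (\<integral>\<^sup>+x. \<integral>\<^sup>+y. f (x, y) \<partial>k x \<partial>\<nu>)"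
  using f by (intro nn_integral_semidirect finite_kernelD(1)[OF k] measurable_nn_integral_finite_kernel[OF k])

lemma emeasure_semidirect_Times:
  assumes k: "finite_kernel \<nu> Y k" and "B \<in> sets \<nu>" "A \<in> sets Y"
  shows "emeasure (semidirect \<nu> Y k) (B \<times> A) = (\<integral>\<^sup>+x\<in>B. emeasure (k x) A \<partial>\<nu>)"
proof -
  have "emeasure (semidirect \<nu> Y k) (B \<times> A) = (\<integral>\<^sup>+x. emeasure (k x) (Pair x -` (B \<times> A)) \<partial>\<nu>)"
    using assms(2,3) by (intro emeasure_semidirect finite_kernelD(1)[OF k] finite_kernel_sections[OF k]) auto
  also have "\<dots> = (\<integral>\<^sup>+x\<in>B. emeasure (k x) A \<partial>\<nu>)"
    by (intro nn_integral_cong) (auto split: split_indicator)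
  finally show ?thesis .
qed

text \<open>
  A disintegration needs to be verified on a generator of each factor only. With countable
  generators this is what allows exceptional null sets to be collected.
\<close>

lemma eq_semidirectI:
  assumes M: "sets M = sets (\<nu> \<Otimes>\<^sub>M Y)" "finite_measure M" and k: "finite_kernel \<nu> Y k"
    and G: "pi_generator \<nu> H" "pi_generator Y G"
    and eq: "\<And>B A. B \<in> H \<Longrightarrow> A \<in> G \<Longrightarrow> emeasure M (B \<times> A) = (\<integral>\<^sup>+x\<in>B. emeasure (k x) A \<partial>\<nu>)"
  shows "M = semidirect \<nu> Y k"
proof (rule measure_eqI_pi_generator[OF pi_generator_pair[OF G] M(1) sets_semidirect M(2)])
  fix C assume "C \<in> {a \<times> b |a b. a \<in> H \<and> b \<in> G}"
  then obtain B A where C: "C = B \<times> A" "B \<in> H" "A \<in> G" by blast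
  then show "emeasure M C = emeasure (semidirect \<nu> Y k) C"
    using emeasure_semidirect_Times[OF k] eq pi_generatorD(5)[OF G(1)] pi_generatorD(5)[OF G(2)] by simp
qed

section \<open>Disintegration on standard spaces\<close>

text \<open>
  The classical construction of a conditional distribution function: Radon--Nikodym
  densities of \<open>B \<mapsto> M (B \<times> {..q})\<close> for rational \<open>q\<close> are almost everywhere monotone in \<open>q\<close>, and their
  limits from the right define a Stieltjes measure on the line for almost every \<open>x\<close>.
\<close>

lemma disintegration_real:
  fixes M :: "('a \<times> real) measure" and \<nu> :: "'a measure"
  assumes \<nu>: "sigma_finite_measure \<nu>" and sets_M: "sets M = sets (\<nu> \<Otimes>\<^sub>M borel)"
    and fin: "finite_measure M"
    and ac: "\<And>B. B \<in> null_sets \<nu> \<Longrightarrow> emeasure M (B \<times> UNIV) = 0"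
  shows "\<exists>\<kappa>. (\<forall>x. sets (\<kappa> x) = sets borel \<and> finite_measure (\<kappa> x)) \<and>
    (\<forall>A\<in>sets borel. (\<lambda>x. emeasure (\<kappa> x) A) \<in> borel_measurable \<nu>) \<and>
    (\<forall>B\<in>sets \<nu>. \<forall>A\<in>sets borel. emeasure M (B \<times> A) = (\<integral>\<^sup>+x\<in>B. emeasure (\<kappa> x) A \<partial>\<nu>))"
proof -
  interpret \<nu>: sigma_finite_measure \<nu> by fact
  interpret M: finite_measure M by fact
  have rect[measurable]: "B \<times> A \<in> sets M" if "B \<in> sets \<nu>" "A \<in> sets borel" for A B
    using that by (simp add: sets_M)
  have "\<exists>g. g \<in> borel_measurable \<nu> \<and> (\<forall>B\<in>sets \<nu>. emeasure M (B \<times> A) = (\<integral>\<^sup>+x\<in>B. g x \<partial>\<nu>))"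
    if A: "A \<in> sets borel" for A
  proof -
    define N where "N = distr (density M (indicator (space \<nu> \<times> A))) \<nu> fst"
    have fst: "fst \<in> M \<rightarrow>\<^sub>M \<nu>"
      using sets_M by (simp cong: measurable_cong_sets)
    have N: "emeasure N B = emeasure M (B \<times> A)" if B: "B \<in> sets \<nu>" for B
    proof -
      have "emeasure N B = emeasure (density M (indicator (space \<nu> \<times> A))) (B \<times> UNIV)"
      proof -
        have "fst -` B \<inter> space M = B \<times> UNIV"
          using sets.sets_into_space[OF B] sets_eq_imp_space_eq[OF sets_M] by (auto simp: space_pair_measure)
        then show ?thesis unfolding N_def using B fst by (subst emeasure_distr) auto
      qed
      also have "\<dots> = (\<integral>\<^sup>+z. indicator (space \<nu> \<times> A) z * indicator (B \<times> UNIV) z \<partial>M)"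
        using A B by (intro emeasure_density) auto
      also have "\<dots> = (\<integral>\<^sup>+z. indicator (B \<times> A) z \<partial>M)"
        using sets.sets_into_space[OF B] by (intro nn_integral_cong) (auto split: split_indicator)
      finally show ?thesis using A B by simp
    qed
    have "absolutely_continuous \<nu> N"
    proof (unfold absolutely_continuous_def, rule subsetI)
      fix B assume B: "B \<in> null_sets \<nu>"
      have "emeasure M (B \<times> A) \<le> emeasure M (B \<times> UNIV)"
        using B by (intro emeasure_mono) auto
      then show "B \<in> null_sets N" using ac[OF B] N[of B] B by (auto simp: N_def null_sets_def)
    qed
    moreover have "sets N = sets \<nu>" by (simp add: N_def)
    ultimately obtain g where "g \<in> borel_measurable \<nu>" "density \<nu> g = N"
      using \<nu>.Radon_Nikodym by blast
    then show ?thesis using N by (intro exI[of _ g]) (auto simp: emeasure_density[symmetric])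
  qed
  then obtain dens where dens_meas[measurable]: "\<And>A. A \<in> sets borel \<Longrightarrow> dens A \<in> borel_measurable \<nu>"
    and dens: "\<And>A B. A \<in> sets borel \<Longrightarrow> B \<in> sets \<nu> \<Longrightarrow> emeasure M (B \<times> A) = (\<integral>\<^sup>+x\<in>B. dens A x \<partial>\<nu>)"
    by metis
  have dens_int: "(\<integral>\<^sup>+x. dens A x \<partial>\<nu>) = emeasure M (space \<nu> \<times> A)" if "A \<in> sets borel" for A
    using dens[OF that sets.top] by (auto intro!: nn_integral_cong)
  \<comment> \<open>For \<open>A \<subseteq> A'\<close> the density of \<open>A'\<close> is that of \<open>A\<close> plus the nonnegative density of \<open>A' - A\<close>.\<close>
  have dens_mono: "AE x in \<nu>. dens A x \<le> dens A' x"
    if [measurable]: "A \<in> sets borel" "A' \<in> sets borel" and AA': "A \<subseteq> A'" for A A'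
  proof -
    have "AE x in \<nu>. dens A x + dens (A' - A) x = dens A' x"
    proof (rule \<nu>.density_unique)
      show "density \<nu> (\<lambda>x. dens A x + dens (A' - A) x) = density \<nu> (dens A')"
      proof (rule measure_eqI)
        fix B assume "B \<in> sets (density \<nu> (\<lambda>x. dens A x + dens (A' - A) x))"
        then have B[measurable]: "B \<in> sets \<nu>" by simp
        have "emeasure M (B \<times> A') = emeasure M (B \<times> A) + emeasure M (B \<times> (A' - A))"
          using AA' by (subst plus_emeasure) (auto intro!: arg_cong[where f="emeasure M"])
        then show "emeasure (density \<nu> (\<lambda>x. dens A x + dens (A' - A) x)) B = emeasure (density \<nu> (dens A')) B"
          by (simp add: emeasure_density dens distrib_right nn_integral_add)
      qed simp
    qed auto
    then show ?thesis by eventually_elim (metis le_iff_add)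
  qed
  define D where "D = dens UNIV"
  have [measurable]: "D \<in> borel_measurable \<nu>" unfolding D_def by measurable
  have D_fin: "AE x in \<nu>. D x \<noteq> \<infinity>"
    using dens_int[of UNIV] by (intro nn_integral_PInf_AE) (auto simp: D_def)
  define g where "g r = dens {..r}" for r :: real
  have g_meas[measurable]: "g r \<in> borel_measurable \<nu>" for r unfolding g_def by measurable
  define good where "good x \<longleftrightarrow> (\<forall>p\<in>\<rat>. \<forall>q\<in>\<rat>. p \<le> q \<longrightarrow> g p x \<le> g q x) \<and> (\<forall>q\<in>\<rat>. g q x \<le> D x) \<and>
     D x \<noteq> \<infinity> \<and> (INF n::nat. g (- real n) x) = 0" for x
  have cR: "countable (\<rat>::real set)" by (rule countable_rat)
  have AE_good: "AE x in \<nu>. good x"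
  proof -
    have "AE x in \<nu>. (INF n::nat. g (- real n) x) = 0"
    proof -
      have "(\<integral>\<^sup>+x. (INF n::nat. g (- real n) x) \<partial>\<nu>) = (INF n::nat. \<integral>\<^sup>+x. g (- real n) x \<partial>\<nu>)"
        by (intro nn_integral_monotone_convergence_INF_AE')
          (auto simp: g_def dens_int less_top[symmetric] intro!: dens_mono)
      also have "\<dots> = (INF n::nat. emeasure M (space \<nu> \<times> {..- real n}))"
        by (simp add: g_def dens_int)
      also have "\<dots> = emeasure M (\<Inter>n::nat. space \<nu> \<times> {..- real n})"
        by (intro INF_emeasure_decseq) (auto simp: decseq_def)
      also have "(\<Inter>n::nat. space \<nu> \<times> {..- real n}) = {}"
      proof -
        have "\<exists>n::nat. \<not> r \<le> - real n" for r :: real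
          by (metis minus_less_iff not_le reals_Archimedean2)
        then show ?thesis by fastforce
      qed
      finally have "(\<integral>\<^sup>+x. (INF n::nat. g (- real n) x) \<partial>\<nu>) = 0" by simp
      then show ?thesis by (rule nn_integral_0_iff_AE[THEN iffD1, rotated]) measurable
    qed
    moreover have "AE x in \<nu>. \<forall>p\<in>\<rat>. \<forall>q\<in>\<rat>. p \<le> q \<longrightarrow> g p x \<le> g q x"
      by (subst AE_ball_countable[OF cR], intro ballI, subst AE_ball_countable[OF cR], intro ballI)
        (auto intro!: AE_impI dens_mono simp: g_def)
    moreover have "AE x in \<nu>. \<forall>q\<in>\<rat>. g q x \<le> D x"
      by (subst AE_ball_countable[OF cR], intro ballI) (auto intro!: dens_mono simp: g_def D_def)
    ultimately show ?thesis using D_fin by eventually_elim (auto simp: good_def)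
  qed
  have [measurable]: "Measurable.pred \<nu> good"
    unfolding good_def[abs_def] using cR by measurable
  \<comment> \<open>The right-continuous version of the distribution function; \<open>F\<close> below is its real-valued form.\<close>
  define G where "G r x = (INF q\<in>{q\<in>\<rat>. r < q}. g q x)" for r x
  have [measurable]: "G r \<in> borel_measurable \<nu>" for r
    unfolding G_def using countable_subset[OF _ cR, of "{q\<in>\<rat>. r < q}"] by (intro borel_measurable_INF) auto
  have G_mono: "G r x \<le> G r' x" if "r \<le> r'" for r r' x
    unfolding G_def using that by (intro INF_superset_mono) auto
  have G_le: "G r x \<le> g q x" if "q \<in> \<rat>" "r < q" for r q x
    unfolding G_def using that by (intro INF_lower) auto
  have ex_rat: "\<exists>q\<in>\<rat>. r < q \<and> q < r'" if "r < r'" for r r' :: real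
    using Rats_dense_in_real[OF that] by auto
  have G_D: "G r x \<le> D x" if "good x" for r x
  proof -
    obtain q where q: "q \<in> \<rat>" "r < q" using ex_rat[of r "r+1"] by auto
    show ?thesis using G_le[OF q, of x] that q(1) by (auto simp: good_def intro: order_trans)
  qed
  have G_fin: "G r x \<noteq> \<infinity>" if "good x" for r x
    using G_D[OF that, of r] that by (auto simp: good_def top_unique)
  define F where "F x r = enn2real (G r x)" for x r
  have F: "ennreal (F x r) = G r x" if "good x" for x r
    using G_fin[OF that, of r] by (simp add: F_def less_top)
  have F_mono: "F x r \<le> F x r'" if "good x" "r \<le> r'" for x r r'
    unfolding F_def using G_mono[OF that(2), of x] G_fin[OF that(1), of r'] by (intro enn2real_mono) (auto simp: less_top)
  have F_right: "continuous (at_right r) (F x)" if x: "good x" for x r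
  proof (subst continuous_at_right_real_increasing)
    show "F x p \<le> F x q" if "p \<le> q" for p q using F_mono[OF x that] .
    show "\<forall>e>0. \<exists>d>0. F x (r + d) - F x r < e"
    proof (intro allI impI)
      fix e :: real assume e: "e > 0"
      have "0 \<le> F x r" by (simp add: F_def)
      then have "G r x < ennreal (F x r + e)"
        using e F[OF x, of r, symmetric] by (simp add: ennreal_less_iff)
      then obtain q where q: "q \<in> \<rat>" "r < q" "g q x < ennreal (F x r + e)"
        unfolding G_def by (auto simp: INF_less_iff)
      have "ennreal (F x (r + (q - r) / 2)) \<le> g q x"
        unfolding F[OF x] using q by (intro G_le) (auto simp: field_simps)
      then have "ennreal (F x (r + (q - r) / 2)) < ennreal (F x r + e)" using q(3) by simp
      then have "F x (r + (q - r) / 2) < F x r + e" by (rule ennreal_less_iff[THEN iffD1, rotated]) (simp add: F_def)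
      then show "\<exists>d>0. F x (r + d) - F x r < e" using q by (intro exI[of _ "(q - r) / 2"]) auto
    qed
  qed
  have F_bot: "(F x \<longlongrightarrow> 0) at_bot" if x: "good x" for x
  proof (rule order_tendstoI)
    fix e :: real assume e: "0 < e"
    then have "(INF n::nat. g (- real n) x) < ennreal e" using x by (simp add: good_def)
    then obtain n :: nat where n: "g (- real n) x < ennreal e" by (auto simp: INF_less_iff)
    show "eventually (\<lambda>r. F x r < e) at_bot"
      unfolding eventually_at_bot_linorder
    proof (intro exI[of _ "- real n - 1"] allI impI)
      fix r assume "r \<le> - real n - 1"
      then have "ennreal (F x r) \<le> g (- real n) x" unfolding F[OF x] by (intro G_le) auto
      then have "ennreal (F x r) < ennreal e" using n by simp
      then show "F x r < e" by (rule ennreal_less_iff[THEN iffD1, rotated]) (simp add: F_def)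
    qed
  next
    fix e :: real assume "e < 0"
    then have "e < F x r" for r by (rule less_le_trans) (simp add: F_def)
    then show "eventually (\<lambda>r. e < F x r) at_bot" by simp
  qed
  define \<kappa> where "\<kappa> x = (if good x then interval_measure (F x) else null_measure borel)" for x
  have sets_\<kappa>: "sets (\<kappa> x) = sets borel" for x by (simp add: \<kappa>_def)
  have \<kappa>_Iic: "emeasure (\<kappa> x) {..r} = (if good x then G r x else 0)" for x r
    using emeasure_interval_measure_Iic[of "F x" r, OF F_mono F_right F_bot] F by (simp add: \<kappa>_def)
  have Iic_UN: "(\<Union>n::nat. {..real n}) = UNIV"
    using real_arch_simple by auto
  have \<kappa>_UNIV: "emeasure (\<kappa> x) UNIV = (SUP n::nat. emeasure (\<kappa> x) {..real n})" for x
    using SUP_emeasure_incseq[of "\<lambda>n. {..real n}" "\<kappa> x"] by (simp add: sets_\<kappa> incseq_def Iic_UN image_subset_iff)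
  have \<kappa>_fin: "finite_measure (\<kappa> x)" for x
  proof (rule finite_measureI)
    have "emeasure (\<kappa> x) UNIV \<le> (if good x then D x else 0)"
      unfolding \<kappa>_UNIV \<kappa>_Iic by (intro SUP_least) (auto simp: G_D)
    also have "\<dots> < \<infinity>" by (auto simp: good_def less_top)
    finally show "emeasure (\<kappa> x) (space (\<kappa> x)) \<noteq> \<infinity>"
      using sets_eq_imp_space_eq[OF sets_\<kappa>, of x] by simp
  qed
  let ?G = "insert UNIV (range atMost) :: real set set"
  have gen: "pi_generator borel ?G"
  proof -
    have "{..a} \<inter> {..b} = {..min a b}" for a b :: real by auto
    then have "Int_stable ?G" by (auto simp: Int_stable_def)
    moreover have "sigma_sets UNIV (range atMost :: real set set) = sigma_sets UNIV ?G"
      by (intro antisym sigma_sets_mono sigma_sets_mono') (auto intro: sigma_sets_top)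
    ultimately show ?thesis by (simp add: pi_generator_def borel_eq_atMost)
  qed
  have fk: "finite_kernel \<nu> borel \<kappa>"
  proof (rule finite_kernel_from_generator[OF gen])
    have Iic: "(\<lambda>x. emeasure (\<kappa> x) {..r}) \<in> borel_measurable \<nu>" for r
      unfolding \<kappa>_Iic by measurable
    then show "(\<lambda>x. emeasure (\<kappa> x) A) \<in> borel_measurable \<nu>" if "A \<in> ?G" for A
      using that by (auto simp: \<kappa>_UNIV)
  qed (use sets_\<kappa> \<kappa>_fin in auto)
  have \<kappa>_meas[measurable]: "(\<lambda>x. emeasure (\<kappa> x) A) \<in> borel_measurable \<nu>" if "A \<in> sets borel" for A
    using fk that by (auto simp: finite_kernel_def)
  have "emeasure M (B \<times> A) = (\<integral>\<^sup>+x\<in>B. emeasure (\<kappa> x) A \<partial>\<nu>)"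
    if B[measurable]: "B \<in> sets \<nu>" and A: "A \<in> ?G" for A B
  proof -
    \<comment> \<open>The sequence \<open>r + 1 / (n + 1)\<close> decreases to \<open>r\<close>. Its members need not be rational, but they
    interlace with the rationals, so that the infimum along it is almost everywhere the infimum \<open>G\<close>.\<close>
    have Iic: "emeasure M (B \<times> {..r}) = (\<integral>\<^sup>+x\<in>B. emeasure (\<kappa> x) {..r} \<partial>\<nu>)" for r
    proof -
      let ?q = "\<lambda>n::nat. r + 1 / (real n + 1)"
      have q: "r < ?q n" "?q (Suc n) \<le> ?q n" for n by (auto simp: field_simps)
      have "AE x in \<nu>. \<forall>p\<in>\<rat>. \<forall>n. (p \<le> ?q n \<longrightarrow> g p x \<le> g (?q n) x) \<and> (?q n \<le> p \<longrightarrow> g (?q n) x \<le> g p x)"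
        by (subst AE_ball_countable[OF cR], intro ballI, subst AE_all_countable)
          (auto intro!: AE_impI dens_mono AE_conjI simp: g_def)
      then have "AE x in \<nu>. (INF n. g (?q n) x) = emeasure (\<kappa> x) {..r}"
        using AE_good
      proof eventually_elim
        fix x assume h: "\<forall>p\<in>\<rat>. \<forall>n. (p \<le> ?q n \<longrightarrow> g p x \<le> g (?q n) x) \<and> (?q n \<le> p \<longrightarrow> g (?q n) x \<le> g p x)"
          and x: "good x"
        have "(INF n. g (?q n) x) = G r x"
        proof (rule antisym)
          show "(INF n. g (?q n) x) \<le> G r x"
            unfolding G_def
          proof (rule INF_mono)
            fix p assume p: "p \<in> {q \<in> \<rat>. r < q}"
            obtain n :: nat where n: "1 / (p - r) \<le> real n" using real_arch_simple by blast
            have "?q n \<le> p"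
            proof -
              have "0 < p - r" using p by simp
              then have "1 \<le> real n * (p - r)" using n by (simp add: field_simps)
              also have "\<dots> \<le> (real n + 1) * (p - r)" using \<open>0 < p - r\<close> by (simp add: field_simps)
              finally have "1 / (real n + 1) \<le> p - r" by (simp add: field_simps)
              then show ?thesis by simp
            qed
            then show "\<exists>n\<in>UNIV. g (?q n) x \<le> g p x" using h p by auto
          qed
          show "G r x \<le> (INF n. g (?q n) x)"
            unfolding G_def
          proof (rule INF_mono)
            fix n :: nat
            obtain p where "p \<in> \<rat>" "r < p" "p < ?q n" using ex_rat[OF q(1)] by auto
            then show "\<exists>p\<in>{q \<in> \<rat>. r < q}. g p x \<le> g (?q n) x" using h by (intro bexI[of _ p]) auto
          qed
        qed
        then show "(INF n. g (?q n) x) = emeasure (\<kappa> x) {..r}" using x by (simp add: \<kappa>_Iic)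
      qed
      then have "AE x in \<nu>. emeasure (\<kappa> x) {..r} * indicator B x = (INF n. g (?q n) x * indicator B x)"
        by eventually_elim (auto split: split_indicator)
      then have "(\<integral>\<^sup>+x\<in>B. emeasure (\<kappa> x) {..r} \<partial>\<nu>) = (\<integral>\<^sup>+x. (INF n. g (?q n) x * indicator B x) \<partial>\<nu>)"
        by (rule nn_integral_cong_AE)
      also have "\<dots> = (INF n. \<integral>\<^sup>+x\<in>B. g (?q n) x \<partial>\<nu>)"
      proof (intro nn_integral_monotone_convergence_INF_AE')
        fix n
        have "AE x in \<nu>. g (?q (Suc n)) x \<le> g (?q n) x"
          unfolding g_def using q(2)[of n] by (intro dens_mono) auto
        then show "AE x in \<nu>. g (?q (Suc n)) x * indicator B x \<le> g (?q n) x * indicator B x"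
          by eventually_elim (auto split: split_indicator)
      next
        show "(\<integral>\<^sup>+x\<in>B. g (?q 0) x \<partial>\<nu>) < \<infinity>"
          by (simp add: g_def dens[symmetric] less_top[symmetric])
      qed auto
      also have "\<dots> = (INF n. emeasure M (B \<times> {..?q n}))" by (simp add: g_def dens)
      also have "\<dots> = emeasure M (\<Inter>n. B \<times> {..?q n})"
      proof (intro INF_emeasure_decseq)
        have "decseq ?q" by (rule decseq_SucI) (rule q(2))
        then show "decseq (\<lambda>n. B \<times> {..?q n})" unfolding decseq_def by (force intro: order_trans)
      qed auto
      also have "(\<Inter>n. B \<times> {..?q n}) = B \<times> {..r}"
      proof -
        have "s \<le> r" if "\<And>n. s \<le> ?q n" for s
        proof (rule LIMSEQ_le_const)
          show "?q \<longlonglongrightarrow> r"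
            using tendsto_add[OF tendsto_const[of r] LIMSEQ_inverse_real_of_nat]
            by (simp add: inverse_eq_divide add.commute)
        qed (use that in auto)
        moreover have "s \<le> ?q n" if "s \<le> r" for s n using q(1)[of n] that by linarith
        ultimately show ?thesis by fastforce
      qed
      finally show ?thesis by simp
    qed
    have U: "emeasure M (B \<times> UNIV) = (\<integral>\<^sup>+x\<in>B. emeasure (\<kappa> x) UNIV \<partial>\<nu>)"
    proof -
      have "emeasure M (B \<times> UNIV) = emeasure M (\<Union>n::nat. B \<times> {..real n})"
        using Iic_UN by (intro arg_cong[where f="emeasure M"]) blast
      also have "\<dots> = (SUP n::nat. emeasure M (B \<times> {..real n}))"
        by (rule SUP_emeasure_incseq[symmetric]) (auto simp: incseq_def)
      also have "\<dots> = (SUP n::nat. \<integral>\<^sup>+x\<in>B. emeasure (\<kappa> x) {..real n} \<partial>\<nu>)" by (simp add: Iic)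
      also have "\<dots> = (\<integral>\<^sup>+x. (SUP n::nat. emeasure (\<kappa> x) {..real n} * indicator B x) \<partial>\<nu>)"
        by (intro nn_integral_monotone_convergence_SUP[symmetric])
          (auto simp: incseq_def le_fun_def sets_\<kappa> intro!: mult_right_mono emeasure_mono)
      also have "\<dots> = (\<integral>\<^sup>+x\<in>B. emeasure (\<kappa> x) UNIV \<partial>\<nu>)"
        by (intro nn_integral_cong) (auto simp: \<kappa>_UNIV split: split_indicator)
      finally show ?thesis .
    qed
    show ?thesis using A Iic U by auto
  qed
  then have "M = semidirect \<nu> borel \<kappa>"
    by (rule eq_semidirectI[OF sets_M fin fk pi_generator_sets gen])
  then have main: "emeasure M (B \<times> A) = (\<integral>\<^sup>+x\<in>B. emeasure (\<kappa> x) A \<partial>\<nu>)" if "B \<in> sets \<nu>" "A \<in> sets borel" for A B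
    using emeasure_semidirect_Times[OF fk that] by simp
  show ?thesis
    by (intro exI[of _ \<kappa>] conjI allI ballI sets_\<kappa> \<kappa>_fin \<kappa>_meas main)
qed

text \<open>
  The isomorphism with a Borel set \<open>S\<close> transports the problem to the line. Mass that the kernel on
  the line may put outside \<open>S\<close> (it does so for a null set of \<open>x\<close> at most) is
  discarded by restriction to \<open>S\<close>.
\<close>

lemma disintegration_exists:
  fixes M :: "('a \<times> 'e) measure" and \<nu> :: "'a measure"
  assumes E: "standard_measurable_space E"
    and \<nu>: "sigma_finite_measure \<nu>" and sets_M: "sets M = sets (\<nu> \<Otimes>\<^sub>M E)"
    and fin: "finite_measure M"
    and ac: "\<And>B. B \<in> null_sets \<nu> \<Longrightarrow> emeasure M (B \<times> space E) = 0"
  shows "\<exists>\<kappa>. (\<forall>x. sets (\<kappa> x) = sets E \<and> finite_measure (\<kappa> x)) \<and>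
    (\<forall>A\<in>sets E. (\<lambda>x. emeasure (\<kappa> x) A) \<in> borel_measurable \<nu>) \<and>
    (\<forall>B\<in>sets \<nu>. \<forall>A\<in>sets E. emeasure M (B \<times> A) = (\<integral>\<^sup>+x\<in>B. emeasure (\<kappa> x) A \<partial>\<nu>))"
proof -
  interpret M: finite_measure M by fact
  obtain S f g where S: "S \<in> sets (borel :: real measure)"
    and f: "f \<in> E \<rightarrow>\<^sub>M restrict_space borel S" and g: "g \<in> restrict_space borel S \<rightarrow>\<^sub>M E"
    and gf: "\<And>y. y \<in> space E \<Longrightarrow> g (f y) = y"
    using E unfolding standard_measurable_space_def by blast
  have f': "f \<in> E \<rightarrow>\<^sub>M borel" and fS: "\<And>y. y \<in> space E \<Longrightarrow> f y \<in> S"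
    using f measurable_space[OF f] by (auto simp: measurable_restrict_space2_iff space_restrict_space)
  let ?T = "\<lambda>(x, y). (x, f y)"
  have T: "?T \<in> M \<rightarrow>\<^sub>M \<nu> \<Otimes>\<^sub>M borel"
    using f' by (simp cong: measurable_cong_sets add: sets_M)
  define M' where "M' = distr M (\<nu> \<Otimes>\<^sub>M borel) ?T"
  have space_M: "space M = space \<nu> \<times> space E"
    using sets_eq_imp_space_eq[OF sets_M] by (simp add: space_pair_measure)
  have M': "emeasure M' (B \<times> A) = emeasure M (B \<times> (f -` A \<inter> space E))"
    if "B \<in> sets \<nu>" "A \<in> sets borel" for A B
    unfolding M'_def using that T sets.sets_into_space[OF that(1)]
    by (subst emeasure_distr) (auto simp: space_M intro!: arg_cong[where f="emeasure M"])
  have "\<exists>\<kappa>. (\<forall>x. sets (\<kappa> x) = sets borel \<and> finite_measure (\<kappa> x)) \<and>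
    (\<forall>A\<in>sets borel. (\<lambda>x. emeasure (\<kappa> x) A) \<in> borel_measurable \<nu>) \<and>
    (\<forall>B\<in>sets \<nu>. \<forall>A\<in>sets borel. emeasure M' (B \<times> A) = (\<integral>\<^sup>+x\<in>B. emeasure (\<kappa> x) A \<partial>\<nu>))"
  proof (rule disintegration_real[OF \<nu>])
    show "finite_measure M'" unfolding M'_def using T by (rule M.finite_measure_distr)
    show "emeasure M' (B \<times> UNIV) = 0" if "B \<in> null_sets \<nu>" for B
      using that ac[OF that] by (simp add: M' null_setsD2)
  qed (simp add: M'_def)
  then obtain \<kappa>' where sets_\<kappa>': "\<And>x. sets (\<kappa>' x) = sets borel" and fin_\<kappa>': "\<And>x. finite_measure (\<kappa>' x)"
    and meas_\<kappa>': "\<And>A. A \<in> sets borel \<Longrightarrow> (\<lambda>x. emeasure (\<kappa>' x) A) \<in> borel_measurable \<nu>"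
    and \<kappa>': "\<And>A B. B \<in> sets \<nu> \<Longrightarrow> A \<in> sets borel \<Longrightarrow> emeasure M' (B \<times> A) = (\<integral>\<^sup>+x\<in>B. emeasure (\<kappa>' x) A \<partial>\<nu>)"
    by blast
  define \<kappa> where "\<kappa> x = distr (restrict_space (\<kappa>' x) S) E g" for x
  have pre: "g -` A \<inter> S \<in> sets borel" if "A \<in> sets E" for A
    using measurable_sets[OF g that] S by (auto simp: space_restrict_space sets_restrict_space)
  have g': "g \<in> restrict_space (\<kappa>' x) S \<rightarrow>\<^sub>M E" for x
    using g by (subst measurable_cong_sets[OF _ refl, of _ "restrict_space borel S"])
      (simp_all add: sets_restrict_space sets_\<kappa>')
  have \<kappa>: "emeasure (\<kappa> x) A = emeasure (\<kappa>' x) (g -` A \<inter> S)" if "A \<in> sets E" for x A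
    unfolding \<kappa>_def using that g' S sets_eq_imp_space_eq[OF sets_\<kappa>', of x]
    by (subst emeasure_distr) (auto simp: space_restrict_space emeasure_restrict_space sets_\<kappa>')
  have "emeasure M (B \<times> A) = (\<integral>\<^sup>+x\<in>B. emeasure (\<kappa> x) A \<partial>\<nu>)" if A: "A \<in> sets E" and B: "B \<in> sets \<nu>" for A B
  proof -
    have "f -` (g -` A \<inter> S) \<inter> space E = A"
      using sets.sets_into_space[OF A] gf fS by auto
    then have "emeasure M (B \<times> A) = emeasure M' (B \<times> (g -` A \<inter> S))"
      using M'[OF B pre[OF A]] by simp
    then show ?thesis using \<kappa>'[OF B pre[OF A]] \<kappa>[OF A] by simp
  qed
  moreover have "finite_measure (\<kappa> x)" for x
    unfolding \<kappa>_def using fin_\<kappa>'[of x] S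
    by (intro finite_measure.finite_measure_distr[OF _ g'] finite_measure_restrict_space) (auto simp: sets_\<kappa>')
  moreover have "(\<lambda>x. emeasure (\<kappa> x) A) \<in> borel_measurable \<nu>" if "A \<in> sets E" for A
    using meas_\<kappa>'[OF pre[OF that]] \<kappa>[OF that] by simp
  ultimately show ?thesis by (intro exI[of _ \<kappa>]) (auto simp: \<kappa>_def)
qed

lemma ex_countable_generator_borel:
  "\<exists>G. countable G \<and> pi_generator (borel :: 'x::second_countable_topology measure) G"
proof -
  obtain B :: "'x set set" where B: "countable B" "topological_basis B"
    using ex_countable_basis by blast
  define G where "G = Inter ` {F. finite F \<and> F \<subseteq> B}"
  have "countable G"
    unfolding G_def using B(1) by (intro countable_image countable_Collect_finite_subset)
  moreover have "Int_stable G"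
    unfolding Int_stable_def
  proof (intro ballI)
    fix a b assume "a \<in> G" "b \<in> G"
    then obtain F F' where "a = \<Inter>F" "finite F" "F \<subseteq> B" "b = \<Inter>F'" "finite F'" "F' \<subseteq> B" unfolding G_def by auto
    then show "a \<inter> b \<in> G" unfolding G_def by (intro image_eqI[of _ _ "F \<union> F'"]) auto
  qed
  moreover have "UNIV \<in> G" unfolding G_def by (intro image_eqI[of _ _ "{}"]) auto
  moreover have "sets borel = sigma_sets UNIV G"
  proof -
    have sB: "sets (borel :: 'x measure) = sigma_sets UNIV B"
      by (simp add: borel_eq_countable_basis[OF B])
    have "B \<subseteq> G"
    proof
      fix b assume "b \<in> B" then show "b \<in> G" unfolding G_def by (intro image_eqI[of _ _ "{b}"]) auto
    qed
    moreover have "G \<subseteq> sets borel"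
    proof
      fix a assume "a \<in> G"
      then obtain F where F: "a = \<Inter>F" "finite F" "F \<subseteq> B" unfolding G_def by auto
      then have "F \<subseteq> sets borel" using sB by auto
      with \<open>finite F\<close> have "\<Inter>F \<in> sets borel" by (induction F rule: finite_induct) auto
      then show "a \<in> sets borel" by (simp add: F)
    qed
    ultimately show ?thesis
      using sB by (metis antisym sets.sigma_sets_subset sigma_sets_mono' space_borel)
  qed
  ultimately show ?thesis unfolding pi_generator_def by (intro exI[of _ G]) simp
qed

lemma ex_countable_generator_standard:
  assumes E: "standard_measurable_space E"
  shows "\<exists>G. countable G \<and> pi_generator E G"
proof -
  obtain S f g where S: "S \<in> sets (borel :: real measure)"
    and f: "f \<in> E \<rightarrow>\<^sub>M restrict_space borel S" and g: "g \<in> restrict_space borel S \<rightarrow>\<^sub>M E"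
    and gf: "\<And>y. y \<in> space E \<Longrightarrow> g (f y) = y"
    using E unfolding standard_measurable_space_def by blast
  have f': "f \<in> E \<rightarrow>\<^sub>M borel" and fS: "\<And>y. y \<in> space E \<Longrightarrow> f y \<in> S"
    using f measurable_space[OF f] by (auto simp: measurable_restrict_space2_iff space_restrict_space)
  obtain G :: "real set set" where cG: "countable G" and G: "pi_generator borel G"
    using ex_countable_generator_borel by blast
  note G = pi_generatorD[OF G]
  define H where "H = {f -` A \<inter> space E |A. A \<in> G}"
  have "sets E = {f -` A \<inter> space E |A. A \<in> sets borel}"
  proof (rule antisym)
    show "sets E \<subseteq> {f -` A \<inter> space E |A. A \<in> sets borel}"
    proof
      fix A assume A: "A \<in> sets E"
      have "g -` A \<inter> S \<in> sets borel"
        using measurable_sets[OF g A] S by (auto simp: space_restrict_space sets_restrict_space)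
      moreover have "A = f -` (g -` A \<inter> S) \<inter> space E"
        using sets.sets_into_space[OF A] gf fS by auto
      ultimately show "A \<in> {f -` A \<inter> space E |A. A \<in> sets borel}" by blast
    qed
    show "{f -` A \<inter> space E |A. A \<in> sets borel} \<subseteq> sets E"
      using measurable_sets[OF f'] by auto
  qed
  also have "\<dots> = sigma_sets (space E) H"
    unfolding H_def G(4) by (intro sigma_sets_vimage_commute) auto
  finally have "sets E = sigma_sets (space E) H" .
  moreover have "countable H"
    unfolding H_def using cG by (simp add: setcompr_eq_image)
  moreover have "Int_stable H"
    unfolding Int_stable_def
  proof (intro ballI)
    fix a b assume "a \<in> H" "b \<in> H"
    then obtain A B where AB: "a = f -` A \<inter> space E" "A \<in> G" "b = f -` B \<inter> space E" "B \<in> G" unfolding H_def by auto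
    then have "A \<inter> B \<in> G" using G(1) by (auto simp: Int_stable_def)
    then show "a \<inter> b \<in> H" unfolding H_def using AB by (intro CollectI exI[of _ "A \<inter> B"]) auto
  qed
  moreover have "space E \<in> H"
    unfolding H_def using G(3) by (intro CollectI exI[of _ UNIV]) auto
  moreover have "H \<subseteq> Pow (space E)" by (auto simp: H_def)
  ultimately show ?thesis unfolding pi_generator_def by blast
qed

text \<open>
  For each set of a countable generator the two densities agree almost everywhere; the
  countably many exceptional null sets are united.
\<close>

lemma finite_kernel_AE_unique:
  assumes \<nu>: "sigma_finite_measure \<nu>" and cG: "countable G" and G: "pi_generator Y G"
    and k: "finite_kernel \<nu> Y k" "finite_kernel \<nu> Y k'"
    and eq: "\<And>A B. A \<in> G \<Longrightarrow> B \<in> sets \<nu> \<Longrightarrow> (\<integral>\<^sup>+x\<in>B. emeasure (k x) A \<partial>\<nu>) = (\<integral>\<^sup>+x\<in>B. emeasure (k' x) A \<partial>\<nu>)"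
  shows "AE x in \<nu>. k x = k' x"
proof -
  interpret \<nu>: sigma_finite_measure \<nu> by fact
  have "AE x in \<nu>. \<forall>A\<in>G. emeasure (k x) A = emeasure (k' x) A"
    unfolding AE_ball_countable[OF cG]
  proof
    fix A assume A: "A \<in> G"
    have [measurable]: "(\<lambda>x. emeasure (k x) A) \<in> borel_measurable \<nu>" "(\<lambda>x. emeasure (k' x) A) \<in> borel_measurable \<nu>"
      using k pi_generatorD(5)[OF G A] by (auto simp: finite_kernel_def)
    show "AE x in \<nu>. emeasure (k x) A = emeasure (k' x) A"
      by (intro \<nu>.density_unique measure_eqI) (auto simp: emeasure_density eq[OF A])
  qed
  then show ?thesis
    using AE_space
  proof eventually_elim
    fix x assume eq: "\<forall>A\<in>G. emeasure (k x) A = emeasure (k' x) A" and x: "x \<in> space \<nu>"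
    show "k x = k' x"
      using finite_kernelD[OF k(1) x] finite_kernelD[OF k(2) x] eq
      by (intro measure_eqI_pi_generator[OF G]) auto
  qed
qed

section \<open>Disintegrations of states\<close>

lemma kernel_measure_eq_semidirect: "kernel_measure E \<kappa> = semidirect lborel E \<kappa>"
proof -
  have "sets (lborel \<Otimes>\<^sub>M E) = sets (borel \<Otimes>\<^sub>M E)" by (intro sets_pair_measure_cong) auto
  then show ?thesis unfolding kernel_measure_def semidirect_def by simp
qed

lemma state_spaceD:
  assumes "\<mu> \<in> state_space E"
  shows "sets \<mu> = sets (borel \<Otimes>\<^sub>M E)" "finite_measure \<mu>" "space \<mu> = UNIV \<times> space E"
    "B \<in> null_sets lborel \<Longrightarrow> emeasure \<mu> (B \<times> space E) = 0"
proof -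
  show s: "sets \<mu> = sets (borel \<Otimes>\<^sub>M E)" and "finite_measure \<mu>"
    using assms by (auto simp: state_space_def)
  show sp: "space \<mu> = UNIV \<times> space E"
    using sets_eq_imp_space_eq[OF s] by (simp add: space_pair_measure)
  assume B: "B \<in> null_sets lborel"
  then have "B \<in> null_sets (distr \<mu> borel fst)"
    using assms by (auto simp: state_space_def absolutely_continuous_def)
  moreover have "fst \<in> \<mu> \<rightarrow>\<^sub>M borel" by (simp cong: measurable_cong_sets add: s)
  moreover have "fst -` B \<inter> space \<mu> = B \<times> space E" by (auto simp: sp)
  ultimately show "emeasure \<mu> (B \<times> space E) = 0"
    using B by (auto simp: null_sets_def emeasure_distr)
qed

lemma is_disintegration_disintegration:
  assumes "standard_measurable_space E" "\<mu> \<in> state_space E"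
  shows "is_disintegration E \<mu> (disintegration E \<mu>)"
proof -
  have "\<exists>\<kappa>. is_disintegration E \<mu> \<kappa>"
    using disintegration_exists[OF assms(1) lborel.sigma_finite_measure_axioms, of \<mu>] state_spaceD[OF assms(2)]
    by (auto simp: is_disintegration_def cong: sets_pair_measure_cong)
  then show ?thesis unfolding disintegration_def by (rule someI_ex)
qed

lemma is_disintegration_finite_kernel:
  "is_disintegration E \<mu> \<kappa> \<Longrightarrow> finite_kernel lborel E \<kappa>"
  by (auto simp: is_disintegration_def finite_kernel_def)

lemma is_disintegration_AE_unique:
  fixes \<mu> :: "('x::euclidean_space \<times> 'e) measure"
  assumes E: "standard_measurable_space E"
    and \<kappa>: "is_disintegration E \<mu> \<kappa>" "is_disintegration E \<mu> \<kappa>'"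
  shows "AE x in lborel. \<kappa> x = \<kappa>' x"
proof -
  obtain G where G: "countable G" "pi_generator E G" using ex_countable_generator_standard[OF E] by blast
  show ?thesis
  proof (rule finite_kernel_AE_unique[OF lborel.sigma_finite_measure_axioms G])
    fix A and B :: "'x set" assume "A \<in> G" "B \<in> sets lborel"
    then have "A \<in> sets E" "B \<in> sets borel" using pi_generatorD(5)[OF G(2)] by auto
    then have "emeasure \<mu> (B \<times> A) = (\<integral>\<^sup>+x\<in>B. emeasure (\<kappa> x) A \<partial>lborel)"
      "emeasure \<mu> (B \<times> A) = (\<integral>\<^sup>+x\<in>B. emeasure (\<kappa>' x) A \<partial>lborel)"
      using \<kappa> unfolding is_disintegration_def by blast+
    then show "(\<integral>\<^sup>+x\<in>B. emeasure (\<kappa> x) A \<partial>lborel) = (\<integral>\<^sup>+x\<in>B. emeasure (\<kappa>' x) A \<partial>lborel)"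
      by simp
  qed (use \<kappa> is_disintegration_finite_kernel in auto)
qed

lemma borel_lborel_pair: "sets (lborel \<Otimes>\<^sub>M E) = sets (borel \<Otimes>\<^sub>M E)"
  by (intro sets_pair_measure_cong) auto

lemma is_disintegration_imp_eq:
  fixes \<mu> :: "('x::euclidean_space \<times> 'e) measure"
  assumes \<mu>: "\<mu> \<in> state_space E" and \<kappa>: "is_disintegration E \<mu> \<kappa>"
  shows "\<mu> = semidirect lborel E \<kappa>"
  using state_spaceD(1,2)[OF \<mu>] \<kappa>
  by (intro eq_semidirectI[OF _ _ is_disintegration_finite_kernel[OF \<kappa>] pi_generator_sets pi_generator_sets])
    (auto simp: borel_lborel_pair is_disintegration_def)

lemma nn_integral_disintegration:
  assumes "\<mu> \<in> state_space E" "is_disintegration E \<mu> \<kappa>"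
    and f: "f \<in> borel_measurable (borel \<Otimes>\<^sub>M E)"
  shows "(\<integral>\<^sup>+z. f z \<partial>\<mu>) = (\<integral>\<^sup>+x. \<integral>\<^sup>+y. f (x, y) \<partial>\<kappa> x \<partial>lborel)"
proof -
  have "f \<in> borel_measurable (lborel \<Otimes>\<^sub>M E)"
    using f by (simp add: measurable_cong_sets[OF borel_lborel_pair refl])
  then show ?thesis
    using nn_integral_semidirect_kernel[OF is_disintegration_finite_kernel[OF assms(2)], of f]
      is_disintegration_imp_eq[OF assms(1,2)] by simp
qed

text \<open>
  The disintegration of the measure \<open>ds \<mu>\<^sub>s(dx,dy)\<close> over \<open>(s,x)\<close>. It gives a version that is measurable
  in \<open>(s,x)\<close>, and for almost every \<open>s\<close> its restriction to time \<open>s\<close> disintegrates \<open>\<mu>\<^sub>s\<close>, since it does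
  so when tested on countable generators of both factors. The total mass of \<open>\<mu>\<^sub>s\<close> need not be
  integrable in \<open>s\<close>, so \<open>\<mu>\<^sub>s\<close> is first divided by \<open>1 + \<mu>\<^sub>s(\<real>\<^sup>d \<times> E)\<close>.
\<close>

theorem joint_disintegration:
  fixes \<mu> :: "real \<Rightarrow> ('x::euclidean_space \<times> 'e) measure"
  assumes E: "standard_measurable_space E"
    and \<mu>: "\<And>s. 0 \<le> s \<Longrightarrow> s < t \<Longrightarrow> \<mu> s \<in> state_space E"
    and meas: "\<And>B A. B \<in> sets borel \<Longrightarrow> A \<in> sets E \<Longrightarrow>
      (\<lambda>s. emeasure (\<mu> s) (B \<times> A)) \<in> borel_measurable (restrict_space borel {0..<t})"
  shows "\<exists>\<kappa>. finite_kernel (borel :: (real \<times> 'x) measure) E \<kappa> \<and>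
    (AE s in lborel. 0 \<le> s \<and> s < t \<longrightarrow> is_disintegration E (\<mu> s) (\<lambda>x. \<kappa> (s, x)))"
proof -
  let ?XE = "(borel :: 'x measure) \<Otimes>\<^sub>M E"
  have bp: "sets ((borel :: real measure) \<Otimes>\<^sub>M (borel :: 'x measure)) = sets (borel :: (real \<times> 'x) measure)"
    using arg_cong[OF borel_prod[where ?'a=real and ?'b='x], of sets] .
  have Pair_b: "Pair s \<in> borel \<rightarrow>\<^sub>M (borel :: (real \<times> 'x) measure)" for s
    by (intro borel_measurable_continuous_onI continuous_intros)
  have Pair_sets: "Pair s -` D \<in> sets borel" if "D \<in> sets (borel :: (real \<times> 'x) measure)" for s D
    using measurable_sets[OF Pair_b that, of s] by simp
  define \<mu>' where "\<mu>' s = (if s \<in> {0..<t} then \<mu> s else null_measure ?XE)" for s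
  have sets_\<mu>': "sets (\<mu>' s) = sets ?XE" for s using \<mu> state_spaceD(1) by (auto simp: \<mu>'_def)
  have fin_\<mu>': "finite_measure (\<mu>' s)" for s
    by (cases "s \<in> {0..<t}") (auto simp: \<mu>'_def state_spaceD(2)[OF \<mu>] intro: finite_measureI)
  have fk: "finite_kernel borel ?XE \<mu>'"
  proof (rule finite_kernel_from_generator[OF pi_generator_pair[OF pi_generator_sets pi_generator_sets]])
    fix C assume "C \<in> {a \<times> b |a b. a \<in> sets (borel :: 'x measure) \<and> b \<in> sets E}"
    then obtain a b where C: "C = a \<times> b" "a \<in> sets borel" "b \<in> sets E" by blast
    have "(\<lambda>s. emeasure (\<mu> s) C * indicator {0..<t} s) \<in> borel_measurable borel"
      using meas[OF C(2,3)] by (subst borel_measurable_restrict_space_iff_ennreal[symmetric]) (auto simp: C)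
    moreover have "emeasure (\<mu>' s) C = emeasure (\<mu> s) C * indicator {0..<t} s" for s
      by (simp add: \<mu>'_def)
    ultimately show "(\<lambda>s. emeasure (\<mu>' s) C) \<in> borel_measurable borel" by simp
  qed (use sets_\<mu>' fin_\<mu>' in auto)
  have \<mu>'_meas[measurable]: "(\<lambda>s. emeasure (\<mu>' s) C) \<in> borel_measurable borel" if "C \<in> sets ?XE" for C
    using fk that by (simp add: finite_kernel_def)
  define c where "c s = 1 + emeasure (\<mu>' s) (space ?XE)" for s
  \<comment> \<open>Normalisation that makes the measure \<open>r s ds \<mu>\<^sub>s(dx,dy)\<close> finite; \<open>c\<close> undoes it at the end.\<close>
  define r where "r s = indicator {0..<t} s / c s" for s
  have [measurable]: "c \<in> borel_measurable borel" unfolding c_def[abs_def] by measurable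
  have [measurable]: "r \<in> borel_measurable borel" unfolding r_def[abs_def] by measurable
  have c_fin: "c s \<noteq> \<infinity>" "c s \<noteq> 0" for s
    using finite_measure.emeasure_finite[OF fin_\<mu>'] by (auto simp: c_def)
  have cr: "c s * r s = indicator {0..<t} s" for s
    using c_fin[of s] by (auto simp: r_def ennreal_times_divide ennreal_divide_self less_top split: split_indicator)
  let ?\<nu> = "density lborel r"
  define M where "M = semidirect ?\<nu> ?XE \<mu>'"
  have sets_M: "sets M = sets (borel \<Otimes>\<^sub>M ?XE)"
    unfolding M_def sets_semidirect by (intro sets_pair_measure_cong) auto
  have fk': "finite_kernel ?\<nu> ?XE \<mu>'" using fk by (simp add: finite_kernel_def)
  let ?T = "\<lambda>(s, x, y). ((s, x), y)"
  have T: "?T \<in> M \<rightarrow>\<^sub>M (lborel :: (real \<times> 'x) measure) \<Otimes>\<^sub>M E"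
  proof -
    have "?T \<in> borel \<Otimes>\<^sub>M ?XE \<rightarrow>\<^sub>M ((borel :: real measure) \<Otimes>\<^sub>M (borel :: 'x measure)) \<Otimes>\<^sub>M E" by measurable
    then show ?thesis
      by (subst measurable_cong_sets[OF sets_M, of _ "((borel :: real measure) \<Otimes>\<^sub>M (borel :: 'x measure)) \<Otimes>\<^sub>M E"])
        (simp_all add: bp cong: sets_pair_measure_cong)
  qed
  define M' where "M' = distr M ((lborel :: (real \<times> 'x) measure) \<Otimes>\<^sub>M E) ?T"
  have M': "emeasure M' (D \<times> A) = (\<integral>\<^sup>+s. r s * emeasure (\<mu>' s) ((Pair s -` D) \<times> A) \<partial>lborel)"
    if D: "D \<in> sets borel" and A: "A \<in> sets E" for D A
  proof -
    have sD: "Pair s -` D \<in> sets borel" for s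
      using D by (rule Pair_sets)
    have "emeasure M' (D \<times> A) = emeasure M (?T -` (D \<times> A) \<inter> space M)"
      unfolding M'_def using T D A by (intro emeasure_distr) auto
    also have "\<dots> = (\<integral>\<^sup>+s. emeasure (\<mu>' s) (Pair s -` (?T -` (D \<times> A) \<inter> space M)) \<partial>?\<nu>)"
    proof (unfold M_def, intro emeasure_semidirect finite_kernelD(1)[OF fk'] finite_kernel_sections[OF fk'])
      have "?T -` (D \<times> A) \<inter> space M \<in> sets M" using T D A by (intro measurable_sets) auto
      then show "?T -` (D \<times> A) \<inter> space (semidirect ?\<nu> ?XE \<mu>') \<in> sets (?\<nu> \<Otimes>\<^sub>M ?XE)"
        unfolding M_def sets_semidirect .
    qed auto
    also have "\<dots> = (\<integral>\<^sup>+s. emeasure (\<mu>' s) ((Pair s -` D) \<times> A) \<partial>?\<nu>)"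
    proof (intro nn_integral_cong arg_cong2[where f=emeasure] refl)
      fix s
      have "space M = UNIV \<times> UNIV \<times> space E"
        using sets_eq_imp_space_eq[OF sets_M] by (simp add: space_pair_measure)
      then show "Pair s -` (?T -` (D \<times> A) \<inter> space M) = (Pair s -` D) \<times> A"
        using sets.sets_into_space[OF A] by auto
    qed
    also have "\<dots> = (\<integral>\<^sup>+s. r s * emeasure (\<mu>' s) ((Pair s -` D) \<times> A) \<partial>lborel)"
    proof (intro nn_integral_density)
      have "(\<lambda>s. emeasure (\<mu>' s) (Pair s -` (?T -` (D \<times> A) \<inter> space (borel \<Otimes>\<^sub>M ?XE)))) \<in> borel_measurable borel"
        using T D A by (intro finite_kernel_sections[OF fk] measurable_sets[of _ _ "((borel :: real measure) \<Otimes>\<^sub>M (borel :: 'x measure)) \<Otimes>\<^sub>M E"])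
          (simp_all add: bp pair_measureI)
      moreover have "Pair s -` (?T -` (D \<times> A) \<inter> space (borel \<Otimes>\<^sub>M ?XE)) = (Pair s -` D) \<times> A" for s
        using sets.sets_into_space[OF A] by (auto simp: space_pair_measure)
      ultimately show "(\<lambda>s. emeasure (\<mu>' s) ((Pair s -` D) \<times> A)) \<in> borel_measurable lborel" by simp
    qed auto
    finally show ?thesis .
  qed
  have "\<exists>\<kappa>. (\<forall>x. sets (\<kappa> x) = sets E \<and> finite_measure (\<kappa> x)) \<and>
    (\<forall>A\<in>sets E. (\<lambda>x. emeasure (\<kappa> x) A) \<in> borel_measurable (lborel :: (real \<times> 'x) measure)) \<and>
    (\<forall>B\<in>sets lborel. \<forall>A\<in>sets E. emeasure M' (B \<times> A) = (\<integral>\<^sup>+x\<in>B. emeasure (\<kappa> x) A \<partial>lborel))"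
  proof (rule disintegration_exists[OF E lborel.sigma_finite_measure_axioms])
    show "sets M' = sets (lborel \<Otimes>\<^sub>M E)" by (simp add: M'_def)
    show "finite_measure M'"
    proof (rule finite_measureI)
      have "emeasure M' (space M') = emeasure M' (UNIV \<times> space E)"
        by (simp add: M'_def space_pair_measure)
      also have "\<dots> = (\<integral>\<^sup>+s. r s * emeasure (\<mu>' s) (UNIV \<times> space E) \<partial>lborel)"
        by (subst M') auto
      also have "\<dots> \<le> (\<integral>\<^sup>+s. indicator {0..<t} s \<partial>lborel)"
      proof (intro nn_integral_mono)
        fix s
        have "r s * emeasure (\<mu>' s) (UNIV \<times> space E) \<le> r s * c s"
          by (intro mult_left_mono) (auto simp: c_def space_pair_measure)
        then show "r s * emeasure (\<mu>' s) (UNIV \<times> space E) \<le> indicator {0..<t} s"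
          using cr[of s] by (simp add: mult.commute)
      qed
      also have "\<dots> < \<infinity>" by (cases "0 \<le> t") auto
      finally show "emeasure M' (space M') \<noteq> \<infinity>" by simp
    qed
    fix D :: "(real \<times> 'x) set" assume D: "D \<in> null_sets lborel"
    then have Db: "D \<in> sets borel" by auto
    have "(\<integral>\<^sup>+s. emeasure lborel (Pair s -` D) \<partial>lborel) = emeasure (lborel \<Otimes>\<^sub>M lborel) D"
      using Db by (intro lborel.emeasure_pair_measure_alt[symmetric]) (simp add: bp cong: sets_pair_measure_cong)
    also have "\<dots> = 0" using D by (auto simp: lborel_prod)
    finally have "AE s in lborel. emeasure lborel (Pair s -` D) = 0"
      using Db by (subst (asm) nn_integral_0_iff_AE)
        (auto intro!: lborel.measurable_emeasure_Pair simp: bp cong: sets_pair_measure_cong)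
    then have "AE s in lborel. r s * emeasure (\<mu>' s) ((Pair s -` D) \<times> space E) = 0"
    proof eventually_elim
      fix s assume "emeasure lborel (Pair s -` D) = 0"
      moreover have "Pair s -` D \<in> sets borel"
        using Db by (rule Pair_sets)
      ultimately have "Pair s -` D \<in> null_sets lborel" by auto
      then show "r s * emeasure (\<mu>' s) ((Pair s -` D) \<times> space E) = 0"
        using state_spaceD(4)[OF \<mu>, of s] by (auto simp: \<mu>'_def r_def)
    qed
    then have "(\<integral>\<^sup>+s. r s * emeasure (\<mu>' s) ((Pair s -` D) \<times> space E) \<partial>lborel) = (\<integral>\<^sup>+s. 0 \<partial>(lborel :: real measure))"
      by (rule nn_integral_cong_AE)
    then show "emeasure M' (D \<times> space E) = 0" using M'[OF Db, of "space E"] by simp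
  qed
  then obtain \<kappa>' where 1: "\<forall>x. sets (\<kappa>' x) = sets E \<and> finite_measure (\<kappa>' x)"
    and 2: "\<forall>A\<in>sets E. (\<lambda>x. emeasure (\<kappa>' x) A) \<in> borel_measurable (lborel :: (real \<times> 'x) measure)"
    and 3: "\<forall>B\<in>sets lborel. \<forall>A\<in>sets E. emeasure M' (B \<times> A) = (\<integral>\<^sup>+x\<in>B. emeasure (\<kappa>' x) A \<partial>lborel)"
    by blast
  have sets_\<kappa>': "\<And>x. sets (\<kappa>' x) = sets E" and fin_\<kappa>': "\<And>x. finite_measure (\<kappa>' x)"
    using 1 by blast+
  have meas_\<kappa>'[measurable]: "(\<lambda>x. emeasure (\<kappa>' x) A) \<in> borel_measurable (borel :: (real \<times> 'x) measure)"
    if "A \<in> sets E" for A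
    using 2 that by simp
  have \<kappa>': "emeasure M' (B \<times> A) = (\<integral>\<^sup>+x\<in>B. emeasure (\<kappa>' x) A \<partial>lborel)"
    if "B \<in> sets borel" "A \<in> sets E" for A B
    using 3 that by simp
  define \<kappa> where "\<kappa> p = scale_measure (c (fst p)) (\<kappa>' p)" for p
  have fin_\<kappa>: "finite_measure (\<kappa> p)" for p
    using finite_measure.emeasure_finite[OF fin_\<kappa>', of p] c_fin
    by (intro finite_measureI) (auto simp: \<kappa>_def ennreal_mult_eq_top_iff)
  have fst_b: "fst \<in> (borel :: (real \<times> 'x) measure) \<rightarrow>\<^sub>M borel"
    by (intro borel_measurable_continuous_onI continuous_intros)
  have fk_\<kappa>: "finite_kernel (borel :: (real \<times> 'x) measure) E \<kappa>"
    unfolding finite_kernel_def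
  proof (intro conjI ballI)
    fix A assume A: "A \<in> sets E"
    have "(\<lambda>p. c (fst p)) \<in> borel_measurable (borel :: (real \<times> 'x) measure)"
      by (rule measurable_compose[OF fst_b]) measurable
    then show "(\<lambda>p. emeasure (\<kappa> p) A) \<in> borel_measurable (borel :: (real \<times> 'x) measure)"
      using meas_\<kappa>'[OF A] by (simp add: \<kappa>_def)
  qed (use fin_\<kappa> in \<open>auto simp: \<kappa>_def sets_\<kappa>'\<close>)
  have rect: "AE s in lborel. r s * emeasure (\<mu>' s) (B \<times> A) = (\<integral>\<^sup>+x\<in>B. emeasure (\<kappa>' (s, x)) A \<partial>lborel)"
    if B[measurable]: "B \<in> sets borel" and A[measurable]: "A \<in> sets E" for A B
  proof -
    have m2[measurable]: "(\<lambda>(s, x). emeasure (\<kappa>' (s, x)) A) \<in> borel_measurable (borel \<Otimes>\<^sub>M borel)"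
    proof -
      have "(\<lambda>(s, x). emeasure (\<kappa>' (s, x)) A) = (\<lambda>p. emeasure (\<kappa>' p) A)" by auto
      then show ?thesis using meas_\<kappa>'[OF A] by (simp only: measurable_cong_sets[OF bp refl])
    qed
    have [measurable]: "(\<lambda>s. \<integral>\<^sup>+x\<in>B. emeasure (\<kappa>' (s, x)) A \<partial>lborel) \<in> borel_measurable lborel"
      by measurable
    show ?thesis
    proof (rule sigma_finite_measure.density_unique[OF lborel.sigma_finite_measure_axioms])
      show "density lborel (\<lambda>s. r s * emeasure (\<mu>' s) (B \<times> A)) =
        density lborel (\<lambda>s. \<integral>\<^sup>+x\<in>B. emeasure (\<kappa>' (s, x)) A \<partial>lborel)"
      proof (rule measure_eqI)
        fix S assume "S \<in> sets (density lborel (\<lambda>s. r s * emeasure (\<mu>' s) (B \<times> A)))"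
        then have S[measurable]: "S \<in> sets borel" by simp
        have SB: "S \<times> B \<in> sets borel" using S B by (simp add: borel_prod[symmetric])
        have "emeasure (density lborel (\<lambda>s. r s * emeasure (\<mu>' s) (B \<times> A))) S =
            (\<integral>\<^sup>+s. r s * emeasure (\<mu>' s) (B \<times> A) * indicator S s \<partial>lborel)"
          by (intro emeasure_density) auto
        also have "\<dots> = emeasure M' ((S \<times> B) \<times> A)"
          unfolding M'[OF SB A] by (intro nn_integral_cong) (auto split: split_indicator)
        also have "\<dots> = (\<integral>\<^sup>+p. emeasure (\<kappa>' p) A * indicator (S \<times> B) p \<partial>(lborel \<Otimes>\<^sub>M lborel))"
          unfolding \<kappa>'[OF SB A] by (simp add: lborel_prod)
        also have "\<dots> = (\<integral>\<^sup>+s. \<integral>\<^sup>+x. emeasure (\<kappa>' (s, x)) A * indicator (S \<times> B) (s, x) \<partial>lborel \<partial>lborel)"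
        proof (intro lborel.nn_integral_fst[symmetric])
          show "(\<lambda>p. emeasure (\<kappa>' p) A * indicator (S \<times> B) p) \<in> borel_measurable (lborel \<Otimes>\<^sub>M lborel)"
            using meas_\<kappa>'[OF A] SB by (simp add: lborel_prod)
        qed
        also have "\<dots> = (\<integral>\<^sup>+s. (\<integral>\<^sup>+x\<in>B. emeasure (\<kappa>' (s, x)) A \<partial>lborel) * indicator S s \<partial>lborel)"
          by (intro nn_integral_cong) (auto split: split_indicator intro!: nn_integral_cong)
        also have "\<dots> = emeasure (density lborel (\<lambda>s. \<integral>\<^sup>+x\<in>B. emeasure (\<kappa>' (s, x)) A \<partial>lborel)) S"
          by (intro emeasure_density[symmetric]) auto
        finally show "emeasure (density lborel (\<lambda>s. r s * emeasure (\<mu>' s) (B \<times> A))) S =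
          emeasure (density lborel (\<lambda>s. \<integral>\<^sup>+x\<in>B. emeasure (\<kappa>' (s, x)) A \<partial>lborel)) S" .
      qed simp
    qed auto
  qed
  obtain G where G: "countable G" "pi_generator E G" using ex_countable_generator_standard[OF E] by blast
  obtain H :: "'x set set" where H: "countable H" "pi_generator borel H" using ex_countable_generator_borel by blast
  note GD = pi_generatorD(5)[OF G(2)] and HD = pi_generatorD(5)[OF H(2)]
  have "AE s in lborel. \<forall>B\<in>H. \<forall>A\<in>G. r s * emeasure (\<mu>' s) (B \<times> A) = (\<integral>\<^sup>+x\<in>B. emeasure (\<kappa>' (s, x)) A \<partial>lborel)"
    by (subst AE_ball_countable[OF H(1)], intro ballI, subst AE_ball_countable[OF G(1)], intro ballI rect GD HD)
  then have "AE s in lborel. 0 \<le> s \<and> s < t \<longrightarrow> is_disintegration E (\<mu> s) (\<lambda>x. \<kappa> (s, x))"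
  proof (eventually_elim, intro impI)
    fix s assume eq: "\<forall>B\<in>H. \<forall>A\<in>G. r s * emeasure (\<mu>' s) (B \<times> A) = (\<integral>\<^sup>+x\<in>B. emeasure (\<kappa>' (s, x)) A \<partial>lborel)"
      and s: "0 \<le> s \<and> s < t"
    have fks: "finite_kernel lborel E (\<lambda>x. \<kappa> (s, x))"
      using finite_kernel_compose[OF fk_\<kappa> Pair_b[of s]] by (simp add: finite_kernel_def)
    have \<mu>s: "\<mu> s \<in> state_space E" using \<mu> s by auto
    have "\<mu> s = semidirect lborel E (\<lambda>x. \<kappa> (s, x))"
    proof (rule eq_semidirectI[OF _ state_spaceD(2)[OF \<mu>s] fks _ G(2)])
      show "sets (\<mu> s) = sets (lborel \<Otimes>\<^sub>M E)" using state_spaceD(1)[OF \<mu>s] by (simp add: borel_lborel_pair)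
      show "pi_generator lborel H" using H(2) by (simp add: pi_generator_def)
      fix B A assume BA: "B \<in> H" "A \<in> G"
      note [measurable] = GD[OF BA(2)] HD[OF BA(1)]
      have m: "(\<lambda>x. emeasure (\<kappa>' (s, x)) A) \<in> borel_measurable borel"
        using measurable_compose[OF Pair_b meas_\<kappa>'[OF GD[OF BA(2)]]] .
      have "emeasure (\<mu> s) (B \<times> A) = c s * r s * emeasure (\<mu>' s) (B \<times> A)"
        using cr[of s] s by (simp add: \<mu>'_def)
      also have "\<dots> = c s * (\<integral>\<^sup>+x\<in>B. emeasure (\<kappa>' (s, x)) A \<partial>lborel)"
        using eq BA by (simp add: mult.assoc)
      also have "\<dots> = (\<integral>\<^sup>+x\<in>B. emeasure (\<kappa> (s, x)) A \<partial>lborel)"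
        using m by (subst nn_integral_cmult[symmetric]) (auto simp: \<kappa>_def mult.assoc)
      finally show "emeasure (\<mu> s) (B \<times> A) = (\<integral>\<^sup>+x\<in>B. emeasure (\<kappa> (s, x)) A \<partial>lborel)" .
    qed
    then show "is_disintegration E (\<mu> s) (\<lambda>x. \<kappa> (s, x))"
      unfolding is_disintegration_def using emeasure_semidirect_Times[OF fks] fin_\<kappa> fks
      by (auto simp: \<kappa>_def sets_\<kappa>' finite_kernel_def)
  qed
  then show ?thesis using fk_\<kappa> by blast
qed

section \<open>The heat kernel\<close>

lemma heat_kernel_nonneg: "0 \<le> heat_kernel t x x'"
  by (simp add: heat_kernel_def)

lemma heat_kernel_commute: "heat_kernel t x x' = heat_kernel t x' x"
  by (simp add: heat_kernel_def norm_minus_commute)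

lemma measurable_heat_kernel[measurable (raw)]:
  fixes g h :: "'a \<Rightarrow> 'x::euclidean_space"
  assumes [measurable]: "f \<in> borel_measurable M" "g \<in> borel_measurable M" "h \<in> borel_measurable M"
  shows "(\<lambda>w. heat_kernel (f w) (g w) (h w)) \<in> borel_measurable M"
  unfolding heat_kernel_def by measurable

text \<open>
  The heat kernel is the product over the coordinates of one-dimensional normal densities.
\<close>

lemma nn_integral_heat_kernel:
  fixes x :: "'x::euclidean_space"
  assumes t: "0 < t"
  shows "(\<integral>\<^sup>+x'. ennreal (heat_kernel t x x') \<partial>lborel) = 1"
proof -
  have nd: "(\<integral>\<^sup>+r. ennreal (normal_density c (sqrt t) r) \<partial>lborel) = 1" for c :: real
    using prob_space.emeasure_space_1[OF prob_space_normal_density[of "sqrt t" c]] t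
    by (simp add: emeasure_density)
  have eq: "heat_kernel t x x' = (\<Prod>b\<in>Basis. normal_density (x \<bullet> b) (sqrt t) (x' \<bullet> b))" for x'
  proof -
    have "(2 * pi * t) powr (- (real DIM('x) / 2)) = (1 / sqrt (2 * pi * t)) ^ DIM('x)"
    proof -
      have "(1 / sqrt (2 * pi * t)) ^ DIM('x) = ((2 * pi * t) powr (- 1 / 2)) powr real DIM('x)"
        using t by (subst powr_realpow) (auto simp: powr_minus_divide powr_half_sqrt)
      also have "\<dots> = (2 * pi * t) powr (- (real DIM('x) / 2))"
        by (simp add: powr_powr)
      finally show ?thesis by simp
    qed
    moreover have "exp (- (norm (x - x'))\<^sup>2 / (2 * t)) = (\<Prod>b\<in>Basis. exp (- (x' \<bullet> b - x \<bullet> b)\<^sup>2 / (2 * t)))"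
    proof -
      have "(norm (x - x'))\<^sup>2 = (\<Sum>b\<in>Basis. (x' \<bullet> b - x \<bullet> b)\<^sup>2)"
        unfolding power2_norm_eq_inner
        by (subst euclidean_inner) (auto simp: inner_diff_left power2_eq_square algebra_simps intro!: sum.cong)
      then show ?thesis
        by (simp add: exp_sum[symmetric] sum_negf sum_divide_distrib[symmetric])
    qed
    ultimately show ?thesis
      using t by (simp add: heat_kernel_def normal_density_def prod_dividef power_divide)
  qed
  have "(\<integral>\<^sup>+x'. ennreal (heat_kernel t x x') \<partial>lborel) =
      (\<integral>\<^sup>+x'. (\<Prod>b\<in>Basis. ennreal (normal_density (x \<bullet> b) (sqrt t) (x' \<bullet> b))) \<partial>lborel)"
    unfolding eq using t by (intro nn_integral_cong prod_ennreal[symmetric]) auto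
  also have "\<dots> = (\<Prod>b\<in>Basis. (\<integral>\<^sup>+r. ennreal (normal_density (x \<bullet> b) (sqrt t) r) \<partial>lborel))"
    by (rule nn_integral_lborel_prod) auto
  finally show ?thesis by (simp add: nd)
qed

lemma nn_integral_heat_kernel_left:
  fixes x' :: "'x::euclidean_space"
  assumes t: "0 < t"
  shows "(\<integral>\<^sup>+x. ennreal (heat_kernel t x x') \<partial>lborel) = 1"
  using nn_integral_heat_kernel[OF t, of x'] by (simp add: heat_kernel_commute)

text \<open>
  Multiplication by \<open>a\<^sup>d\<^sup>/\<^sup>2\<close> cancels the dependence on \<open>a\<close> of the normalisation and leaves the Gaussian factor
  \<open>exp (- |x - x'|\<^sup>2 / (2at))\<close>. This is the reason for the power of \<open>a\<close> in the weight.
\<close>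

lemma powr_heat_kernel_mono:
  fixes x x' :: "'x::euclidean_space"
  assumes "0 < a" "a \<le> b" "0 < t"
  shows "a powr (real DIM('x) / 2) * heat_kernel (a * t) x x' \<le> b powr (real DIM('x) / 2) * heat_kernel (b * t) x x'"
proof -
  have eq: "c powr (real DIM('x) / 2) * heat_kernel (c * t) x x' =
      (2 * pi * t) powr (- (real DIM('x) / 2)) * exp (- (norm (x - x'))\<^sup>2 / (2 * (c * t)))" if "0 < c" for c
  proof -
    have "(2 * pi * (c * t)) powr (- (real DIM('x) / 2)) = c powr (- (real DIM('x) / 2)) * (2 * pi * t) powr (- (real DIM('x) / 2))"
      using that assms(3) by (simp add: powr_mult[symmetric] mult_ac)
    then show ?thesis
      using that by (simp add: heat_kernel_def powr_minus field_simps)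
  qed
  have "(norm (x - x'))\<^sup>2 / (2 * (b * t)) \<le> (norm (x - x'))\<^sup>2 / (2 * (a * t))"
    using assms by (intro divide_left_mono mult_left_mono mult_right_mono mult_pos_pos) auto
  then show ?thesis
    using assms by (simp add: eq mult_left_mono)
qed

section \<open>Gain and loss at a point of space\<close>

text \<open>
  For \<open>\<kappa> = \<mu>(x,dy)\<close> and suitable finite kernels \<open>L\<close> this is the integral of \<open>v\<close> against the density at \<open>x\<close> of
  the collision measures \<open>K\<^sup>+(\<mu>)\<close> and \<open>K\<^sup>-(\<mu>)\<close>. The densities may be infinite measures that are not
  \<open>\<sigma>\<close>-finite, for which Tonelli's theorem is not available; as an iterated integral against
  finite measures the functional still commutes with other integrals.
\<close>

definition coll :: "('e \<Rightarrow> 'e \<Rightarrow> 'e measure) \<Rightarrow> 'e measure \<Rightarrow> ('e \<Rightarrow> ennreal) \<Rightarrow> ennreal" where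
  "coll L \<kappa> v = (\<integral>\<^sup>+y. \<integral>\<^sup>+y'. \<integral>\<^sup>+z. v z \<partial>L y y' \<partial>\<kappa> \<partial>\<kappa>)"

lemma finite_kernel2_finite_kernel:
  "finite_kernel2 E K \<Longrightarrow> finite_kernel (E \<Otimes>\<^sub>M E) E (\<lambda>(y, y'). K y y')"
  by (auto simp: finite_kernel2_def finite_kernel_def space_pair_measure split_beta')

lemma finite_kernel_const:
  assumes "sets \<kappa> = sets Y" "finite_measure \<kappa>"
  shows "finite_kernel X Y (\<lambda>_. \<kappa>)"
  using assms by (simp add: finite_kernel_def)

lemma measurable_kernel2_integral:
  assumes K: "finite_kernel2 E K"
    and h: "case_prod h \<in> borel_measurable (X \<Otimes>\<^sub>M E)"
    and f: "f \<in> X \<rightarrow>\<^sub>M E" "g \<in> X \<rightarrow>\<^sub>M E"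
  shows "(\<lambda>x. \<integral>\<^sup>+z. h x z \<partial>K (f x) (g x)) \<in> borel_measurable X"
proof -
  have "finite_kernel X E (\<lambda>x. case (f x, g x) of (y, y') \<Rightarrow> K y y')"
    by (rule finite_kernel_compose[OF finite_kernel2_finite_kernel[OF K]]) (use f in measurable)
  then show ?thesis using measurable_nn_integral_finite_kernel h by auto
qed

lemma measurable_kernel2_total:
  assumes K: "finite_kernel2 E K"
    and f: "f \<in> X \<rightarrow>\<^sub>M E" "g \<in> X \<rightarrow>\<^sub>M E"
  shows "(\<lambda>x. emeasure (K (f x) (g x)) (space E)) \<in> borel_measurable X"
proof -
  have "finite_kernel X E (\<lambda>x. case (f x, g x) of (y, y') \<Rightarrow> K y y')"
    by (rule finite_kernel_compose[OF finite_kernel2_finite_kernel[OF K]]) (use f in measurable)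
  then show ?thesis by (simp add: finite_kernel_def)
qed

lemma measurable_coll:
  assumes K: "finite_kernel2 E K" and \<kappa>: "finite_kernel X E \<kappa>"
    and h: "case_prod h \<in> borel_measurable (X \<Otimes>\<^sub>M E)"
  shows "(\<lambda>x. coll K (\<kappa> x) (h x)) \<in> borel_measurable X"
proof -
  have 1: "(\<lambda>p. \<integral>\<^sup>+z. h (fst (fst p)) z \<partial>K (snd (fst p)) (snd p)) \<in> borel_measurable ((X \<Otimes>\<^sub>M E) \<Otimes>\<^sub>M E)"
  proof (rule measurable_kernel2_integral[OF K])
    have "(\<lambda>(p, z). case_prod h (fst (fst p), z)) \<in> borel_measurable (((X \<Otimes>\<^sub>M E) \<Otimes>\<^sub>M E) \<Otimes>\<^sub>M E)"
      using h by measurable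
    then show "(\<lambda>(p, z). h (fst (fst p)) z) \<in> borel_measurable (((X \<Otimes>\<^sub>M E) \<Otimes>\<^sub>M E) \<Otimes>\<^sub>M E)" by simp
  qed measurable
  have 2: "(\<lambda>q. \<integral>\<^sup>+y'. \<integral>\<^sup>+z. h (fst q) z \<partial>K (snd q) y' \<partial>\<kappa> (fst q)) \<in> borel_measurable (X \<Otimes>\<^sub>M E)"
    using 1 by (intro measurable_nn_integral_finite_kernel[OF finite_kernel_compose[OF \<kappa> measurable_fst]])
      (simp add: split_beta')
  then show ?thesis
    unfolding coll_def by (intro measurable_nn_integral_finite_kernel[OF \<kappa>]) (simp add: split_beta')
qed

lemma nn_integral_swap:
  assumes "sigma_finite_measure A" "sigma_finite_measure B"
    and "case_prod f \<in> borel_measurable (A \<Otimes>\<^sub>M B)"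
  shows "(\<integral>\<^sup>+b. \<integral>\<^sup>+a. f a b \<partial>A \<partial>B) = (\<integral>\<^sup>+a. \<integral>\<^sup>+b. f a b \<partial>B \<partial>A)"
proof -
  interpret pair_sigma_finite A B using assms by (simp add: pair_sigma_finite_def)
  show ?thesis using assms(3) by (rule Fubini')
qed

lemma finite_kernel2D:
  assumes "finite_kernel2 E K" "y \<in> space E" "y' \<in> space E"
  shows "sets (K y y') = sets E" "finite_measure (K y y')" "sigma_finite_measure (K y y')" "space (K y y') = space E"
  using finite_kernelD[OF finite_kernel2_finite_kernel[OF assms(1)], of "(y, y')"] assms(2,3)
  by (auto simp: space_pair_measure)

lemma coll_swap:
  assumes K: "finite_kernel2 E K" and \<kappa>: "sets \<kappa> = sets E" "finite_measure \<kappa>"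
    and N: "sigma_finite_measure N"
    and h: "case_prod h \<in> borel_measurable (N \<Otimes>\<^sub>M E)"
  shows "(\<integral>\<^sup>+x. coll K \<kappa> (h x) \<partial>N) = coll K \<kappa> (\<lambda>z. \<integral>\<^sup>+x. h x z \<partial>N)"
proof -
  have sf: "sigma_finite_measure \<kappa>" using \<kappa>(2) by (rule finite_measure.axioms(1))
  have sp: "space \<kappa> = space E" using \<kappa>(1) by (rule sets_eq_imp_space_eq)
  have fk: "finite_kernel X E (\<lambda>_. \<kappa>)" for X :: "'z measure" using \<kappa> by (rule finite_kernel_const)
  have ms: "borel_measurable (A \<Otimes>\<^sub>M N) = borel_measurable (B \<Otimes>\<^sub>M N)" if "sets A = sets B" for A B :: "'a measure"
    using that by (intro measurable_cong_sets sets_pair_measure_cong) auto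
  have 1: "(\<lambda>p. \<integral>\<^sup>+z. h (snd (fst p)) z \<partial>K (fst (fst p)) (snd p)) \<in> borel_measurable ((E \<Otimes>\<^sub>M N) \<Otimes>\<^sub>M E)"
  proof (rule measurable_kernel2_integral[OF K])
    have "(\<lambda>(p, z). case_prod h (snd (fst p), z)) \<in> borel_measurable (((E \<Otimes>\<^sub>M N) \<Otimes>\<^sub>M E) \<Otimes>\<^sub>M E)"
      using h by measurable
    then show "(\<lambda>(p, z). h (snd (fst p)) z) \<in> borel_measurable (((E \<Otimes>\<^sub>M N) \<Otimes>\<^sub>M E) \<Otimes>\<^sub>M E)" by simp
  qed measurable
  have 2: "(\<lambda>(y, x). \<integral>\<^sup>+y'. \<integral>\<^sup>+z. h x z \<partial>K y y' \<partial>\<kappa>) \<in> borel_measurable (E \<Otimes>\<^sub>M N)"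
    using 1 measurable_nn_integral_finite_kernel[OF fk, of "\<lambda>q y'. \<integral>\<^sup>+z. h (snd q) z \<partial>K (fst q) y'" "E \<Otimes>\<^sub>M N"]
    by (simp add: split_beta')
  have 3: "(\<lambda>(y', x). \<integral>\<^sup>+z. h x z \<partial>K y y') \<in> borel_measurable (E \<Otimes>\<^sub>M N)" if y: "y \<in> space E" for y
  proof -
    have "(\<lambda>q. \<integral>\<^sup>+z. h (snd q) z \<partial>K y (fst q)) \<in> borel_measurable (E \<Otimes>\<^sub>M N)"
    proof (rule measurable_kernel2_integral[OF K])
      have "(\<lambda>(q, z). case_prod h (snd q, z)) \<in> borel_measurable ((E \<Otimes>\<^sub>M N) \<Otimes>\<^sub>M E)"
        using h by measurable
      then show "(\<lambda>(q, z). h (snd q) z) \<in> borel_measurable ((E \<Otimes>\<^sub>M N) \<Otimes>\<^sub>M E)" by simp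
    qed (use y in measurable)
    then show ?thesis by (simp add: split_beta')
  qed
  have 4: "(\<lambda>(z, x). h x z) \<in> borel_measurable (E \<Otimes>\<^sub>M N)"
    using measurable_pair_swap[OF h] by simp
  have "(\<integral>\<^sup>+x. coll K \<kappa> (h x) \<partial>N) = (\<integral>\<^sup>+y. \<integral>\<^sup>+x. \<integral>\<^sup>+y'. \<integral>\<^sup>+z. h x z \<partial>K y y' \<partial>\<kappa> \<partial>N \<partial>\<kappa>)"
    unfolding coll_def
    using 2 by (intro nn_integral_swap sf N) (simp add: ms[OF \<kappa>(1)])
  also have "\<dots> = (\<integral>\<^sup>+y. \<integral>\<^sup>+y'. \<integral>\<^sup>+x. \<integral>\<^sup>+z. h x z \<partial>K y y' \<partial>N \<partial>\<kappa> \<partial>\<kappa>)"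
    using 3 by (intro nn_integral_cong nn_integral_swap sf N) (simp add: ms[OF \<kappa>(1)] sp)
  also have "\<dots> = (\<integral>\<^sup>+y. \<integral>\<^sup>+y'. \<integral>\<^sup>+z. \<integral>\<^sup>+x. h x z \<partial>N \<partial>K y y' \<partial>\<kappa> \<partial>\<kappa>)"
  proof (intro nn_integral_cong nn_integral_swap N)
    fix y y' assume "y \<in> space \<kappa>" "y' \<in> space \<kappa>"
    then have yy': "y \<in> space E" "y' \<in> space E" by (simp_all add: sp)
    note K' = finite_kernel2D[OF K yy']
    show "sigma_finite_measure (K y y')" by (rule K')
    show "(\<lambda>(z, x). h x z) \<in> borel_measurable (K y y' \<Otimes>\<^sub>M N)" using 4 by (simp add: ms[OF K'(1)])
  qed
  finally show ?thesis by (simp add: coll_def)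
qed

lemma coll_cong:
  assumes K: "finite_kernel2 E K" and \<kappa>: "sets \<kappa> = sets E" and eq: "\<And>z. z \<in> space E \<Longrightarrow> u z = v z"
  shows "coll K \<kappa> u = coll K \<kappa> v"
  unfolding coll_def using eq sets_eq_imp_space_eq[OF \<kappa>] finite_kernel2D(4)[OF K]
  by (intro nn_integral_cong) auto

text \<open>
  The measures in the equation are given by set functions. Exhibiting a measure that
  takes the prescribed values shows these set functions to be countably additive.
\<close>

lemma measure_of_eq_measure:
  assumes "sets N = sets E" "\<And>A. A \<in> sets E \<Longrightarrow> \<phi> A = emeasure N A"
  shows "measure_of (space E) (sets E) \<phi> = N"
proof -
  have "measure_of (space E) (sets E) \<phi> = measure_of (space E) (sets E) (emeasure N)"
    by (rule measure_of_eq) (simp_all add: sets.space_closed sets.sigma_sets_eq assms(2))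
  also have "\<dots> = measure_of (space N) (sets N) (emeasure N)"
    using assms(1) sets_eq_imp_space_eq[OF assms(1)] by simp
  finally show ?thesis by (simp add: measure_of_of_measure)
qed

definition coll_measure :: "'e measure \<Rightarrow> ('e \<Rightarrow> 'e \<Rightarrow> 'e measure) \<Rightarrow> 'e measure \<Rightarrow> 'e measure" where
  "coll_measure E L \<kappa> = distr (semidirect (\<kappa> \<Otimes>\<^sub>M \<kappa>) E (\<lambda>(y, y'). L y y')) E snd"

lemma sets_coll_measure: "sets (coll_measure E L \<kappa>) = sets E"
  by (simp add: coll_measure_def)

lemma nn_integral_coll_measure:
  assumes L: "finite_kernel2 E L" and \<kappa>: "sets \<kappa> = sets E" "finite_measure \<kappa>"
    and v[measurable]: "v \<in> borel_measurable E"
  shows "(\<integral>\<^sup>+z. v z \<partial>coll_measure E L \<kappa>) = coll L \<kappa> v"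
proof -
  interpret \<kappa>: sigma_finite_measure \<kappa> using \<kappa>(2) by (rule finite_measure.axioms(1))
  have skk: "sets (\<kappa> \<Otimes>\<^sub>M \<kappa>) = sets (E \<Otimes>\<^sub>M E)" using \<kappa>(1) by (intro sets_pair_measure_cong) auto
  have fkk: "finite_kernel (\<kappa> \<Otimes>\<^sub>M \<kappa>) E (\<lambda>(y, y'). L y y')"
    using finite_kernel2_finite_kernel[OF L] sets_eq_imp_space_eq[OF skk]
    by (simp add: finite_kernel_def measurable_cong_sets[OF skk refl])
  let ?P = "semidirect (\<kappa> \<Otimes>\<^sub>M \<kappa>) E (\<lambda>(y, y'). L y y')"
  have snd: "snd \<in> ?P \<rightarrow>\<^sub>M E" by (subst measurable_cong_sets[OF sets_semidirect refl]) measurable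
  have "(\<integral>\<^sup>+z. v z \<partial>coll_measure E L \<kappa>) = (\<integral>\<^sup>+w. v (snd w) \<partial>?P)"
    unfolding coll_measure_def using snd by (intro nn_integral_distr) auto
  also have "\<dots> = (\<integral>\<^sup>+p. \<integral>\<^sup>+z. v z \<partial>(case p of (y, y') \<Rightarrow> L y y') \<partial>(\<kappa> \<Otimes>\<^sub>M \<kappa>))"
    by (subst nn_integral_semidirect_kernel[OF fkk]) auto
  also have "\<dots> = coll L \<kappa> v"
    unfolding coll_def
  proof (subst \<kappa>.nn_integral_fst[symmetric])
    have "(\<lambda>p. \<integral>\<^sup>+z. v z \<partial>L (fst p) (snd p)) \<in> borel_measurable (E \<Otimes>\<^sub>M E)"
      by (rule measurable_kernel2_integral[OF L]) measurable
    then show "(\<lambda>p. \<integral>\<^sup>+z. v z \<partial>(case p of (y, y') \<Rightarrow> L y y')) \<in> borel_measurable (\<kappa> \<Otimes>\<^sub>M \<kappa>)"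
      by (simp add: measurable_cong_sets[OF skk refl] split_beta')
  qed simp
  finally show ?thesis .
qed

lemma measure_of_eq_coll_measure:
  assumes L: "finite_kernel2 E L" and \<kappa>: "sets \<kappa> = sets E" "finite_measure \<kappa>"
    and \<phi>: "\<And>A. A \<in> sets E \<Longrightarrow> \<phi> A = coll L \<kappa> (indicator A)"
  shows "measure_of (space E) (sets E) \<phi> = coll_measure E L \<kappa>"
  using \<phi> by (intro measure_of_eq_measure) (simp_all add: nn_integral_coll_measure[OF L \<kappa>, symmetric] sets_coll_measure)

definition gain_kernel :: "('e \<Rightarrow> 'e \<Rightarrow> 'e measure) \<Rightarrow> 'e \<Rightarrow> 'e \<Rightarrow> 'e measure" where
  "gain_kernel K y y' = scale_measure (1 / 2) (K y y')"

text \<open>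
  A loss is described as a collision too: the pair \<open>(y,y')\<close> produces \<open>y\<close>, with the total
  rate of \<open>K y y'\<close>. Gain and loss thus differ in the kernel only.
\<close>

definition loss_kernel :: "'e measure \<Rightarrow> ('e \<Rightarrow> 'e \<Rightarrow> 'e measure) \<Rightarrow> 'e \<Rightarrow> 'e \<Rightarrow> 'e measure" where
  "loss_kernel E K y y' = distr (K y y') E (\<lambda>_. y)"

lemma nn_integral_gain_kernel:
  assumes "finite_kernel2 E K" "y \<in> space E" "y' \<in> space E" "v \<in> borel_measurable E"
  shows "(\<integral>\<^sup>+z. v z \<partial>gain_kernel K y y') = 1 / 2 * (\<integral>\<^sup>+z. v z \<partial>K y y')"
  unfolding gain_kernel_def using assms(4)
  by (intro nn_integral_scale_measure) (simp add: measurable_cong_sets[OF finite_kernel2D(1)[OF assms(1-3)] refl])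

lemma nn_integral_loss_kernel:
  assumes "finite_kernel2 E K" "y \<in> space E" "y' \<in> space E" "v \<in> borel_measurable E"
  shows "(\<integral>\<^sup>+z. v z \<partial>loss_kernel E K y y') = v y * emeasure (K y y') (space E)"
  unfolding loss_kernel_def using assms finite_kernel2D(4)[OF assms(1-3)]
  by (subst nn_integral_distr) auto

lemma finite_kernel2_gain_kernel:
  assumes K: "finite_kernel2 E K"
  shows "finite_kernel2 E (gain_kernel K)"
  unfolding finite_kernel2_def
proof (intro conjI ballI)
  fix y y' assume y: "y \<in> space E" "y' \<in> space E"
  note Ky = finite_kernel2D[OF K y]
  show "sets (gain_kernel K y y') = sets E" by (simp add: gain_kernel_def Ky(1))
  show "finite_measure (gain_kernel K y y')"
    using finite_measure.emeasure_finite[OF Ky(2)]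
    by (intro finite_measureI) (simp add: gain_kernel_def ennreal_mult_eq_top_iff ennreal_divide_eq_top_iff)
next
  fix A assume "A \<in> sets E"
  then have "(\<lambda>p. case p of (y, y') \<Rightarrow> emeasure (K y y') A) \<in> borel_measurable (E \<Otimes>\<^sub>M E)"
    using K by (simp add: finite_kernel2_def)
  then show "(\<lambda>(y, y'). emeasure (gain_kernel K y y') A) \<in> borel_measurable (E \<Otimes>\<^sub>M E)"
    by (simp add: gain_kernel_def split_beta')
qed

lemma finite_kernel2_loss_kernel:
  assumes K: "finite_kernel2 E K"
  shows "finite_kernel2 E (loss_kernel E K)"
  unfolding finite_kernel2_def
proof (intro conjI ballI)
  fix y y' assume y: "y \<in> space E" "y' \<in> space E"
  show "sets (loss_kernel E K y y') = sets E" by (simp add: loss_kernel_def)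
  show "finite_measure (loss_kernel E K y y')"
    unfolding loss_kernel_def using y by (intro finite_measure.finite_measure_distr[OF finite_kernel2D(2)[OF K y]]) simp
next
  fix A assume A[measurable]: "A \<in> sets E"
  have [measurable]: "(\<lambda>p. emeasure (K (fst p) (snd p)) (space E)) \<in> borel_measurable (E \<Otimes>\<^sub>M E)"
    by (rule measurable_kernel2_total[OF K]) measurable
  have "emeasure (loss_kernel E K y y') A = indicator A y * emeasure (K y y') (space E)"
    if "y \<in> space E" "y' \<in> space E" for y y'
    using nn_integral_loss_kernel[OF K that, of "indicator A"] A by (simp add: loss_kernel_def)
  then have "(\<lambda>(y, y'). emeasure (loss_kernel E K y y') A) \<in> borel_measurable (E \<Otimes>\<^sub>M E) \<longleftrightarrow>
      (\<lambda>p. indicator A (fst p) * emeasure (K (fst p) (snd p)) (space E)) \<in> borel_measurable (E \<Otimes>\<^sub>M E)"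
    by (intro measurable_cong) (auto simp: space_pair_measure)
  then show "(\<lambda>(y, y'). emeasure (loss_kernel E K y y') A) \<in> borel_measurable (E \<Otimes>\<^sub>M E)" by simp
qed

lemma coll_loss_kernel:
  assumes K: "finite_kernel2 E K" and \<kappa>: "sets \<kappa> = sets E" and v: "v \<in> borel_measurable E"
  shows "coll (loss_kernel E K) \<kappa> v = (\<integral>\<^sup>+y. \<integral>\<^sup>+y'. v y * emeasure (K y y') (space E) \<partial>\<kappa> \<partial>\<kappa>)"
  unfolding coll_def using sets_eq_imp_space_eq[OF \<kappa>] v
  by (intro nn_integral_cong nn_integral_loss_kernel[OF K]) auto

lemma measurable_slices:
  assumes L: "finite_kernel2 E L" and A: "A \<in> sets E" and \<kappa>: "sets \<kappa> = sets E" "finite_measure \<kappa>"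
  shows "y \<in> space E \<Longrightarrow> (\<lambda>y'. emeasure (L y y') A) \<in> borel_measurable \<kappa>"
    and "(\<lambda>y. \<integral>\<^sup>+y'. emeasure (L y y') A \<partial>\<kappa>) \<in> borel_measurable \<kappa>"
proof -
  note m = measurable_cong_sets[OF \<kappa>(1) refl]
  have c: "(\<lambda>(y, y'). emeasure (L y y') A) \<in> borel_measurable (E \<Otimes>\<^sub>M E)"
    using L A by (simp add: finite_kernel2_def)
  show "(\<lambda>y'. emeasure (L y y') A) \<in> borel_measurable \<kappa>" if "y \<in> space E"
    using measurable_compose[OF measurable_Pair1'[OF that] c] by (simp add: m)
  show "(\<lambda>y. \<integral>\<^sup>+y'. emeasure (L y y') A \<partial>\<kappa>) \<in> borel_measurable \<kappa>"
    using measurable_nn_integral_finite_kernel[OF finite_kernel_const[OF \<kappa>] c] by (simp add: m)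
qed

section \<open>Collision measures and their heat flow\<close>

text \<open>
  Abstracts from the difference between gain and loss: the operator \<open>C\<close> has the
  density \<open>coll L\<close> at each point of space, for whichever version of the disintegration.
\<close>

definition collision_operator :: "'e measure \<Rightarrow> (('x::euclidean_space \<times> 'e) measure \<Rightarrow> ('x \<times> 'e) measure) \<Rightarrow>
    ('e \<Rightarrow> 'e \<Rightarrow> 'e measure) \<Rightarrow> bool" where
  "collision_operator E C L \<longleftrightarrow> (\<forall>\<mu>\<in>state_space E. \<forall>\<kappa>. is_disintegration E \<mu> \<kappa> \<longrightarrow>
     sets (C \<mu>) = sets (borel \<Otimes>\<^sub>M E) \<and>
     (\<forall>f\<in>borel_measurable (borel \<Otimes>\<^sub>M E). (\<integral>\<^sup>+p. f p \<partial>C \<mu>) = (\<integral>\<^sup>+x. coll L (\<kappa> x) (\<lambda>z. f (x, z)) \<partial>lborel)))"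

lemma collision_operatorI:
  fixes C :: "('x::euclidean_space \<times> 'e) measure \<Rightarrow> ('x \<times> 'e) measure"
  assumes E: "standard_measurable_space E"
    and L: "finite_kernel2 E L"
    and C: "\<And>\<mu>. \<mu> \<in> state_space E \<Longrightarrow> C \<mu> = semidirect lborel E (\<lambda>x. coll_measure E L (disintegration E \<mu> x))"
  shows "collision_operator E C L"
  unfolding collision_operator_def
proof (intro ballI allI impI conjI)
  fix \<mu> :: "('x \<times> 'e) measure" and \<kappa> assume \<mu>: "\<mu> \<in> state_space E" and \<kappa>: "is_disintegration E \<mu> \<kappa>"
  let ?\<kappa> = "disintegration E \<mu>"
  have dis: "is_disintegration E \<mu> ?\<kappa>" using E \<mu> by (rule is_disintegration_disintegration)
  have fk: "finite_kernel lborel E ?\<kappa>" using dis by (rule is_disintegration_finite_kernel)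
  have \<kappa>x: "sets (?\<kappa> x) = sets E" "finite_measure (?\<kappa> x)" for x
    using dis by (auto simp: is_disintegration_def)
  show "sets (C \<mu>) = sets (borel \<Otimes>\<^sub>M E)"
    by (simp add: C[OF \<mu>] sets_semidirect borel_lborel_pair)
  fix f :: "'x \<times> 'e \<Rightarrow> ennreal" assume f: "f \<in> borel_measurable (borel \<Otimes>\<^sub>M E)"
  have slice: "(\<lambda>z. h x z) \<in> borel_measurable E" if "case_prod h \<in> borel_measurable (lborel \<Otimes>\<^sub>M E)"
    for h :: "'x \<Rightarrow> 'e \<Rightarrow> ennreal" and x
    using measurable_compose[OF measurable_Pair1' that, of x] by simp
  have f': "f \<in> borel_measurable (lborel \<Otimes>\<^sub>M E)"
    using f by (simp add: measurable_cong_sets[OF borel_lborel_pair refl])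
  have "(\<integral>\<^sup>+p. f p \<partial>C \<mu>) = (\<integral>\<^sup>+x. \<integral>\<^sup>+z. f (x, z) \<partial>coll_measure E L (?\<kappa> x) \<partial>lborel)"
    unfolding C[OF \<mu>]
  proof (intro nn_integral_semidirect sets_coll_measure f')
    fix h :: "'x \<Rightarrow> 'e \<Rightarrow> ennreal" assume h: "case_prod h \<in> borel_measurable (lborel \<Otimes>\<^sub>M E)"
    show "(\<lambda>x. \<integral>\<^sup>+y. h x y \<partial>coll_measure E L (?\<kappa> x)) \<in> borel_measurable lborel"
      using measurable_coll[OF L fk h] by (simp add: nn_integral_coll_measure[OF L \<kappa>x slice[OF h]])
  qed
  also have "\<dots> = (\<integral>\<^sup>+x. coll L (?\<kappa> x) (\<lambda>z. f (x, z)) \<partial>lborel)"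
    using slice[of "\<lambda>x z. f (x, z)"] f' by (intro nn_integral_cong nn_integral_coll_measure[OF L \<kappa>x]) simp
  also have "\<dots> = (\<integral>\<^sup>+x. coll L (\<kappa> x) (\<lambda>z. f (x, z)) \<partial>lborel)"
    using is_disintegration_AE_unique[OF E dis \<kappa>] by (intro nn_integral_cong_AE) (auto elim: eventually_mono)
  finally show "(\<integral>\<^sup>+p. f p \<partial>C \<mu>) = (\<integral>\<^sup>+x. coll L (\<kappa> x) (\<lambda>z. f (x, z)) \<partial>lborel)" .
qed

lemma finite_disintegration:
  assumes "standard_measurable_space E" "\<mu> \<in> state_space E"
  shows "sets (disintegration E \<mu> x) = sets E" "finite_measure (disintegration E \<mu> x)"
  using is_disintegration_disintegration[OF assms] by (auto simp: is_disintegration_def)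

lemma collision_operator_K_plus:
  fixes E :: "'e measure"
  assumes K: "finite_kernel2 E K" and E: "standard_measurable_space E"
  shows "collision_operator E (K_plus E K) (gain_kernel K)"
proof (rule collision_operatorI[OF E finite_kernel2_gain_kernel[OF K]])
  fix \<mu> :: "('x::euclidean_space \<times> 'e) measure" assume "\<mu> \<in> state_space E"
  note \<kappa> = finite_disintegration[OF E this]
  show "K_plus E K \<mu> = semidirect lborel E (\<lambda>x. coll_measure E (gain_kernel K) (disintegration E \<mu> x))"
    unfolding K_plus_def kernel_measure_eq_semidirect
  proof (intro arg_cong[where f="semidirect lborel E"] ext measure_of_eq_coll_measure[OF finite_kernel2_gain_kernel[OF K] \<kappa>])
    fix x A assume A: "A \<in> sets E"
    let ?\<kappa> = "disintegration E \<mu> x"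
    note sp = sets_eq_imp_space_eq[OF \<kappa>(1)[of x]]
    have "coll (gain_kernel K) ?\<kappa> (indicator A) = (\<integral>\<^sup>+y. \<integral>\<^sup>+y'. 1 / 2 * emeasure (K y y') A \<partial>?\<kappa> \<partial>?\<kappa>)"
      unfolding coll_def using A
      by (intro nn_integral_cong) (simp add: nn_integral_gain_kernel[OF K] finite_kernel2D(1)[OF K] sp)
    also have "\<dots> = (\<integral>\<^sup>+y. 1 / 2 * (\<integral>\<^sup>+y'. emeasure (K y y') A \<partial>?\<kappa>) \<partial>?\<kappa>)"
      using measurable_slices(1)[OF K A \<kappa>, of _ x] by (intro nn_integral_cong nn_integral_cmult) (simp add: sp)
    also have "\<dots> = 1 / 2 * (\<integral>\<^sup>+y. \<integral>\<^sup>+y'. emeasure (K y y') A \<partial>?\<kappa> \<partial>?\<kappa>)"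
      by (rule nn_integral_cmult[OF measurable_slices(2)[OF K A \<kappa>]])
    finally show "1 / 2 * (\<integral>\<^sup>+y. \<integral>\<^sup>+y'. emeasure (K y y') A \<partial>?\<kappa> \<partial>?\<kappa>) = coll (gain_kernel K) ?\<kappa> (indicator A)" ..
  qed
qed

lemma collision_operator_K_minus:
  fixes E :: "'e measure"
  assumes K: "finite_kernel2 E K" and E: "standard_measurable_space E"
  shows "collision_operator E (K_minus E K) (loss_kernel E K)"
proof (rule collision_operatorI[OF E finite_kernel2_loss_kernel[OF K]])
  fix \<mu> :: "('x::euclidean_space \<times> 'e) measure" assume "\<mu> \<in> state_space E"
  note \<kappa> = finite_disintegration[OF E this]
  show "K_minus E K \<mu> = semidirect lborel E (\<lambda>x. coll_measure E (loss_kernel E K) (disintegration E \<mu> x))"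
    unfolding K_minus_def kernel_measure_eq_semidirect
  proof (intro arg_cong[where f="semidirect lborel E"] ext measure_of_eq_coll_measure[OF finite_kernel2_loss_kernel[OF K] \<kappa>])
    fix x A assume A: "A \<in> sets E"
    let ?\<kappa> = "disintegration E \<mu> x"
    show "(\<integral>\<^sup>+y\<in>A. (\<integral>\<^sup>+y'. emeasure (K y y') (space E) \<partial>?\<kappa>) \<partial>?\<kappa>) = coll (loss_kernel E K) ?\<kappa> (indicator A)"
      using A by (subst coll_loss_kernel[OF K \<kappa>(1)]) (auto intro!: nn_integral_cong split: split_indicator)
  qed
qed

lemma heat_at_integral:
  fixes \<nu> :: "('x::euclidean_space \<times> 'e) measure"
  assumes \<nu>: "sets \<nu> = sets (borel \<Otimes>\<^sub>M E)" and a[measurable]: "a \<in> borel_measurable E"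
  shows "sets (heat_at E a \<tau> \<nu> x') = sets E"
    and "v \<in> borel_measurable E \<Longrightarrow> (\<integral>\<^sup>+z. v z \<partial>heat_at E a \<tau> \<nu> x') =
      (\<integral>\<^sup>+p. ennreal (heat_kernel (a (snd p) * \<tau>) (fst p) x') * v (snd p) \<partial>\<nu>)"
proof -
  note ms = measurable_cong_sets[OF \<nu> refl]
  have m: "(\<lambda>p. ennreal (heat_kernel (a (snd p) * \<tau>) (fst p) x')) \<in> borel_measurable \<nu>"
    unfolding ms by measurable
  have snd: "snd \<in> \<nu> \<rightarrow>\<^sub>M E" unfolding ms by measurable
  define N where "N = distr (density \<nu> (\<lambda>p. ennreal (heat_kernel (a (snd p) * \<tau>) (fst p) x'))) E snd"
  have N: "(\<integral>\<^sup>+z. v z \<partial>N) = (\<integral>\<^sup>+p. ennreal (heat_kernel (a (snd p) * \<tau>) (fst p) x') * v (snd p) \<partial>\<nu>)"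
    if "v \<in> borel_measurable E" for v
    unfolding N_def using that m snd measurable_compose[OF snd that]
    by (subst nn_integral_distr) (auto simp: nn_integral_density)
  have eq: "heat_at E a \<tau> \<nu> x' = N"
    unfolding heat_at_def
  proof (rule measure_of_eq_measure)
    fix A assume A: "A \<in> sets E"
    have "emeasure N A = (\<integral>\<^sup>+p. ennreal (heat_kernel (a (snd p) * \<tau>) (fst p) x') * indicator A (snd p) \<partial>\<nu>)"
      using A by (subst N[symmetric]) (auto simp: N_def)
    also have "\<dots> = (\<integral>\<^sup>+(x, y)\<in>UNIV \<times> A. ennreal (heat_kernel (a y * \<tau>) x x') \<partial>\<nu>)"
      by (intro nn_integral_cong) (auto split: split_indicator)
    finally show "(\<integral>\<^sup>+(x, y)\<in>UNIV \<times> A. ennreal (heat_kernel (a y * \<tau>) x x') \<partial>\<nu>) = emeasure N A" ..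
  qed (simp add: N_def)
  show "sets (heat_at E a \<tau> \<nu> x') = sets E" by (simp add: eq N_def)
  show "v \<in> borel_measurable E \<Longrightarrow> (\<integral>\<^sup>+z. v z \<partial>heat_at E a \<tau> \<nu> x') =
      (\<integral>\<^sup>+p. ennreal (heat_kernel (a (snd p) * \<tau>) (fst p) x') * v (snd p) \<partial>\<nu>)"
    by (simp add: eq N)
qed

text \<open>
  The source \<open>\<nu>\<close> may be a collision measure, which is not known to be \<open>\<sigma>\<close>-finite. The
  measurability in \<open>x'\<close> of integrals against it is therefore a separate hypothesis.
\<close>

lemma heat_flow_integral:
  fixes \<nu> :: "('x::euclidean_space \<times> 'e) measure"
  assumes \<nu>: "sets \<nu> = sets (borel \<Otimes>\<^sub>M E)" and a[measurable]: "a \<in> borel_measurable E"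
    and \<tau>: "\<tau> \<noteq> 0"
    and par: "\<And>h. case_prod h \<in> borel_measurable ((borel :: 'x measure) \<Otimes>\<^sub>M (borel \<Otimes>\<^sub>M E)) \<Longrightarrow>
      (\<lambda>x'. \<integral>\<^sup>+p. h x' p \<partial>\<nu>) \<in> borel_measurable borel"
  shows "sets (heat_flow E a \<tau> \<nu>) = sets (borel \<Otimes>\<^sub>M E)"
    and "f \<in> borel_measurable (borel \<Otimes>\<^sub>M E) \<Longrightarrow> (\<integral>\<^sup>+q. f q \<partial>heat_flow E a \<tau> \<nu>) =
      (\<integral>\<^sup>+x'. \<integral>\<^sup>+p. ennreal (heat_kernel (a (snd p) * \<tau>) (fst p) x') * f (x', snd p) \<partial>\<nu> \<partial>lborel)"
proof -
  have eq: "heat_flow E a \<tau> \<nu> = semidirect lborel E (heat_at E a \<tau> \<nu>)"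
    using \<tau> by (simp add: heat_flow_def kernel_measure_eq_semidirect)
  show "sets (heat_flow E a \<tau> \<nu>) = sets (borel \<Otimes>\<^sub>M E)"
    by (simp add: eq sets_semidirect borel_lborel_pair)
  assume f: "f \<in> borel_measurable (borel \<Otimes>\<^sub>M E)"
  have slice: "(\<lambda>z. h x z) \<in> borel_measurable E" if "case_prod h \<in> borel_measurable (lborel \<Otimes>\<^sub>M E)"
    for h :: "'x \<Rightarrow> 'e \<Rightarrow> ennreal" and x
    using measurable_compose[OF measurable_Pair1' that, of x] by simp
  have f': "f \<in> borel_measurable (lborel \<Otimes>\<^sub>M E)"
    using f by (simp add: measurable_cong_sets[OF borel_lborel_pair refl])
  have "(\<integral>\<^sup>+q. f q \<partial>heat_flow E a \<tau> \<nu>) = (\<integral>\<^sup>+x'. \<integral>\<^sup>+z. f (x', z) \<partial>heat_at E a \<tau> \<nu> x' \<partial>lborel)"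
    unfolding eq
  proof (intro nn_integral_semidirect heat_at_integral(1)[OF \<nu> a] f')
    fix h :: "'x \<Rightarrow> 'e \<Rightarrow> ennreal" assume h: "case_prod h \<in> borel_measurable (lborel \<Otimes>\<^sub>M E)"
    then have h': "case_prod h \<in> borel_measurable (borel \<Otimes>\<^sub>M E)"
      by (simp add: measurable_cong_sets[OF borel_lborel_pair refl])
    have "(\<lambda>(x', p). ennreal (heat_kernel (a (snd p) * \<tau>) (fst p) x') * case_prod h (x', snd p)) \<in>
       borel_measurable ((borel :: 'x measure) \<Otimes>\<^sub>M ((borel :: 'x measure) \<Otimes>\<^sub>M E))"
      using h' by measurable
    then have "(\<lambda>x'. \<integral>\<^sup>+p. ennreal (heat_kernel (a (snd p) * \<tau>) (fst p) x') * h x' (snd p) \<partial>\<nu>) \<in> borel_measurable borel"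
      by (intro par) simp
    then show "(\<lambda>x'. \<integral>\<^sup>+y. h x' y \<partial>heat_at E a \<tau> \<nu> x') \<in> borel_measurable lborel"
      by (simp add: heat_at_integral(2)[OF \<nu> a slice[OF h]])
  qed
  also have "\<dots> = (\<integral>\<^sup>+x'. \<integral>\<^sup>+p. ennreal (heat_kernel (a (snd p) * \<tau>) (fst p) x') * f (x', snd p) \<partial>\<nu> \<partial>lborel)"
    using slice[of "\<lambda>x z. f (x, z)"] f' by (intro nn_integral_cong heat_at_integral(2)[OF \<nu> a]) simp
  finally show "(\<integral>\<^sup>+q. f q \<partial>heat_flow E a \<tau> \<nu>) =
      (\<integral>\<^sup>+x'. \<integral>\<^sup>+p. ennreal (heat_kernel (a (snd p) * \<tau>) (fst p) x') * f (x', snd p) \<partial>\<nu> \<partial>lborel)" .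
qed

text \<open>
  The integrand of the gain is at most \<open>(v y + v y') K(y,y',E)\<close>. By the symmetry of
  \<open>K\<close> both summands have the same integral, namely the loss, and the factor \<open>1 / 2\<close> compensates
  for there being two of them.
\<close>

lemma gain_le_loss:
  assumes K: "finite_kernel2 E K" and \<kappa>: "sets \<kappa> = sets E" "finite_measure \<kappa>"
    and sym: "\<And>y y'. y \<in> space E \<Longrightarrow> y' \<in> space E \<Longrightarrow> K y y' = K y' y"
    and v: "v \<in> borel_measurable E"
    and sub: "\<And>y y'. y \<in> space E \<Longrightarrow> y' \<in> space E \<Longrightarrow> AE z in K y y'. v z \<le> v y + v y'"
  shows "coll (gain_kernel K) \<kappa> v \<le> coll (loss_kernel E K) \<kappa> v"
proof -
  let ?c = "\<lambda>y y'. emeasure (K y y') (space E)"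
  have sf: "sigma_finite_measure \<kappa>" using \<kappa>(2) by (rule finite_measure.axioms(1))
  have sp: "space \<kappa> = space E" using \<kappa>(1) by (rule sets_eq_imp_space_eq)
  have skk: "sets (\<kappa> \<Otimes>\<^sub>M \<kappa>) = sets (E \<Otimes>\<^sub>M E)" using \<kappa>(1) by (intro sets_pair_measure_cong) auto
  note mE = measurable_cong_sets[OF \<kappa>(1) refl]
  have c[measurable]: "(\<lambda>p. ?c (fst p) (snd p)) \<in> borel_measurable (E \<Otimes>\<^sub>M E)"
    by (rule measurable_kernel2_total[OF K]) measurable
  have c1: "(\<lambda>y'. ?c y y') \<in> borel_measurable \<kappa>" if "y \<in> space E" for y
    using measurable_slices(1)[OF K sets.top \<kappa> that] .
  have p1: "(\<lambda>p. v (fst p) * ?c (fst p) (snd p)) \<in> borel_measurable (E \<Otimes>\<^sub>M E)"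
    and p2: "(\<lambda>p. v (snd p) * ?c (fst p) (snd p)) \<in> borel_measurable (E \<Otimes>\<^sub>M E)"
    using v by measurable
  have i: "(\<lambda>y. \<integral>\<^sup>+y'. F (y, y') \<partial>\<kappa>) \<in> borel_measurable \<kappa>" if "F \<in> borel_measurable (E \<Otimes>\<^sub>M E)" for F
    unfolding mE using that
    by (intro measurable_nn_integral_finite_kernel[OF finite_kernel_const[OF \<kappa>]]) (simp add: split_beta')
  note first = coll_loss_kernel[OF K \<kappa>(1) v, symmetric]
  have "(\<integral>\<^sup>+y. \<integral>\<^sup>+y'. v y' * ?c y y' \<partial>\<kappa> \<partial>\<kappa>) = (\<integral>\<^sup>+y'. \<integral>\<^sup>+y. v y' * ?c y y' \<partial>\<kappa> \<partial>\<kappa>)"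
  proof (rule nn_integral_swap[OF sf sf])
    have "(\<lambda>p. v (fst p) * ?c (snd p) (fst p)) \<in> borel_measurable (E \<Otimes>\<^sub>M E)"
      using measurable_compose[OF measurable_pair_swap' p2] by (simp add: split_beta')
    then show "(\<lambda>(y', y). v y' * ?c y y') \<in> borel_measurable (\<kappa> \<Otimes>\<^sub>M \<kappa>)"
      by (simp add: measurable_cong_sets[OF skk refl] split_beta')
  qed
  also have "\<dots> = (\<integral>\<^sup>+y. \<integral>\<^sup>+y'. v y * ?c y y' \<partial>\<kappa> \<partial>\<kappa>)"
    by (intro nn_integral_cong) (simp add: sp sym)
  finally have second: "(\<integral>\<^sup>+y. \<integral>\<^sup>+y'. v y' * ?c y y' \<partial>\<kappa> \<partial>\<kappa>) = coll (loss_kernel E K) \<kappa> v"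
    by (simp add: first)
  have "coll (gain_kernel K) \<kappa> v \<le> (\<integral>\<^sup>+y. \<integral>\<^sup>+y'. 1 / 2 * (v y * ?c y y' + v y' * ?c y y') \<partial>\<kappa> \<partial>\<kappa>)"
    unfolding coll_def
  proof (intro nn_integral_mono)
    fix y y' assume "y \<in> space \<kappa>" "y' \<in> space \<kappa>"
    then have yy': "y \<in> space E" "y' \<in> space E" by (simp_all add: sp)
    have "(\<integral>\<^sup>+z. v z \<partial>K y y') \<le> (\<integral>\<^sup>+z. v y + v y' \<partial>K y y')"
      using sub[OF yy'] by (rule nn_integral_mono_AE)
    also have "\<dots> = v y * ?c y y' + v y' * ?c y y'"
      by (simp add: finite_kernel2D(4)[OF K yy'] distrib_right)
    finally show "(\<integral>\<^sup>+z. v z \<partial>gain_kernel K y y') \<le> 1 / 2 * (v y * ?c y y' + v y' * ?c y y')"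
      unfolding nn_integral_gain_kernel[OF K yy' v] by (intro mult_left_mono) auto
  qed
  also have "\<dots> = (\<integral>\<^sup>+y. 1 / 2 * ((\<integral>\<^sup>+y'. v y * ?c y y' \<partial>\<kappa>) + (\<integral>\<^sup>+y'. v y' * ?c y y' \<partial>\<kappa>)) \<partial>\<kappa>)"
  proof (rule nn_integral_cong)
    fix y assume "y \<in> space \<kappa>"
    then have c: "(\<lambda>y'. ?c y y') \<in> borel_measurable \<kappa>" by (intro c1) (simp add: sp)
    have v': "v \<in> borel_measurable \<kappa>" using v by (simp add: mE)
    show "(\<integral>\<^sup>+y'. 1 / 2 * (v y * ?c y y' + v y' * ?c y y') \<partial>\<kappa>) =
        1 / 2 * ((\<integral>\<^sup>+y'. v y * ?c y y' \<partial>\<kappa>) + (\<integral>\<^sup>+y'. v y' * ?c y y' \<partial>\<kappa>))"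
      using c v' by (subst nn_integral_cmult, measurable, subst nn_integral_add) auto
  qed
  also have "\<dots> = 1 / 2 * (coll (loss_kernel E K) \<kappa> v + coll (loss_kernel E K) \<kappa> v)"
    using i[OF p1] i[OF p2] by (subst nn_integral_cmult, simp, subst nn_integral_add) (auto simp: first second)
  also have "\<dots> = (1 / 2 * 2) * coll (loss_kernel E K) \<kappa> v" by (simp add: mult_2[symmetric] mult.assoc)
  also have "(1 / 2 * 2 :: ennreal) = 1"
    by (simp add: ennreal_divide_times)
  finally show ?thesis by simp
qed

section \<open>Superposition in time\<close>

text \<open>
  Passes from the equation, an identity between the values of measures on sets, to an
  identity between integrals. The values may be infinite, so that no term can be moved to the
  other side.
\<close>

lemma nn_integral_add_measures_eq:
  assumes sets: "sets A = sets Y" "sets A' = sets Y" "sets B = sets Y" "sets B' = sets Y"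
    and eq: "\<And>C. C \<in> sets Y \<Longrightarrow> emeasure A C + emeasure A' C = emeasure B C + emeasure B' C"
    and f: "f \<in> borel_measurable Y"
  shows "(\<integral>\<^sup>+p. f p \<partial>A) + (\<integral>\<^sup>+p. f p \<partial>A') = (\<integral>\<^sup>+p. f p \<partial>B) + (\<integral>\<^sup>+p. f p \<partial>B')"
proof -
  note sp = sets(1)[THEN sets_eq_imp_space_eq] sets(2)[THEN sets_eq_imp_space_eq]
    sets(3)[THEN sets_eq_imp_space_eq] sets(4)[THEN sets_eq_imp_space_eq]
  note ms = measurable_cong_sets[OF sets(1) refl] measurable_cong_sets[OF sets(2) refl]
    measurable_cong_sets[OF sets(3) refl] measurable_cong_sets[OF sets(4) refl]
  from f show ?thesis
  proof (induct rule: borel_measurable_induct)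
    case (cong f g)
    have "(\<integral>\<^sup>+p. f p \<partial>N) = (\<integral>\<^sup>+p. g p \<partial>N)" if "space N = space Y" for N :: "'a measure"
      using cong(3) that by (intro nn_integral_cong) simp
    then show ?case using cong(4) by (simp add: sp)
  next
    case (set C)
    then show ?case using eq[OF set] by (simp add: sets)
  next
    case (mult u c)
    then show ?case by (simp add: nn_integral_cmult ms distrib_left[symmetric])
  next
    case (add u v)
    have "(\<integral>\<^sup>+p. v p + u p \<partial>A) + (\<integral>\<^sup>+p. v p + u p \<partial>A') =
        ((\<integral>\<^sup>+p. v p \<partial>A) + (\<integral>\<^sup>+p. v p \<partial>A')) + ((\<integral>\<^sup>+p. u p \<partial>A) + (\<integral>\<^sup>+p. u p \<partial>A'))"
      using add by (simp add: nn_integral_add ms add_ac)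
    also have "\<dots> = (\<integral>\<^sup>+p. v p + u p \<partial>B) + (\<integral>\<^sup>+p. v p + u p \<partial>B')"
      unfolding add(3) add(7) using add by (simp add: nn_integral_add ms add_ac)
    finally show ?case .
  next
    case (seq U)
    have SUP: "(\<integral>\<^sup>+p. (SUP i. U i) p \<partial>N) = (SUP i. \<integral>\<^sup>+p. U i p \<partial>N)" if "sets N = sets Y" for N
      unfolding SUP_apply using seq(1,4) that
      by (intro nn_integral_monotone_convergence_SUP) (auto simp: measurable_cong_sets[OF that refl])
    have inc: "incseq (\<lambda>i. \<integral>\<^sup>+p. U i p \<partial>N)" for N
      using seq(4) by (auto simp: incseq_def le_fun_def intro!: nn_integral_mono)
    show ?case
      unfolding SUP[OF sets(1)] SUP[OF sets(2)] SUP[OF sets(3)] SUP[OF sets(4)]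
      by (simp add: ennreal_SUP_add[symmetric] inc seq(3))
  qed
qed

text \<open>
  The integral over time of the measures \<open>N s\<close> is itself a measure, provided that almost all
  of the \<open>N s\<close> come from functionals \<open>\<Phi> s\<close> that depend measurably on \<open>s\<close>; the values of \<open>N\<close> on the exceptional
  null set do not matter.
\<close>

lemma ex_time_mixture:
  fixes N :: "real \<Rightarrow> 'b measure"
  assumes N: "AE s in lborel. s \<in> I \<longrightarrow> sets (N s) = sets Y \<and>
      (\<forall>f\<in>borel_measurable Y. (\<integral>\<^sup>+p. f p \<partial>N s) = \<Phi> s f)"
    and meas: "\<And>h. case_prod h \<in> borel_measurable (borel \<Otimes>\<^sub>M Y) \<Longrightarrow> (\<lambda>s. \<Phi> s (h s)) \<in> borel_measurable borel"
    and I[measurable]: "I \<in> sets borel"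
  shows "\<exists>A. sets A = sets Y \<and>
     (\<forall>f\<in>borel_measurable Y. (\<integral>\<^sup>+p. f p \<partial>A) = (\<integral>\<^sup>+s\<in>I. \<Phi> s f \<partial>lborel)) \<and>
     (\<forall>C\<in>sets Y. emeasure A C = (\<integral>\<^sup>+s\<in>I. emeasure (N s) C \<partial>lborel))"
proof -
  obtain Z where Z: "Z \<in> null_sets lborel"
    and good: "\<And>s. s \<notin> Z \<Longrightarrow> s \<in> I \<Longrightarrow> sets (N s) = sets Y \<and> (\<forall>f\<in>borel_measurable Y. (\<integral>\<^sup>+p. f p \<partial>N s) = \<Phi> s f)"
  proof (rule AE_E3[OF N])
    fix Z assume *: "\<And>s. s \<in> space lborel - Z \<Longrightarrow> s \<in> I \<longrightarrow> sets (N s) = sets Y \<and>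
      (\<forall>f\<in>borel_measurable Y. (\<integral>\<^sup>+p. f p \<partial>N s) = \<Phi> s f)" "Z \<in> null_sets lborel"
    show thesis by (rule that[OF *(2)]) (use *(1) in simp)
  qed
  \<comment> \<open>On \<open>Z\<close> and outside \<open>I\<close> the family is replaced by zero to make it measurable everywhere.\<close>
  define N' where "N' s = (if s \<in> I - Z then N s else null_measure Y)" for s
  have sets_N': "sets (N' s) = sets Y" for s using good by (auto simp: N'_def)
  have N': "(\<integral>\<^sup>+p. f p \<partial>N' s) = \<Phi> s f * indicator (I - Z) s" if "f \<in> borel_measurable Y" for f s
    using good that by (auto simp: N'_def)
  have [measurable]: "Z \<in> sets borel" using Z by auto
  have slice: "h s \<in> borel_measurable Y" if "case_prod h \<in> borel_measurable (borel \<Otimes>\<^sub>M Y)" for h and s :: real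
    using measurable_compose[OF measurable_Pair1' that, of s] by simp
  have bl: "sets ((lborel :: real measure) \<Otimes>\<^sub>M Y) = sets (borel \<Otimes>\<^sub>M Y)"
    by (intro sets_pair_measure_cong) auto
  define P where "P = semidirect lborel Y N'"
  have sP: "sets P = sets (borel \<Otimes>\<^sub>M Y)" by (simp add: P_def sets_semidirect bl)
  have snd: "snd \<in> P \<rightarrow>\<^sub>M Y" by (subst measurable_cong_sets[OF sP refl]) measurable
  have drop: "(\<integral>\<^sup>+s. g s * indicator (I - Z) s \<partial>lborel) = (\<integral>\<^sup>+s\<in>I. g s \<partial>lborel)" for g :: "real \<Rightarrow> ennreal"
    using AE_not_in[OF Z] by (intro nn_integral_cong_AE) (auto split: split_indicator)
  have int: "(\<integral>\<^sup>+p. f p \<partial>distr P Y snd) = (\<integral>\<^sup>+s. \<integral>\<^sup>+p. f p \<partial>N' s \<partial>lborel)" if f: "f \<in> borel_measurable Y" for f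
  proof -
    have "(\<integral>\<^sup>+p. f p \<partial>distr P Y snd) = (\<integral>\<^sup>+q. f (snd q) \<partial>P)"
      using snd f by (intro nn_integral_distr) auto
    also have "\<dots> = (\<integral>\<^sup>+s. \<integral>\<^sup>+p. f (snd (s, p)) \<partial>N' s \<partial>lborel)"
      unfolding P_def
    proof (rule nn_integral_semidirect)
      show "(\<lambda>q. f (snd q)) \<in> borel_measurable (lborel \<Otimes>\<^sub>M Y)" using f by measurable
      fix h :: "real \<Rightarrow> 'b \<Rightarrow> ennreal" assume "case_prod h \<in> borel_measurable (lborel \<Otimes>\<^sub>M Y)"
      then have h: "case_prod h \<in> borel_measurable (borel \<Otimes>\<^sub>M Y)"
        by (simp add: measurable_cong_sets[OF bl refl])
      show "(\<lambda>s. \<integral>\<^sup>+p. h s p \<partial>N' s) \<in> borel_measurable lborel"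
        using meas[OF h] by (simp add: N'[OF slice[OF h]])
    qed (rule sets_N')
    finally show ?thesis by simp
  qed
  show ?thesis
  proof (intro exI[of _ "distr P Y snd"] conjI ballI)
    show "(\<integral>\<^sup>+p. f p \<partial>distr P Y snd) = (\<integral>\<^sup>+s\<in>I. \<Phi> s f \<partial>lborel)" if f: "f \<in> borel_measurable Y" for f
      unfolding int[OF f] N'[OF f] by (rule drop)
    fix C assume C: "C \<in> sets Y"
    have "emeasure (distr P Y snd) C = (\<integral>\<^sup>+p. indicator C p \<partial>distr P Y snd)" using C by simp
    also have "\<dots> = (\<integral>\<^sup>+s. \<integral>\<^sup>+p. indicator C p \<partial>N' s \<partial>lborel)" using C by (intro int) simp
    also have "\<dots> = (\<integral>\<^sup>+s. emeasure (N s) C * indicator (I - Z) s \<partial>lborel)"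
      using C by (intro nn_integral_cong) (simp add: sets_N', simp add: N'_def)
    also have "\<dots> = (\<integral>\<^sup>+s\<in>I. emeasure (N s) C \<partial>lborel)" by (rule drop)
    finally show "emeasure (distr P Y snd) C = (\<integral>\<^sup>+s\<in>I. emeasure (N s) C \<partial>lborel)" .
  qed simp
qed

text \<open>
  With \<open>L\<close> the kernel of the gain or of the loss, this is the integral of \<open>v\<close> against the measure that the
  collisions at time \<open>s\<close> produce at the point \<open>x'\<close> at time \<open>t\<close>, after diffusion during \<open>t - s\<close>.
\<close>

definition evolved :: "('e \<Rightarrow> 'e \<Rightarrow> 'e measure) \<Rightarrow> ('e \<Rightarrow> real) \<Rightarrow>
    (real \<times> 'x::euclidean_space \<Rightarrow> 'e measure) \<Rightarrow> real \<Rightarrow> real \<Rightarrow> 'x \<Rightarrow> ('e \<Rightarrow> ennreal) \<Rightarrow> ennreal" where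
  "evolved L a \<kappa> t s x' v = (\<integral>\<^sup>+x. coll L (\<kappa> (s, x)) (\<lambda>z. ennreal (heat_kernel (a z * (t - s)) x x') * v z) \<partial>lborel)"

lemma measurable_evolved:
  fixes \<kappa> :: "real \<times> 'x::euclidean_space \<Rightarrow> 'e measure"
  assumes L: "finite_kernel2 E L" and \<kappa>: "finite_kernel borel E \<kappa>"
    and a[measurable]: "a \<in> borel_measurable E"
    and h: "case_prod h \<in> borel_measurable (((borel :: real measure) \<Otimes>\<^sub>M (borel :: 'x measure)) \<Otimes>\<^sub>M E)"
  shows "(\<lambda>(s, x'). evolved L a \<kappa> t s x' (h (s, x'))) \<in> borel_measurable ((borel :: real measure) \<Otimes>\<^sub>M (borel :: 'x measure))"
proof -
  let ?X = "((borel :: real measure) \<Otimes>\<^sub>M (borel :: 'x measure)) \<Otimes>\<^sub>M (lborel :: 'x measure)"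
  have "(\<lambda>p. (fst (fst p), snd p)) \<in> ?X \<rightarrow>\<^sub>M borel \<Otimes>\<^sub>M borel" by measurable
  then have "(\<lambda>p. (fst (fst p), snd p)) \<in> ?X \<rightarrow>\<^sub>M (borel :: (real \<times> 'x) measure)" by (simp add: borel_prod)
  then have k: "finite_kernel ?X E (\<lambda>p. \<kappa> (fst (fst p), snd p))" by (rule finite_kernel_compose[OF \<kappa>])
  have "(\<lambda>q. ennreal (heat_kernel (a (snd q) * (t - fst (fst (fst q)))) (snd (fst q)) (snd (fst (fst q)))) *
      case_prod h (fst (fst q), snd q)) \<in> borel_measurable (?X \<Otimes>\<^sub>M E)"
    using h by measurable
  then have "(\<lambda>p. coll L (\<kappa> (fst (fst p), snd p)) (\<lambda>z. ennreal (heat_kernel (a z * (t - fst (fst p))) (snd p) (snd (fst p))) *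
       h (fst p) z)) \<in> borel_measurable ?X"
    using measurable_coll[OF L k] by (simp add: split_beta')
  then show ?thesis
    unfolding evolved_def
    using lborel.borel_measurable_nn_integral[of "\<lambda>q x. coll L (\<kappa> (fst q, x)) (\<lambda>z. ennreal (heat_kernel (a z * (t - fst q)) x (snd q)) *
       h q z)" "(borel :: real measure) \<Otimes>\<^sub>M (borel :: 'x measure)"]
    by (simp add: split_beta')
qed

lemma heat_flow_source:
  fixes \<nu> :: "('x::euclidean_space \<times> 'e) measure"
  assumes L: "finite_kernel2 E L" and \<kappa>: "finite_kernel lborel E \<kappa>"
    and a[measurable]: "a \<in> borel_measurable E" and \<tau>: "\<tau> \<noteq> 0"
    and \<nu>: "sets \<nu> = sets (borel \<Otimes>\<^sub>M E)"
    and int: "\<And>f. f \<in> borel_measurable (borel \<Otimes>\<^sub>M E) \<Longrightarrow> (\<integral>\<^sup>+p. f p \<partial>\<nu>) = (\<integral>\<^sup>+x. coll L (\<kappa> x) (\<lambda>z. f (x, z)) \<partial>lborel)"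
  shows "sets (heat_flow E a \<tau> \<nu>) = sets (borel \<Otimes>\<^sub>M E)"
    and "f \<in> borel_measurable (borel \<Otimes>\<^sub>M E) \<Longrightarrow> (\<integral>\<^sup>+q. f q \<partial>heat_flow E a \<tau> \<nu>) =
      (\<integral>\<^sup>+x'. \<integral>\<^sup>+x. coll L (\<kappa> x) (\<lambda>z. ennreal (heat_kernel (a z * \<tau>) x x') * f (x', z)) \<partial>lborel \<partial>lborel)"
    and "v \<in> borel_measurable E \<Longrightarrow> (\<integral>\<^sup>+z. v z \<partial>heat_at E a \<tau> \<nu> x') =
      (\<integral>\<^sup>+x. coll L (\<kappa> x) (\<lambda>z. ennreal (heat_kernel (a z * \<tau>) x x') * v z) \<partial>lborel)"
proof -
  let ?X = "(borel :: 'x measure) \<Otimes>\<^sub>M (lborel :: 'x measure)"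
  have slice: "(\<lambda>p. h x p) \<in> borel_measurable Y" if "case_prod h \<in> borel_measurable (borel \<Otimes>\<^sub>M Y)"
    for h :: "'x \<Rightarrow> 'z \<Rightarrow> ennreal" and x and Y
    using measurable_compose[OF measurable_Pair1' that, of x] by simp
  have par: "(\<lambda>x'. \<integral>\<^sup>+p. h x' p \<partial>\<nu>) \<in> borel_measurable borel"
    if h: "case_prod h \<in> borel_measurable ((borel :: 'x measure) \<Otimes>\<^sub>M (borel \<Otimes>\<^sub>M E))" for h
  proof -
    have "(\<lambda>q. case_prod h (fst (fst q), (snd (fst q), snd q))) \<in> borel_measurable (?X \<Otimes>\<^sub>M E)"
      using h by measurable
    then have "(\<lambda>p. coll L (\<kappa> (snd p)) (\<lambda>z. h (fst p) (snd p, z))) \<in> borel_measurable ?X"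
      using measurable_coll[OF L finite_kernel_compose[OF \<kappa> measurable_snd]] by (simp add: split_beta')
    then have "(\<lambda>x'. \<integral>\<^sup>+x. coll L (\<kappa> x) (\<lambda>z. h x' (x, z)) \<partial>lborel) \<in> borel_measurable borel"
      by (intro lborel.borel_measurable_nn_integral) (simp add: split_beta')
    then show ?thesis by (simp add: int[OF slice[OF h]])
  qed
  show "sets (heat_flow E a \<tau> \<nu>) = sets (borel \<Otimes>\<^sub>M E)"
    by (rule heat_flow_integral(1)[OF \<nu> a \<tau> par])
  show "(\<integral>\<^sup>+z. v z \<partial>heat_at E a \<tau> \<nu> x') = (\<integral>\<^sup>+x. coll L (\<kappa> x) (\<lambda>z. ennreal (heat_kernel (a z * \<tau>) x x') * v z) \<partial>lborel)"
    if [measurable]: "v \<in> borel_measurable E" for v x'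
    unfolding heat_at_integral(2)[OF \<nu> a that] by (subst int) auto
  assume f: "f \<in> borel_measurable (borel \<Otimes>\<^sub>M E)"
  have "(\<integral>\<^sup>+p. ennreal (heat_kernel (a (snd p) * \<tau>) (fst p) x') * f (x', snd p) \<partial>\<nu>) =
     (\<integral>\<^sup>+x. coll L (\<kappa> x) (\<lambda>z. ennreal (heat_kernel (a z * \<tau>) x x') * f (x', z)) \<partial>lborel)" for x'
  proof -
    have [measurable]: "(\<lambda>z. f (x', z)) \<in> borel_measurable E"
      using slice[of "\<lambda>x z. f (x, z)"] f by simp
    show ?thesis by (subst int) auto
  qed
  then show "(\<integral>\<^sup>+q. f q \<partial>heat_flow E a \<tau> \<nu>) =
      (\<integral>\<^sup>+x'. \<integral>\<^sup>+x. coll L (\<kappa> x) (\<lambda>z. ennreal (heat_kernel (a z * \<tau>) x x') * f (x', z)) \<partial>lborel \<partial>lborel)"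
    using heat_flow_integral(2)[OF \<nu> a \<tau> par f] by simp
qed

lemma ex_source_mixture:
  fixes \<kappa> :: "real \<times> 'x::euclidean_space \<Rightarrow> 'e measure"
  assumes L: "finite_kernel2 E L" and \<kappa>: "finite_kernel borel E \<kappa>"
    and a[measurable]: "a \<in> borel_measurable E"
    and \<nu>: "AE s in lborel. 0 \<le> s \<and> s < t \<longrightarrow> sets (\<nu> s) = sets (borel \<Otimes>\<^sub>M E) \<and>
      (\<forall>f\<in>borel_measurable (borel \<Otimes>\<^sub>M E). (\<integral>\<^sup>+p. f p \<partial>\<nu> s) = (\<integral>\<^sup>+x. coll L (\<kappa> (s, x)) (\<lambda>z. f (x, z)) \<partial>lborel))"
  shows "\<exists>A. sets A = sets (borel \<Otimes>\<^sub>M E) \<and>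
     (\<forall>f\<in>borel_measurable (borel \<Otimes>\<^sub>M E). (\<integral>\<^sup>+p. f p \<partial>A) =
       (\<integral>\<^sup>+s\<in>{0..<t}. (\<integral>\<^sup>+x'. evolved L a \<kappa> t s x' (\<lambda>z. f (x', z)) \<partial>lborel) \<partial>lborel)) \<and>
     (\<forall>C\<in>sets (borel \<Otimes>\<^sub>M E). emeasure A C = (\<integral>\<^sup>+s\<in>{0..<t}. emeasure (heat_flow E a (t - s) (\<nu> s)) C \<partial>lborel))"
proof (rule ex_time_mixture)
  show "AE s in lborel. s \<in> {0..<t} \<longrightarrow> sets (heat_flow E a (t - s) (\<nu> s)) = sets (borel \<Otimes>\<^sub>M E) \<and>
     (\<forall>f\<in>borel_measurable (borel \<Otimes>\<^sub>M E). (\<integral>\<^sup>+q. f q \<partial>heat_flow E a (t - s) (\<nu> s)) =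
       (\<integral>\<^sup>+x'. evolved L a \<kappa> t s x' (\<lambda>z. f (x', z)) \<partial>lborel))"
    using \<nu>
  proof (eventually_elim, intro impI)
    fix s assume *: "0 \<le> s \<and> s < t \<longrightarrow> sets (\<nu> s) = sets (borel \<Otimes>\<^sub>M E) \<and>
      (\<forall>f\<in>borel_measurable (borel \<Otimes>\<^sub>M E). (\<integral>\<^sup>+p. f p \<partial>\<nu> s) = (\<integral>\<^sup>+x. coll L (\<kappa> (s, x)) (\<lambda>z. f (x, z)) \<partial>lborel))"
      and s: "s \<in> {0..<t}"
    have Pair: "Pair s \<in> lborel \<rightarrow>\<^sub>M (borel :: (real \<times> 'x) measure)"
      using borel_measurable_continuous_onI[of "Pair s :: 'x \<Rightarrow> _"] by (simp add: continuous_intros)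
    have k: "finite_kernel lborel E (\<lambda>x. \<kappa> (s, x))" by (rule finite_kernel_compose[OF \<kappa> Pair])
    have \<tau>: "t - s \<noteq> 0" and \<nu>s: "sets (\<nu> s) = sets (borel \<Otimes>\<^sub>M E)" using s * by auto
    have i: "(\<integral>\<^sup>+p. f p \<partial>\<nu> s) = (\<integral>\<^sup>+x. coll L (\<kappa> (s, x)) (\<lambda>z. f (x, z)) \<partial>lborel)"
      if "f \<in> borel_measurable (borel \<Otimes>\<^sub>M E)" for f using s * that by auto
    note hf = heat_flow_source[OF L k a \<tau> \<nu>s i]
    show "sets (heat_flow E a (t - s) (\<nu> s)) = sets (borel \<Otimes>\<^sub>M E) \<and>
     (\<forall>f\<in>borel_measurable (borel \<Otimes>\<^sub>M E). (\<integral>\<^sup>+q. f q \<partial>heat_flow E a (t - s) (\<nu> s)) =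
       (\<integral>\<^sup>+x'. evolved L a \<kappa> t s x' (\<lambda>z. f (x', z)) \<partial>lborel))"
      unfolding evolved_def using hf(1,2) by blast
  qed
  fix h :: "real \<Rightarrow> 'x \<times> 'e \<Rightarrow> ennreal"
  assume h: "case_prod h \<in> borel_measurable (borel \<Otimes>\<^sub>M (borel \<Otimes>\<^sub>M E))"
  have "(\<lambda>q. case_prod h (fst (fst q), (snd (fst q), snd q))) \<in> borel_measurable (((borel :: real measure) \<Otimes>\<^sub>M (borel :: 'x measure)) \<Otimes>\<^sub>M E)"
    using h by measurable
  then have h': "case_prod (\<lambda>p z. h (fst p) (snd p, z)) \<in> borel_measurable (((borel :: real measure) \<Otimes>\<^sub>M (borel :: 'x measure)) \<Otimes>\<^sub>M E)"
    by (simp add: split_beta')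
  have bl: "sets ((borel :: real measure) \<Otimes>\<^sub>M (lborel :: 'x measure)) = sets (borel \<Otimes>\<^sub>M borel)"
    by (intro sets_pair_measure_cong) auto
  have m: "(\<lambda>(s, x'). evolved L a \<kappa> t s x' (\<lambda>z. h s (x', z))) \<in> borel_measurable ((borel :: real measure) \<Otimes>\<^sub>M (lborel :: 'x measure))"
    using measurable_evolved[OF L \<kappa> a h', of t] by (simp add: measurable_cong_sets[OF bl refl])
  show "(\<lambda>s. \<integral>\<^sup>+x'. evolved L a \<kappa> t s x' (\<lambda>z. h s (x', z)) \<partial>lborel) \<in> borel_measurable borel"
    by (rule lborel.borel_measurable_nn_integral[OF m])
qed auto

lemma evolved_indicator:
  "evolved L a \<kappa> t s x' (\<lambda>z. indicator B x' * v z) = indicator B x' * evolved L a \<kappa> t s x' v"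
  by (cases "x' \<in> B") (simp_all add: evolved_def coll_def)

section \<open>The integrated equation\<close>

text \<open>
  The dimension is a variable here, tied to the type \<open>'x\<close> by an equation, because the
  setting of the kernel mentions it as a number only.
\<close>

locale coagulation_solution = coagulation_setting d E m a K \<phi>
  for d and E :: "'e measure" and m a K \<phi> +
  fixes T :: ereal and \<mu> :: "real \<Rightarrow> ('x::euclidean_space \<times> 'e) measure"
  assumes dim: "d = DIM('x)"
    and solution: "solution E m a K \<phi> T \<mu>"
begin

abbreviation gainK :: "'e \<Rightarrow> 'e \<Rightarrow> 'e measure" where "gainK \<equiv> gain_kernel K"
abbreviation lossK :: "'e \<Rightarrow> 'e \<Rightarrow> 'e measure" where "lossK \<equiv> loss_kernel E K"

lemmas gainK = finite_kernel2_gain_kernel[OF kernel] and lossK = finite_kernel2_loss_kernel[OF kernel]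

lemma state: "0 \<le> t \<Longrightarrow> ereal t < T \<Longrightarrow> \<mu> t \<in> state_space E"
  using solution by (auto simp: solution_def process_def)

lemma state_before: "ereal t < T \<Longrightarrow> 0 \<le> s \<Longrightarrow> s < t \<Longrightarrow> \<mu> s \<in> state_space E"
  by (rule state) (auto intro: less_trans[of "ereal s" "ereal t"])

definition disintegration_upto :: "real \<Rightarrow> (real \<times> 'x \<Rightarrow> 'e measure) \<Rightarrow> bool" where
  "disintegration_upto t \<kappa> \<longleftrightarrow> finite_kernel borel E \<kappa> \<and>
     (AE s in lborel. 0 \<le> s \<and> s < t \<longrightarrow> is_disintegration E (\<mu> s) (\<lambda>x. \<kappa> (s, x)))"

lemma ex_disintegration_upto:
  assumes t: "ereal t < T"
  shows "\<exists>\<kappa>. disintegration_upto t \<kappa>"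
  unfolding disintegration_upto_def
proof (rule joint_disintegration[OF standard])
  fix s assume "0 \<le> s" "s < t"
  then show "\<mu> s \<in> state_space E" by (rule state_before[OF t])
next
  fix B :: "'x set" and A assume "B \<in> sets borel" "A \<in> sets E"
  then have "(\<lambda>s. emeasure (\<mu> s) (B \<times> A)) \<in> borel_measurable (restrict_space borel {s. 0 \<le> s \<and> ereal s < T})"
    using solution by (auto simp: solution_def process_def)
  then show "(\<lambda>s. emeasure (\<mu> s) (B \<times> A)) \<in> borel_measurable (restrict_space borel {0..<t})"
    by (rule measurable_restrict_mono) (use t in \<open>auto intro: less_trans[of "ereal _" "ereal t"]\<close>)
qed

lemma disintegration_uptoD:
  assumes "disintegration_upto t \<kappa>"
  shows "finite_kernel borel E \<kappa>" "sets (\<kappa> p) = sets E" "finite_measure (\<kappa> p)"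
    "AE s in lborel. 0 \<le> s \<and> s < t \<longrightarrow> is_disintegration E (\<mu> s) (\<lambda>x. \<kappa> (s, x))"
  using assms finite_kernelD[of borel E \<kappa> p] by (auto simp: disintegration_upto_def)

lemma ex_collision_mixture:
  assumes t: "ereal t < T" and \<kappa>: "disintegration_upto t \<kappa>" and L: "finite_kernel2 E L"
    and C: "collision_operator E C L"
  shows "\<exists>A. sets A = sets (borel \<Otimes>\<^sub>M E) \<and>
     (\<forall>f\<in>borel_measurable (borel \<Otimes>\<^sub>M E). (\<integral>\<^sup>+p. f p \<partial>A) =
       (\<integral>\<^sup>+s\<in>{0..<t}. (\<integral>\<^sup>+x'. evolved L a \<kappa> t s x' (\<lambda>z. f (x', z)) \<partial>lborel) \<partial>lborel)) \<and>
     (\<forall>D\<in>sets (borel \<Otimes>\<^sub>M E). emeasure A D = (\<integral>\<^sup>+s\<in>{0..<t}. emeasure (heat_flow E a (t - s) (C (\<mu> s))) D \<partial>lborel))"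
proof (rule ex_source_mixture[OF L disintegration_uptoD(1)[OF \<kappa>] a_measurable])
  show "AE s in lborel. 0 \<le> s \<and> s < t \<longrightarrow> sets (C (\<mu> s)) = sets (borel \<Otimes>\<^sub>M E) \<and>
      (\<forall>f\<in>borel_measurable (borel \<Otimes>\<^sub>M E). (\<integral>\<^sup>+p. f p \<partial>C (\<mu> s)) = (\<integral>\<^sup>+x. coll L (\<kappa> (s, x)) (\<lambda>z. f (x, z)) \<partial>lborel))"
    using disintegration_uptoD(4)[OF \<kappa>]
  proof (eventually_elim, intro impI)
    fix s assume "0 \<le> s \<and> s < t \<longrightarrow> is_disintegration E (\<mu> s) (\<lambda>x. \<kappa> (s, x))" "0 \<le> s \<and> s < t"
    then show "sets (C (\<mu> s)) = sets (borel \<Otimes>\<^sub>M E) \<and>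
      (\<forall>f\<in>borel_measurable (borel \<Otimes>\<^sub>M E). (\<integral>\<^sup>+p. f p \<partial>C (\<mu> s)) = (\<integral>\<^sup>+x. coll L (\<kappa> (s, x)) (\<lambda>z. f (x, z)) \<partial>lborel))"
      using C state_before[OF t, of s] by (simp add: collision_operator_def)
  qed
qed

text \<open>
  The equation of the solution tested against an arbitrary nonnegative function. All later
  estimates start from this identity.
\<close>

lemma mild_integral:
  assumes t: "0 < t" "ereal t < T" and \<kappa>: "disintegration_upto t \<kappa>"
    and f: "f \<in> borel_measurable (borel \<Otimes>\<^sub>M E)"
  shows "(\<integral>\<^sup>+p. f p \<partial>\<mu> t) + (\<integral>\<^sup>+s\<in>{0..<t}. (\<integral>\<^sup>+x'. evolved lossK a \<kappa> t s x' (\<lambda>z. f (x', z)) \<partial>lborel) \<partial>lborel) =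
    (\<integral>\<^sup>+x'. \<integral>\<^sup>+p. ennreal (heat_kernel (a (snd p) * t) (fst p) x') * f (x', snd p) \<partial>\<mu> 0 \<partial>lborel) +
    (\<integral>\<^sup>+s\<in>{0..<t}. (\<integral>\<^sup>+x'. evolved gainK a \<kappa> t s x' (\<lambda>z. f (x', z)) \<partial>lborel) \<partial>lborel)"
proof -
  from ex_collision_mixture[OF t(2) \<kappa> gainK collision_operator_K_plus[OF kernel standard]]
  obtain P where P: "sets P = sets (borel \<Otimes>\<^sub>M E)"
    "\<forall>f\<in>borel_measurable (borel \<Otimes>\<^sub>M E). (\<integral>\<^sup>+p. f p \<partial>P) =
       (\<integral>\<^sup>+s\<in>{0..<t}. (\<integral>\<^sup>+x'. evolved gainK a \<kappa> t s x' (\<lambda>z. f (x', z)) \<partial>lborel) \<partial>lborel)"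
    "\<forall>C\<in>sets (borel \<Otimes>\<^sub>M E). emeasure P C = (\<integral>\<^sup>+s\<in>{0..<t}. emeasure (heat_flow E a (t - s) (K_plus E K (\<mu> s))) C \<partial>lborel)"
    by blast
  from ex_collision_mixture[OF t(2) \<kappa> lossK collision_operator_K_minus[OF kernel standard]]
  obtain M where M: "sets M = sets (borel \<Otimes>\<^sub>M E)"
    "\<forall>f\<in>borel_measurable (borel \<Otimes>\<^sub>M E). (\<integral>\<^sup>+p. f p \<partial>M) =
       (\<integral>\<^sup>+s\<in>{0..<t}. (\<integral>\<^sup>+x'. evolved lossK a \<kappa> t s x' (\<lambda>z. f (x', z)) \<partial>lborel) \<partial>lborel)"
    "\<forall>C\<in>sets (borel \<Otimes>\<^sub>M E). emeasure M C = (\<integral>\<^sup>+s\<in>{0..<t}. emeasure (heat_flow E a (t - s) (K_minus E K (\<mu> s))) C \<partial>lborel)"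
    by blast
  have st0: "\<mu> 0 \<in> state_space E" using t by (intro state_before[OF t(2)]) auto
  have par: "(\<lambda>x'. \<integral>\<^sup>+p. h x' p \<partial>\<mu> 0) \<in> borel_measurable borel"
    if "case_prod h \<in> borel_measurable ((borel :: 'x measure) \<Otimes>\<^sub>M (borel \<Otimes>\<^sub>M E))" for h
    using that by (rule measurable_nn_integral_finite_kernel[OF finite_kernel_const[OF state_spaceD(1,2)[OF st0]]])
  note hf = heat_flow_integral[OF state_spaceD(1)[OF st0] a_measurable, of t, OF _ par]
  have "(\<integral>\<^sup>+p. f p \<partial>\<mu> t) + (\<integral>\<^sup>+p. f p \<partial>M) = (\<integral>\<^sup>+p. f p \<partial>heat_flow E a t (\<mu> 0)) + (\<integral>\<^sup>+p. f p \<partial>P)"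
  proof (rule nn_integral_add_measures_eq[OF _ M(1) _ P(1) _ f])
    show "sets (\<mu> t) = sets (borel \<Otimes>\<^sub>M E)" using state_spaceD(1)[OF state] t by auto
    show "sets (heat_flow E a t (\<mu> 0)) = sets (borel \<Otimes>\<^sub>M E)" using t by (intro hf) auto
    show "emeasure (\<mu> t) C + emeasure M C = emeasure (heat_flow E a t (\<mu> 0)) C + emeasure P C"
      if "C \<in> sets (borel \<Otimes>\<^sub>M E)" for C
      using solution t that M(3) P(3) by (simp add: solution_def)
  qed
  moreover have "(\<integral>\<^sup>+p. f p \<partial>heat_flow E a t (\<mu> 0)) =
     (\<integral>\<^sup>+x'. \<integral>\<^sup>+p. ennreal (heat_kernel (a (snd p) * t) (fst p) x') * f (x', snd p) \<partial>\<mu> 0 \<partial>lborel)"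
    using t f by (intro hf) auto
  ultimately show ?thesis using M(2) P(2) f by simp
qed

end

section \<open>Pointwise comparison of gain and loss\<close>

text \<open>
  With \<open>l = (r + r') / r\<close> the hypothesis gives \<open>r \<psi>(r + r') \<le> (r + r') \<psi>(r)\<close>. Adding the
  same inequality with \<open>r\<close> and \<open>r'\<close> exchanged yields the claim.
\<close>

lemma sublinear_imp_subadditive:
  fixes \<psi> :: "real \<Rightarrow> real"
  assumes sub: "\<And>l r. 1 \<le> l \<Longrightarrow> 0 < r \<Longrightarrow> \<psi> (l * r) \<le> l * \<psi> r"
    and r: "0 < r" "0 < r'"
  shows "\<psi> (r + r') \<le> \<psi> r + \<psi> r'"
proof -
  have *: "p * \<psi> (p + q) \<le> (p + q) * \<psi> p" if "0 < p" "0 < q" for p q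
  proof -
    have "(p + q) / p * p = p + q" using that by simp
    then have "\<psi> (p + q) \<le> (p + q) / p * \<psi> p"
      using sub[of "(p + q) / p" p] that by simp
    from mult_left_mono[OF this, of p] show ?thesis using that by simp
  qed
  have "(r + r') * \<psi> (r + r') \<le> (r + r') * (\<psi> r + \<psi> r')"
    using *[of r r'] *[of r' r] r by (simp add: algebra_simps)
  then show ?thesis using r by simp
qed

text \<open>
  The form in which the integrated equation is used: if the gain \<open>G\<close> is finite, then so is the
  larger loss \<open>L\<close>, and \<open>L\<close> can be cancelled.
\<close>

lemma ennreal_cancel_balance:
  fixes \<alpha> \<beta> :: ennreal
  assumes "\<alpha> + L = \<beta> + G" "G \<le> L" "\<beta> < \<infinity>" "G < \<infinity>"
  shows "\<alpha> \<le> \<beta>"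
proof -
  have "L \<le> \<alpha> + L" by simp
  also have "\<dots> < \<infinity>" using assms by (simp add: less_top[symmetric])
  finally have "L \<noteq> \<infinity>" by simp
  moreover have "L + \<alpha> \<le> L + \<beta>"
    using assms(1) add_left_mono[OF assms(2), of \<beta>] by (simp add: add.commute)
  ultimately show ?thesis using ennreal_add_left_cancel_le by blast
qed

text \<open>
  The integral of \<open>f - W\<close> over the part of a ball where \<open>f > W\<close> cannot be positive, so this
  part is a null set.
\<close>

lemma AE_le_of_average_le:
  fixes f :: "'x::euclidean_space \<Rightarrow> ennreal"
  assumes f[measurable]: "f \<in> borel_measurable borel" and W: "W < \<infinity>"
    and le: "\<And>B. B \<in> sets borel \<Longrightarrow> (\<integral>\<^sup>+x\<in>B. f x \<partial>lborel) \<le> W * emeasure lborel B"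
  shows "AE x in lborel. f x \<le> W"
proof -
  have "AE x in lborel. \<not> (x \<in> cball 0 (real k) \<and> W < f x)" for k :: nat
  proof -
    define D where "D = cball 0 (real k) \<inter> {x. W < f x}"
    have [measurable]: "D \<in> sets borel" unfolding D_def by measurable
    have "emeasure lborel D \<le> emeasure lborel (cball (0::'x) (real k))"
      by (intro emeasure_mono) (auto simp: D_def)
    also have "\<dots> < \<infinity>" by (rule emeasure_lborel_cball_finite)
    finally have fin: "W * emeasure lborel D \<noteq> \<infinity>" using W by (auto simp: ennreal_mult_eq_top_iff)
    have "(\<integral>\<^sup>+x. (f x - W) * indicator D x \<partial>lborel) + W * emeasure lborel D =
        (\<integral>\<^sup>+x. (f x - W) * indicator D x + W * indicator D x \<partial>lborel)"
      by (subst nn_integral_add) (auto simp: nn_integral_cmult_indicator)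
    also have "\<dots> = (\<integral>\<^sup>+x\<in>D. f x \<partial>lborel)"
      by (intro nn_integral_cong) (auto simp: D_def diff_add_cancel_ennreal less_imp_le split: split_indicator)
    also have "\<dots> \<le> 0 + W * emeasure lborel D" using le[of D] by simp
    finally have "(\<integral>\<^sup>+x. (f x - W) * indicator D x \<partial>lborel) \<le> 0"
      using fin by (metis add.commute ennreal_add_left_cancel_le)
    then have "AE x in lborel. (f x - W) * indicator D x = 0"
      by (subst (asm) le_zero_eq, subst (asm) nn_integral_0_iff_AE) auto
    then show ?thesis
    proof eventually_elim
      fix x assume "(f x - W) * indicator D x = 0"
      then show "\<not> (x \<in> cball 0 (real k) \<and> W < f x)"
        by (auto simp: D_def diff_eq_0_iff_ennreal indicator_def not_less split: if_splits)
    qed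
  qed
  then have "AE x in lborel. \<forall>k::nat. \<not> (x \<in> cball 0 (real k) \<and> W < f x)"
    unfolding AE_all_countable by blast
  then show ?thesis
  proof eventually_elim
    fix x :: 'x assume *: "\<forall>k::nat. \<not> (x \<in> cball 0 (real k) \<and> W < f x)"
    obtain k :: nat where "norm x \<le> real k" using real_arch_simple by blast
    then show "f x \<le> W" using * by (auto simp: not_less)
  qed
qed

context coagulation_solution
begin

abbreviation w :: "'e \<Rightarrow> real" where "w \<equiv> weight d m a \<phi>"

lemmas [measurable] = a_measurable

lemma m_measurable[measurable]: "m \<in> borel_measurable E" and m_pos: "y \<in> space E \<Longrightarrow> 0 < m y"
  and m_additive: "y \<in> space E \<Longrightarrow> y' \<in> space E \<Longrightarrow> AE z in K y y'. m z = m y + m y'"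
  using mass by (auto simp: mass_function_def)

lemma phi_m_measurable[measurable]: "(\<lambda>y. \<phi> (m y)) \<in> borel_measurable E"
proof -
  have "\<phi> \<in> borel_measurable (restrict_space borel {0<..})"
    using phi_continuous by (rule borel_measurable_continuous_on_restrict)
  moreover have "m \<in> E \<rightarrow>\<^sub>M restrict_space borel {0<..}"
    by (intro measurable_restrict_space2) (auto simp: m_pos)
  ultimately show ?thesis by (rule measurable_compose[rotated])
qed

lemma w_measurable[measurable]: "w \<in> borel_measurable E"
  unfolding weight_def[abs_def] by measurable

text \<open>
  The comparison holds at each point of space: \<open>a\<^sup>d\<^sup>/\<^sup>2 p(a\<tau>,x,x')\<close> increases with \<open>a\<close>, and \<open>a\<close> of
  the product of a collision is at most \<open>a\<close> of each of the two colliding particles.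
\<close>

lemma evolved_gain_le_loss:
  assumes \<kappa>: "disintegration_upto t \<kappa>" and s: "s < t"
    and c[measurable]: "c \<in> borel_measurable E" and c_nonneg: "\<And>y. y \<in> space E \<Longrightarrow> 0 \<le> c y"
    and sub: "\<And>y y'. y \<in> space E \<Longrightarrow> y' \<in> space E \<Longrightarrow> AE z in K y y'. c z \<le> c y + c y'"
  shows "evolved gainK a \<kappa> t s x' (\<lambda>y. ennreal (a y powr (real d / 2) * c y)) \<le>
    evolved lossK a \<kappa> t s x' (\<lambda>y. ennreal (a y powr (real d / 2) * c y))"
  unfolding evolved_def
proof (intro nn_integral_mono)
  fix x :: 'x
  let ?q = "\<lambda>b. b powr (real d / 2) * heat_kernel (b * (t - s)) x x'"
  let ?v = "\<lambda>y. ennreal (heat_kernel (a y * (t - s)) x x') * ennreal (a y powr (real d / 2) * c y)"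
  have v: "?v y = ennreal (?q (a y) * c y)" for y
    by (subst ennreal_mult'[symmetric]) (simp_all add: heat_kernel_nonneg mult_ac)
  have q_nonneg: "0 \<le> ?q b" for b by (simp add: heat_kernel_nonneg)
  have q_mono: "?q b \<le> ?q b'" if "0 < b" "b \<le> b'" for b b'
    unfolding dim using that s by (intro powr_heat_kernel_mono) auto
  show "coll gainK (\<kappa> (s, x)) ?v \<le> coll lossK (\<kappa> (s, x)) ?v"
  proof (rule gain_le_loss[OF kernel disintegration_uptoD(2,3)[OF \<kappa>] kernel_symmetric])
    show "?v \<in> borel_measurable E" by measurable
    fix y y' assume y: "y \<in> space E" and y': "y' \<in> space E"
    have "AE z in K y y'. a z \<le> a y" using a_decreasing y y' by (auto simp: K_decreasing_def)
    moreover have "AE z in K y y'. a z \<le> a y'"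
      unfolding kernel_symmetric[OF y y'] using a_decreasing y y' by (auto simp: K_decreasing_def)
    moreover have "AE z in K y y'. z \<in> space E"
      using AE_space[of "K y y'"] finite_kernel2D(4)[OF kernel y y'] by simp
    ultimately show "AE z in K y y'. ?v z \<le> ?v y + ?v y'"
      using sub[OF y y']
    proof eventually_elim
      fix z assume z: "a z \<le> a y" "a z \<le> a y'" "z \<in> space E" "c z \<le> c y + c y'"
      have "?q (a z) * c z \<le> ?q (a z) * c y + ?q (a z) * c y'"
        using mult_left_mono[OF z(4) q_nonneg] by (simp add: distrib_left)
      also have "\<dots> \<le> ?q (a y) * c y + ?q (a y') * c y'"
        using z(1,2) a_pos[OF z(3)] y y'
        by (intro add_mono mult_right_mono q_mono c_nonneg) auto
      finally have "ennreal (?q (a z) * c z) \<le> ennreal (?q (a y) * c y + ?q (a y') * c y')"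
        by (rule ennreal_leI)
      also have "\<dots> = ennreal (?q (a y) * c y) + ennreal (?q (a y') * c y')"
        using q_nonneg c_nonneg y y' by (intro ennreal_plus) auto
      finally show "?v z \<le> ?v y + ?v y'" unfolding v .
    qed
  qed
qed

lemma nn_integral_heat_initial:
  assumes t: "0 < t" "ereal t < T" and u[measurable]: "u \<in> borel_measurable E"
  shows "(\<integral>\<^sup>+x'. \<integral>\<^sup>+p. ennreal (heat_kernel (a (snd p) * t) (fst p) x') * u (snd p) \<partial>\<mu> 0 \<partial>lborel) = (\<integral>\<^sup>+p. u (snd p) \<partial>\<mu> 0)"
proof -
  have st0: "\<mu> 0 \<in> state_space E" using t by (intro state_before[OF t(2)]) auto
  note st0 = state_spaceD[OF st0]
  have "(\<integral>\<^sup>+x'. \<integral>\<^sup>+p. ennreal (heat_kernel (a (snd p) * t) (fst p) x') * u (snd p) \<partial>\<mu> 0 \<partial>lborel) =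
     (\<integral>\<^sup>+p. \<integral>\<^sup>+x'. ennreal (heat_kernel (a (snd p) * t) (fst p) x') * u (snd p) \<partial>lborel \<partial>\<mu> 0)"
  proof (rule nn_integral_swap)
    have "sets (\<mu> 0 \<Otimes>\<^sub>M (lborel :: 'x measure)) = sets ((borel \<Otimes>\<^sub>M E) \<Otimes>\<^sub>M borel)"
      using st0(1) by (intro sets_pair_measure_cong) auto
    note ms = measurable_cong_sets[OF this refl]
    show "(\<lambda>(p, x'). ennreal (heat_kernel (a (snd p) * t) (fst p) x') * u (snd p)) \<in> borel_measurable (\<mu> 0 \<Otimes>\<^sub>M lborel)"
      unfolding ms by measurable
  qed (use st0(2) lborel.sigma_finite_measure_axioms in \<open>auto intro: finite_measure.axioms(1)\<close>)
  also have "\<dots> = (\<integral>\<^sup>+p. u (snd p) \<partial>\<mu> 0)"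
  proof (rule nn_integral_cong)
    fix p assume "p \<in> space (\<mu> 0)"
    then have "0 < a (snd p) * t" using a_pos t by (auto simp: st0(3))
    then show "(\<integral>\<^sup>+x'. ennreal (heat_kernel (a (snd p) * t) (fst p) x') * u (snd p) \<partial>lborel) = u (snd p)"
      by (subst nn_integral_multc) (auto simp: nn_integral_heat_kernel)
  qed
  finally show ?thesis .
qed

lemma measurable_evolved_const:
  fixes \<kappa> :: "real \<times> 'x \<Rightarrow> 'e measure"
  assumes L: "finite_kernel2 E L" and \<kappa>: "disintegration_upto t \<kappa>"
    and u[measurable]: "u \<in> borel_measurable E"
  shows "(\<lambda>(s, x'). evolved L a \<kappa> t s x' u) \<in> borel_measurable (borel \<Otimes>\<^sub>M borel)"
  using measurable_evolved[OF L disintegration_uptoD(1)[OF \<kappa>] a_measurable, of "\<lambda>_. u" t] by simp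

text \<open>
  The density at \<open>x'\<close> of the amount of \<open>u\<close> that the collisions before time \<open>t\<close> have
  added by time \<open>t\<close> (for the gain kernel) or taken away (for the loss kernel).
\<close>

definition flux :: "('e \<Rightarrow> 'e \<Rightarrow> 'e measure) \<Rightarrow> (real \<times> 'x \<Rightarrow> 'e measure) \<Rightarrow> real \<Rightarrow>
    ('e \<Rightarrow> ennreal) \<Rightarrow> 'x \<Rightarrow> ennreal" where
  "flux L \<kappa> t u x' = (\<integral>\<^sup>+s\<in>{0..<t}. evolved L a \<kappa> t s x' u \<partial>lborel)"

lemma measurable_flux:
  assumes L: "finite_kernel2 E L" and \<kappa>: "disintegration_upto t \<kappa>"
    and u[measurable]: "u \<in> borel_measurable E"
  shows "flux L \<kappa> t u \<in> borel_measurable borel"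
proof -
  have "(\<lambda>q. (\<lambda>(s, x'). evolved L a \<kappa> t s x' u) (snd q, fst q) * indicator {0..<t} (snd q)) \<in> borel_measurable (borel \<Otimes>\<^sub>M lborel)"
    by (intro borel_measurable_times_ennreal measurable_compose[OF _ measurable_evolved_const[OF assms]]) measurable
  then show ?thesis
    unfolding flux_def[abs_def] by (intro lborel.borel_measurable_nn_integral) (simp add: split_beta')
qed

lemma nn_integral_flux:
  assumes L: "finite_kernel2 E L"
    and \<kappa>: "disintegration_upto t \<kappa>"
    and u[measurable]: "u \<in> borel_measurable E" and B[measurable]: "B \<in> sets borel"
  shows "(\<integral>\<^sup>+s\<in>{0..<t}. (\<integral>\<^sup>+x'. evolved L a \<kappa> t s x' (\<lambda>z. indicator B x' * u z) \<partial>lborel) \<partial>lborel) =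
    (\<integral>\<^sup>+x'\<in>B. flux L \<kappa> t u x' \<partial>lborel)"
proof -
  note e = measurable_evolved_const[OF L \<kappa> u]
  have e1: "(\<lambda>x'. evolved L a \<kappa> t s x' u) \<in> borel_measurable borel" for s
    using measurable_compose[OF measurable_Pair1' e, of s] by simp
  have e2: "(\<lambda>s. evolved L a \<kappa> t s x' u) \<in> borel_measurable borel" for x'
    using measurable_compose[OF measurable_Pair2' e, of x'] by simp
  have "(\<integral>\<^sup>+s\<in>{0..<t}. (\<integral>\<^sup>+x'. evolved L a \<kappa> t s x' (\<lambda>z. indicator B x' * u z) \<partial>lborel) \<partial>lborel) =
      (\<integral>\<^sup>+s. \<integral>\<^sup>+x'. indicator B x' * evolved L a \<kappa> t s x' u * indicator {0..<t} s \<partial>lborel \<partial>lborel)"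
    using e1 by (intro nn_integral_cong) (simp add: evolved_indicator nn_integral_multc)
  also have "\<dots> = (\<integral>\<^sup>+x'. \<integral>\<^sup>+s. indicator B x' * evolved L a \<kappa> t s x' u * indicator {0..<t} s \<partial>lborel \<partial>lborel)"
  proof (rule nn_integral_swap[OF lborel.sigma_finite_measure_axioms lborel.sigma_finite_measure_axioms])
    have bl: "sets ((lborel :: 'x measure) \<Otimes>\<^sub>M (lborel :: real measure)) = sets (borel \<Otimes>\<^sub>M borel)"
      by (intro sets_pair_measure_cong) auto
    have "(\<lambda>q. indicator B (fst q) * (\<lambda>(s, x'). evolved L a \<kappa> t s x' u) (snd q, fst q) * indicator {0..<t} (snd q))
        \<in> borel_measurable ((borel :: 'x measure) \<Otimes>\<^sub>M (borel :: real measure))"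
      by (intro borel_measurable_times_ennreal measurable_compose[OF _ e]) measurable
    then show "(\<lambda>(x', s). indicator B x' * evolved L a \<kappa> t s x' u * indicator {0..<t} s) \<in> borel_measurable (lborel \<Otimes>\<^sub>M lborel)"
      by (simp add: measurable_cong_sets[OF bl refl] split_beta')
  qed
  also have "\<dots> = (\<integral>\<^sup>+x'\<in>B. flux L \<kappa> t u x' \<partial>lborel)"
  proof (rule nn_integral_cong)
    fix x'
    have "(\<integral>\<^sup>+s. indicator B x' * (evolved L a \<kappa> t s x' u * indicator {0..<t} s) \<partial>lborel) = indicator B x' * flux L \<kappa> t u x'"
      unfolding flux_def using e2 by (intro nn_integral_cmult) auto
    then show "(\<integral>\<^sup>+s. indicator B x' * evolved L a \<kappa> t s x' u * indicator {0..<t} s \<partial>lborel) = flux L \<kappa> t u x' * indicator B x'"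
      by (simp add: mult_ac)
  qed
  finally show ?thesis .
qed

lemma localized_balance:
  assumes t: "0 < t" "ereal t < T" and \<kappa>: "disintegration_upto t \<kappa>"
    and u[measurable]: "u \<in> borel_measurable E" and B[measurable]: "B \<in> sets borel"
  shows "(\<integral>\<^sup>+p. indicator B (fst p) * u (snd p) \<partial>\<mu> t) + (\<integral>\<^sup>+x'\<in>B. flux lossK \<kappa> t u x' \<partial>lborel) =
    (\<integral>\<^sup>+x'\<in>B. (\<integral>\<^sup>+p. ennreal (heat_kernel (a (snd p) * t) (fst p) x') * u (snd p) \<partial>\<mu> 0) \<partial>lborel) +
    (\<integral>\<^sup>+x'\<in>B. flux gainK \<kappa> t u x' \<partial>lborel)"
proof -
  have st0: "\<mu> 0 \<in> state_space E" using t by (intro state_before[OF t(2)]) auto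
  have "(\<integral>\<^sup>+p. ennreal (heat_kernel (a (snd p) * t) (fst p) x') * (indicator B x' * u (snd p)) \<partial>\<mu> 0) =
     (\<integral>\<^sup>+p. ennreal (heat_kernel (a (snd p) * t) (fst p) x') * u (snd p) \<partial>\<mu> 0) * indicator B x'" for x'
    by (cases "x' \<in> B") auto
  then show ?thesis
    using mild_integral[OF t \<kappa>, of "\<lambda>p. indicator B (fst p) * u (snd p)"]
      nn_integral_flux[OF gainK \<kappa> u B]
      nn_integral_flux[OF lossK \<kappa> u B]
    by simp
qed

text \<open>
  An approximation of \<open>\<phi>(m)\<close> from below by a function of \<open>m\<close>. It is bounded by \<open>R m\<close> and vanishes for \<open>m > R\<close>,
  so that the last condition on a solution applies to it. The quotient \<open>min \<phi>(r) (Rr) / r\<close> is nonincreasing in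
  \<open>r\<close>, like \<open>\<phi>(r) / r\<close>, and this keeps the minimum subadditive.
\<close>

definition cut_weight :: "real \<Rightarrow> 'e \<Rightarrow> real" where
  "cut_weight R y = (if m y \<le> R then min (\<phi> (m y)) (R * m y) else 0)"

lemma cut_weight_measurable[measurable]: "cut_weight R \<in> borel_measurable E"
  unfolding cut_weight_def[abs_def] by measurable

lemma cut_weight_nonneg: "0 < R \<Longrightarrow> y \<in> space E \<Longrightarrow> 0 \<le> cut_weight R y"
  using m_pos[of y] phi_pos[of "m y"] by (auto simp: cut_weight_def less_imp_le)

text \<open>
  If the product has mass at most \<open>R\<close>, then so have both colliding particles, and the cut-off
  is not felt; otherwise the left-hand side vanishes.
\<close>

lemma cut_weight_subadditive:
  assumes R: "0 < R" and y: "y \<in> space E" "y' \<in> space E"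
  shows "AE z in K y y'. cut_weight R z \<le> cut_weight R y + cut_weight R y'"
  using m_additive[OF y]
proof eventually_elim
  fix z assume z: "m z = m y + m y'"
  have sub: "min (\<phi> (l * r)) (R * (l * r)) \<le> l * min (\<phi> r) (R * r)" if "1 \<le> l" "0 < r" for l r
  proof -
    have "min (\<phi> (l * r)) (R * (l * r)) \<le> l * \<phi> r"
      using phi_sublinear[OF that] by (rule min.coboundedI1)
    moreover have "min (\<phi> (l * r)) (R * (l * r)) \<le> l * (R * r)"
      by (rule min.coboundedI2) (simp add: mult_ac)
    ultimately show ?thesis by (cases "\<phi> r \<le> R * r") (simp_all add: min.absorb1 min.absorb2)
  qed
  show "cut_weight R z \<le> cut_weight R y + cut_weight R y'"
  proof (cases "m z \<le> R")
    case True
    then have "m y \<le> R" "m y' \<le> R" using z m_pos[OF y(1)] m_pos[OF y(2)] by auto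
    then show ?thesis
      using True sublinear_imp_subadditive[of "\<lambda>r. min (\<phi> r) (R * r)", OF sub m_pos[OF y(1)] m_pos[OF y(2)]]
      by (simp add: cut_weight_def z)
  next
    case False
    then show ?thesis using cut_weight_nonneg[OF R] y by (simp add: cut_weight_def[of R z])
  qed
qed

lemma flux_gain_finite:
  assumes t: "0 < t" "ereal t < T" and \<kappa>: "disintegration_upto t \<kappa>" and R: "0 < R"
  shows "AE x' in lborel. flux gainK \<kappa> t (\<lambda>y. ennreal (a y powr (real d / 2) * cut_weight R y)) x' < \<infinity>"
proof -
  let ?u = "\<lambda>y. ennreal (a y powr (real d / 2) * cut_weight R y)"
  let ?tw = "\<lambda>y. ennreal (truncated_weight d m a R y)"
  have [measurable]: "truncated_weight d m a R \<in> borel_measurable E"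
    unfolding truncated_weight_def[abs_def] by measurable
  note \<kappa>D = disintegration_uptoD[OF \<kappa>]
  have heat: "AE s in lborel. s \<in> {0..<t} \<longrightarrow> (\<forall>v\<in>(borel_measurable E :: ('e \<Rightarrow> ennreal) set). \<forall>x'.
      (\<integral>\<^sup>+z. v z \<partial>heat_at E a (t - s) (K_plus E K (\<mu> s)) x') = evolved gainK a \<kappa> t s x' v)"
    using \<kappa>D(4)
  proof (eventually_elim, intro impI ballI allI)
    fix s and v :: "'e \<Rightarrow> ennreal" and x' assume *: "0 \<le> s \<and> s < t \<longrightarrow> is_disintegration E (\<mu> s) (\<lambda>x. \<kappa> (s, x))" "s \<in> {0..<t}"
      and v: "v \<in> borel_measurable E"
    then have dis: "is_disintegration E (\<mu> s) (\<lambda>x. \<kappa> (s, x))" and s: "t - s \<noteq> 0" "0 \<le> s" "s < t" by auto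
    have Kp: "sets (K_plus E K (\<mu> s)) = sets (borel \<Otimes>\<^sub>M E)"
      "f \<in> borel_measurable (borel \<Otimes>\<^sub>M E) \<Longrightarrow>
        (\<integral>\<^sup>+p. f p \<partial>K_plus E K (\<mu> s)) = (\<integral>\<^sup>+x. coll gainK (\<kappa> (s, x)) (\<lambda>z. f (x, z)) \<partial>lborel)"
      for f
      using collision_operator_K_plus[OF kernel standard] state_before[OF t(2) s(2,3)] dis
      by (auto simp: collision_operator_def)
    show "(\<integral>\<^sup>+z. v z \<partial>heat_at E a (t - s) (K_plus E K (\<mu> s)) x') = evolved gainK a \<kappa> t s x' v"
      unfolding evolved_def
      by (rule heat_flow_source(3)[OF gainK is_disintegration_finite_kernel[OF dis]
            a_measurable s(1) Kp v])
  qed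
  have "AE x' in lborel. (\<integral>\<^sup>+s\<in>{0..<t}. (\<integral>\<^sup>+y. ?tw y \<partial>heat_at E a (t - s) (K_plus E K (\<mu> s)) x') \<partial>lborel) < \<infinity>"
    using solution R t unfolding solution_def dim by auto
  then show ?thesis
  proof eventually_elim
    fix x' assume fin: "(\<integral>\<^sup>+s\<in>{0..<t}. (\<integral>\<^sup>+y. ?tw y \<partial>heat_at E a (t - s) (K_plus E K (\<mu> s)) x') \<partial>lborel) < \<infinity>"
    have e: "(\<lambda>s. evolved gainK a \<kappa> t s x' ?tw) \<in> borel_measurable borel"
      using measurable_compose[OF measurable_Pair2' measurable_evolved_const[OF gainK \<kappa>], of x' ?tw]
      by simp
    have "flux gainK \<kappa> t ?u x' \<le> (\<integral>\<^sup>+s. ennreal R * (evolved gainK a \<kappa> t s x' ?tw * indicator {0..<t} s) \<partial>lborel)"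
      unfolding flux_def
    proof (rule nn_integral_mono_AE, use heat in eventually_elim)
      fix s assume h: "s \<in> {0..<t} \<longrightarrow> (\<forall>v\<in>(borel_measurable E :: ('e \<Rightarrow> ennreal) set). \<forall>x'.
         (\<integral>\<^sup>+z. v z \<partial>heat_at E a (t - s) (K_plus E K (\<mu> s)) x') = evolved gainK a \<kappa> t s x' v)"
      show "evolved gainK a \<kappa> t s x' ?u * indicator {0..<t} s \<le> ennreal R * (evolved gainK a \<kappa> t s x' ?tw * indicator {0..<t} s)"
      proof (cases "s \<in> {0..<t}")
        case True
        let ?h = "heat_at E a (t - s) (K_plus E K (\<mu> s)) x'"
        have sh: "sets ?h = sets E"
          by (simp add: heat_at_def sets.sets_measure_of_eq)
        have "(\<integral>\<^sup>+z. ?u z \<partial>?h) \<le> (\<integral>\<^sup>+z. ennreal R * ?tw z \<partial>?h)"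
        proof (rule nn_integral_mono)
          fix z
          show "?u z \<le> ennreal R * ?tw z"
          proof -
            have "min (\<phi> (m z)) (R * m z) \<le> R * m z" by simp
            from mult_left_mono[OF this, of "a z powr (real d / 2)"]
            have "a z powr (real d / 2) * cut_weight R z \<le> R * truncated_weight d m a R z"
              by (simp add: truncated_weight_def cut_weight_def mult_ac)
            then show ?thesis using R by (subst ennreal_mult'[symmetric]) (auto intro: ennreal_leI)
          qed
        qed
        also have "\<dots> = ennreal R * (\<integral>\<^sup>+z. ?tw z \<partial>?h)"
          by (rule nn_integral_cmult) (simp add: measurable_cong_sets[OF sh refl])
        finally show ?thesis using h True by simp
      qed simp
    qed
    also have "\<dots> = ennreal R * (\<integral>\<^sup>+s\<in>{0..<t}. evolved gainK a \<kappa> t s x' ?tw \<partial>lborel)"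
      using e by (intro nn_integral_cmult) auto
    also have "(\<integral>\<^sup>+s\<in>{0..<t}. evolved gainK a \<kappa> t s x' ?tw \<partial>lborel) =
        (\<integral>\<^sup>+s\<in>{0..<t}. (\<integral>\<^sup>+y. ?tw y \<partial>heat_at E a (t - s) (K_plus E K (\<mu> s)) x') \<partial>lborel)"
      by (rule nn_integral_cong_AE, use heat in eventually_elim) (auto split: split_indicator)
    finally show "flux gainK \<kappa> t ?u x' < \<infinity>"
      using fin by (auto simp: ennreal_mult_less_top intro: le_less_trans)
  qed
qed

section \<open>Bounds on the weight and on the collision rate\<close>

abbreviation total :: "real \<Rightarrow> ('e \<Rightarrow> real) \<Rightarrow> ennreal" where
  "total t n \<equiv> \<integral>\<^sup>+p. ennreal (n (snd p)) \<partial>\<mu> t"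

text \<open>
  The density of \<open>w\<close> at time \<open>t\<close> if there were no collisions.
\<close>

definition initial_density :: "real \<Rightarrow> 'x \<Rightarrow> ennreal" where
  "initial_density t x' = (\<integral>\<^sup>+p. ennreal (heat_kernel (a (snd p) * t) (fst p) x') * ennreal (w (snd p)) \<partial>\<mu> 0)"

lemma w_initial_finite: "total 0 w < \<infinity>"
  using solution unfolding solution_def dim by (simp add: split_beta')

lemma nn_integral_initial_density:
  assumes t: "0 < t" "ereal t < T"
  shows "(\<integral>\<^sup>+x'. initial_density t x' \<partial>lborel) = total 0 w"
  unfolding initial_density_def by (rule nn_integral_heat_initial[OF t]) measurable

lemma cut_weight_le: "a y powr (real d / 2) * cut_weight R y \<le> w y" if "y \<in> space E"
  using that phi_pos[OF m_pos, of y]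
  by (auto simp: weight_def cut_weight_def intro!: mult_left_mono)

text \<open>
  The balance of gain and loss is cancelled on bounded sets where the gain is at most \<open>k\<close>. These
  exhaust \<open>B\<close> up to a null set, which \<open>\<mu>\<^sub>t\<close> does not charge because its first marginal is
  absolutely continuous.
\<close>

lemma cut_weight_bound:
  assumes t: "0 < t" "ereal t < T" and R: "0 < R" and B[measurable]: "B \<in> sets borel"
  shows "(\<integral>\<^sup>+p. indicator B (fst p) * ennreal (a (snd p) powr (real d / 2) * cut_weight R (snd p)) \<partial>\<mu> t) \<le>
    (\<integral>\<^sup>+x'\<in>B. initial_density t x' \<partial>lborel)"
proof -
  obtain \<kappa> where \<kappa>: "disintegration_upto t \<kappa>" using ex_disintegration_upto[OF t(2)] by blast
  have st0: "\<mu> 0 \<in> state_space E" and stt: "\<mu> t \<in> state_space E"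
    using t by (auto intro: state_before[OF t(2)] state)
  note stt = state_spaceD[OF stt] and st0 = state_spaceD[OF st0]
  note mst = measurable_cong_sets[OF stt(1) refl]
  define u where "u y = ennreal (a y powr (real d / 2) * cut_weight R y)" for y
  have [measurable]: "u \<in> borel_measurable E" unfolding u_def[abs_def] by measurable
  define G where "G = flux gainK \<kappa> t u"
  define L where "L = flux lossK \<kappa> t u"
  have [measurable]: "G \<in> borel_measurable borel" "L \<in> borel_measurable borel"
    unfolding G_def L_def
    by (intro measurable_flux[OF _ \<kappa>] gainK lossK; measurable)+
  have GL: "G x' \<le> L x'" for x'
    unfolding G_def L_def flux_def u_def
  proof (intro nn_integral_mono)
    fix s
    show "evolved gainK a \<kappa> t s x' (\<lambda>y. ennreal (a y powr (real d / 2) * cut_weight R y)) * indicator {0..<t} s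
      \<le> evolved lossK a \<kappa> t s x' (\<lambda>y. ennreal (a y powr (real d / 2) * cut_weight R y)) * indicator {0..<t} s"
    proof (cases "s \<in> {0..<t}")
      case True
      then show ?thesis
        using evolved_gain_le_loss[OF \<kappa>, of s "cut_weight R" x'] cut_weight_nonneg[OF R] cut_weight_subadditive[OF R] by simp
    qed simp
  qed
  have Gfin: "AE x' in lborel. G x' < \<infinity>"
    using flux_gain_finite[OF t \<kappa> R] by (simp add: G_def u_def[abs_def])
  define M0 where "M0 x' = (\<integral>\<^sup>+p. ennreal (heat_kernel (a (snd p) * t) (fst p) x') * u (snd p) \<partial>\<mu> 0)" for x'
  have M0: "M0 x' \<le> initial_density t x'" for x'
    unfolding M0_def initial_density_def u_def
    by (intro nn_integral_mono mult_left_mono ennreal_leI cut_weight_le) (auto simp: st0(3))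
  \<comment> \<open>Bounded regions with bounded gain, on which the integrated gain is finite.\<close>
  define Bk where "Bk k = {x'\<in>B. G x' \<le> of_nat k \<and> norm x' \<le> real k}" for k :: nat
  have [measurable]: "Bk k \<in> sets borel" for k unfolding Bk_def by measurable
  have step: "(\<integral>\<^sup>+p. indicator (Bk k) (fst p) * u (snd p) \<partial>\<mu> t) \<le> (\<integral>\<^sup>+x'\<in>B. initial_density t x' \<partial>lborel)" for k
  proof -
    have "(\<integral>\<^sup>+p. indicator (Bk k) (fst p) * u (snd p) \<partial>\<mu> t) \<le> (\<integral>\<^sup>+x'\<in>Bk k. M0 x' \<partial>lborel)"
    proof (rule ennreal_cancel_balance)
      show "(\<integral>\<^sup>+p. indicator (Bk k) (fst p) * u (snd p) \<partial>\<mu> t) + (\<integral>\<^sup>+x'\<in>Bk k. L x' \<partial>lborel) =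
         (\<integral>\<^sup>+x'\<in>Bk k. M0 x' \<partial>lborel) + (\<integral>\<^sup>+x'\<in>Bk k. G x' \<partial>lborel)"
        unfolding L_def G_def M0_def by (rule localized_balance[OF t \<kappa>]) measurable
      show "(\<integral>\<^sup>+x'\<in>Bk k. G x' \<partial>lborel) \<le> (\<integral>\<^sup>+x'\<in>Bk k. L x' \<partial>lborel)"
        by (intro nn_integral_mono mult_right_mono GL) auto
      have "(\<integral>\<^sup>+x'\<in>Bk k. M0 x' \<partial>lborel) \<le> (\<integral>\<^sup>+x'. initial_density t x' \<partial>lborel)"
        by (intro nn_integral_mono) (auto split: split_indicator intro: M0)
      then show "(\<integral>\<^sup>+x'\<in>Bk k. M0 x' \<partial>lborel) < \<infinity>"
        using w_initial_finite nn_integral_initial_density[OF t] by (auto intro: le_less_trans)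
      have "(\<integral>\<^sup>+x'\<in>Bk k. G x' \<partial>lborel) \<le> (\<integral>\<^sup>+x'. of_nat k * indicator (cball (0::'x) (real k)) x' \<partial>lborel)"
        by (intro nn_integral_mono) (auto split: split_indicator simp: Bk_def)
      also have "\<dots> = of_nat k * emeasure lborel (cball (0::'x) (real k))"
        by (intro nn_integral_cmult_indicator) auto
      also have "\<dots> < \<infinity>"
        using emeasure_lborel_cball_finite[of "0::'x" "real k"] by (simp add: ennreal_mult_less_top of_nat_less_top)
      finally show "(\<integral>\<^sup>+x'\<in>Bk k. G x' \<partial>lborel) < \<infinity>" .
    qed
    also have "\<dots> \<le> (\<integral>\<^sup>+x'\<in>B. initial_density t x' \<partial>lborel)"
      by (intro nn_integral_mono) (auto split: split_indicator simp: Bk_def intro: M0)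
    finally show ?thesis .
  qed
  obtain Z where Z: "Z \<in> null_sets lborel" "\<And>x'. x' \<notin> Z \<Longrightarrow> G x' < \<infinity>"
    by (rule AE_E3[OF Gfin]) auto
  have "emeasure (\<mu> t) (Z \<times> space E) = 0" using Z(1) by (rule stt(4))
  moreover have "Z \<times> space E \<in> sets (\<mu> t)" using Z(1) by (auto simp: stt(1))
  ultimately have "AE p in \<mu> t. p \<notin> Z \<times> space E" by (intro AE_not_in) auto
  then have "AE p in \<mu> t. G (fst p) < \<infinity>"
    using AE_space
  proof eventually_elim
    fix p assume "p \<notin> Z \<times> space E" "p \<in> space (\<mu> t)"
    then have "fst p \<notin> Z" by (auto simp: stt(3))
    then show "G (fst p) < \<infinity>" by (rule Z(2))
  qed
  then have "AE p in \<mu> t. indicator B (fst p) * u (snd p) = (SUP k. indicator (Bk k) (fst p) * u (snd p))"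
  proof eventually_elim
    fix p :: "'x \<times> 'e" assume G: "G (fst p) < \<infinity>"
    show "indicator B (fst p) * u (snd p) = (SUP k. indicator (Bk k) (fst p) * u (snd p))"
    proof (rule antisym)
      obtain k1 :: nat where k1: "G (fst p) \<le> of_nat k1"
        using G ennreal_Ex_less_of_nat[of "G (fst p)"] by (auto intro: less_imp_le)
      obtain k2 :: nat where k2: "norm (fst p) \<le> real k2" using real_arch_simple by blast
      have "G (fst p) \<le> of_nat (max k1 k2)" using k1 by (rule order_trans) simp
      then have "indicator B (fst p) * u (snd p) \<le> indicator (Bk (max k1 k2)) (fst p) * u (snd p)"
        using k2 by (auto simp: Bk_def split: split_indicator)
      then show "indicator B (fst p) * u (snd p) \<le> (SUP k. indicator (Bk k) (fst p) * u (snd p))"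
        by (rule SUP_upper2[OF UNIV_I])
      show "(SUP k. indicator (Bk k) (fst p) * u (snd p)) \<le> indicator B (fst p) * u (snd p)"
        by (intro SUP_least) (auto simp: Bk_def split: split_indicator)
    qed
  qed
  then have "(\<integral>\<^sup>+p. indicator B (fst p) * u (snd p) \<partial>\<mu> t) = (\<integral>\<^sup>+p. (SUP k. indicator (Bk k) (fst p) * u (snd p)) \<partial>\<mu> t)"
    by (rule nn_integral_cong_AE)
  also have "\<dots> = (SUP k. \<integral>\<^sup>+p. indicator (Bk k) (fst p) * u (snd p) \<partial>\<mu> t)"
  proof (rule nn_integral_monotone_convergence_SUP)
    show "incseq (\<lambda>k p. indicator (Bk k) (fst p) * u (snd p))"
    proof (rule incseq_SucI, rule le_funI)
      fix k and p :: "'x \<times> 'e"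
      have "Bk k \<subseteq> Bk (Suc k)" unfolding Bk_def by (auto intro: order_trans)
      then show "indicator (Bk k) (fst p) * u (snd p) \<le> indicator (Bk (Suc k)) (fst p) * u (snd p)"
        by (auto split: split_indicator)
    qed
    show "(\<lambda>p. indicator (Bk k) (fst p) * u (snd p)) \<in> borel_measurable (\<mu> t)" for k
      unfolding mst by measurable
  qed
  also have "\<dots> \<le> (\<integral>\<^sup>+x'\<in>B. initial_density t x' \<partial>lborel)" by (rule SUP_least) (rule step)
  finally show ?thesis by (simp add: u_def)
qed

lemma weight_bound:
  assumes t: "0 < t" "ereal t < T" and B[measurable]: "B \<in> sets borel"
  shows "(\<integral>\<^sup>+p. indicator B (fst p) * ennreal (w (snd p)) \<partial>\<mu> t) \<le> (\<integral>\<^sup>+x'\<in>B. initial_density t x' \<partial>lborel)"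
proof -
  have stt: "\<mu> t \<in> state_space E" using t by (auto intro: state)
  note stt = state_spaceD[OF stt]
  note mst = measurable_cong_sets[OF stt(1) refl]
  let ?c = "\<lambda>j y. a y powr (real d / 2) * cut_weight (real (Suc j)) y"
  have cw_mono: "cut_weight R y \<le> cut_weight R' y" if "0 < R" "R \<le> R'" "y \<in> space E" for R R' y
  proof -
    have "R * m y \<le> R' * m y" using that m_pos[OF that(3)] by (intro mult_right_mono) auto
    then show ?thesis
      using that cut_weight_nonneg[of R' y] by (auto simp: cut_weight_def min.coboundedI2)
  qed
  have sup: "ennreal (w y) = (SUP j. ennreal (?c j y))" if y: "y \<in> space E" for y
  proof (rule antisym)
    \<comment> \<open>From this \<open>j\<close> on neither the cut-off nor the bound by a multiple of \<open>m\<close> is felt at \<open>y\<close>.\<close>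
    obtain j :: nat where j: "max (m y) (\<phi> (m y) / m y) \<le> real j" using real_arch_simple by blast
    then have "m y \<le> real (Suc j)" "\<phi> (m y) \<le> real (Suc j) * m y"
      using m_pos[OF y] by (auto simp: field_simps)
    then have "?c j y = w y" by (simp add: cut_weight_def weight_def min_def)
    then show "ennreal (w y) \<le> (SUP j. ennreal (?c j y))" by (intro SUP_upper2[of j]) auto
    show "(SUP j. ennreal (?c j y)) \<le> ennreal (w y)" by (intro SUP_least ennreal_leI cut_weight_le[OF y])
  qed
  have "(\<integral>\<^sup>+p. indicator B (fst p) * ennreal (w (snd p)) \<partial>\<mu> t) =
      (\<integral>\<^sup>+p. (SUP j. indicator B (fst p) * ennreal (?c j (snd p))) \<partial>\<mu> t)"
    by (intro nn_integral_cong) (auto simp: stt(3) sup split: split_indicator)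
  also have "\<dots> = (SUP j. \<integral>\<^sup>+p. indicator B (fst p) * ennreal (?c j (snd p)) \<partial>\<mu> t)"
  proof (rule nn_integral_monotone_convergence_SUP_AE)
    show "AE p in \<mu> t. indicator B (fst p) * ennreal (?c j (snd p)) \<le> indicator B (fst p) * ennreal (?c (Suc j) (snd p))" for j
    proof (rule AE_I2)
      fix p assume "p \<in> space (\<mu> t)"
      then show "indicator B (fst p) * ennreal (?c j (snd p)) \<le> indicator B (fst p) * ennreal (?c (Suc j) (snd p))"
        by (intro mult_left_mono ennreal_leI cw_mono) (auto simp: stt(3))
    qed
    show "(\<lambda>p. indicator B (fst p) * ennreal (?c j (snd p))) \<in> borel_measurable (\<mu> t)" for j
      unfolding mst by measurable
  qed
  also have "\<dots> \<le> (\<integral>\<^sup>+x'\<in>B. initial_density t x' \<partial>lborel)"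
    by (intro SUP_least cut_weight_bound[OF t]) auto
  finally show ?thesis .
qed

lemma weight_integral_bound:
  assumes t: "0 < t" "ereal t < T"
  shows "total t w \<le> total 0 w"
  using weight_bound[OF t, of UNIV] nn_integral_initial_density[OF t] by simp

text \<open>
  Here \<open>W\<close> is the integral of \<open>w\<close> against the measure \<open>\<mu>\<^sub>0\<^sup>*\<close> with \<open>\<mu>\<^sub>0 \<le> dx \<otimes> \<mu>\<^sub>0\<^sup>*\<close>: the heat kernel
  integrates to \<open>1\<close> over the starting point. That measure is finite because \<open>w\<close> is bounded below, and
  finiteness is what makes Tonelli's theorem applicable.
\<close>

lemma weight_density_bound:
  "\<exists>W<\<infinity>. \<forall>t. 0 < t \<and> ereal t < T \<longrightarrow> (\<forall>B\<in>sets borel.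
     (\<integral>\<^sup>+p. indicator B (fst p) * ennreal (w (snd p)) \<partial>\<mu> t) \<le> W * emeasure lborel B)"
proof -
  obtain \<mu>0 where s0: "sets \<mu>0 = sets E" and fin: "(\<integral>\<^sup>+y. ennreal (w y) \<partial>\<mu>0) < \<infinity>"
    and le: "\<And>C. C \<in> sets (borel \<Otimes>\<^sub>M E) \<Longrightarrow> emeasure (\<mu> 0) C \<le> emeasure (lborel \<Otimes>\<^sub>M \<mu>0) C"
    using solution unfolding solution_def dim by blast
  have sp0: "space \<mu>0 = space E" using s0 by (rule sets_eq_imp_space_eq)
  note m0 = measurable_cong_sets[OF s0 refl]
  obtain c where c: "0 < c" "\<And>y. y \<in> space E \<Longrightarrow> c \<le> w y" using weight_uniformly_pos by blast
  \<comment> \<open>The measure \<open>\<mu>0\<close> is finite, since \<open>w\<close> is integrable and bounded below by \<open>c\<close>.\<close>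
  have "ennreal c * emeasure \<mu>0 (space \<mu>0) = (\<integral>\<^sup>+y. ennreal c \<partial>\<mu>0)" by simp
  also have "\<dots> \<le> (\<integral>\<^sup>+y. ennreal (w y) \<partial>\<mu>0)"
    using c by (intro nn_integral_mono ennreal_leI) (simp add: sp0)
  finally have "ennreal c * emeasure \<mu>0 (space \<mu>0) < \<infinity>" using fin by (rule le_less_trans)
  then have "finite_measure \<mu>0"
    using c(1) by (intro finite_measureI) (auto simp: ennreal_mult_less_top)
  then have sf0: "sigma_finite_measure \<mu>0" by (rule finite_measure.axioms(1))
  have spr: "sets (lborel \<Otimes>\<^sub>M \<mu>0) = sets ((borel :: 'x measure) \<Otimes>\<^sub>M E)"
    using s0 by (intro sets_pair_measure_cong) auto
  let ?W = "\<integral>\<^sup>+y. ennreal (w y) \<partial>\<mu>0"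
  have dens: "initial_density t x' \<le> ?W" if t: "0 < t" "ereal t < T" for t x'
  proof -
    have st0: "\<mu> 0 \<in> state_space E" using t by (auto intro: state_before[OF t(2)])
    note st0 = state_spaceD[OF st0]
    have "\<mu> 0 \<le> lborel \<Otimes>\<^sub>M \<mu>0"
      using le by (subst le_measure[OF trans[OF st0(1) spr[symmetric]]]) (simp add: st0(1))
    then have "initial_density t x' \<le> (\<integral>\<^sup>+p. ennreal (heat_kernel (a (snd p) * t) (fst p) x') * ennreal (w (snd p)) \<partial>(lborel \<Otimes>\<^sub>M \<mu>0))"
      unfolding initial_density_def by (rule nn_integral_mono_measure[OF trans[OF st0(1) spr[symmetric]]])
    also have "\<dots> = (\<integral>\<^sup>+y. \<integral>\<^sup>+x. ennreal (heat_kernel (a y * t) x x') * ennreal (w y) \<partial>lborel \<partial>\<mu>0)"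
    proof -
      interpret pair_sigma_finite "lborel :: 'x measure" \<mu>0
        using sf0 lborel.sigma_finite_measure_axioms by (simp add: pair_sigma_finite_def)
      have "(\<lambda>p. ennreal (heat_kernel (a (snd p) * t) (fst p) x') * ennreal (w (snd p))) \<in> borel_measurable (lborel \<Otimes>\<^sub>M \<mu>0)"
        unfolding measurable_cong_sets[OF spr refl] by measurable
      from nn_integral_snd[OF this] show ?thesis by simp
    qed
    also have "\<dots> = ?W"
    proof (rule nn_integral_cong)
      fix y assume "y \<in> space \<mu>0"
      then have "0 < a y * t" using a_pos t by (auto simp: sp0)
      then show "(\<integral>\<^sup>+x. ennreal (heat_kernel (a y * t) x x') * ennreal (w y) \<partial>lborel) = ennreal (w y)"
        by (subst nn_integral_multc) (auto simp: nn_integral_heat_kernel_left)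
    qed
    finally show ?thesis .
  qed
  show ?thesis
  proof (intro exI[of _ ?W] conjI allI impI ballI fin)
    fix t and B :: "'x set" assume t: "0 < t \<and> ereal t < T" and B: "B \<in> sets borel"
    have "(\<integral>\<^sup>+p. indicator B (fst p) * ennreal (w (snd p)) \<partial>\<mu> t) \<le> (\<integral>\<^sup>+x'\<in>B. initial_density t x' \<partial>lborel)"
      using t B by (intro weight_bound) auto
    also have "\<dots> \<le> (\<integral>\<^sup>+x'\<in>B. ?W \<partial>lborel)"
      using dens t by (intro nn_integral_mono mult_right_mono) auto
    also have "\<dots> = ?W * emeasure lborel B"
      using B by (intro nn_integral_cmult_indicator) auto
    finally show "(\<integral>\<^sup>+p. indicator B (fst p) * ennreal (w (snd p)) \<partial>\<mu> t) \<le> ?W * emeasure lborel B" .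
  qed
qed

text \<open>
  Since \<open>K(y,y',E) \<le> w(y)w(y')\<close>, the collision rate at \<open>x\<close> is at most the square of the density of
  \<open>w\<close> at \<open>x\<close>. One factor is at most \<open>W\<close> almost everywhere and the other one has
  an integral bounded by its initial value. A bound on \<open>g\<close> enters as a factor.
\<close>

lemma total_loss_bound:
  "\<exists>Q<\<infinity>. \<forall>s \<kappa> g c. 0 < s \<and> ereal s < T \<and> is_disintegration E (\<mu> s) \<kappa> \<and>
     g \<in> borel_measurable E \<and> (\<forall>y\<in>space E. g y \<le> c) \<longrightarrow> (\<integral>\<^sup>+x. coll lossK (\<kappa> x) g \<partial>lborel) \<le> c * Q"
proof -
  obtain W where W: "W < \<infinity>" and dens: "\<And>t B. 0 < t \<Longrightarrow> ereal t < T \<Longrightarrow> B \<in> sets borel \<Longrightarrow>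
     (\<integral>\<^sup>+p. indicator B (fst p) * ennreal (w (snd p)) \<partial>\<mu> t) \<le> W * emeasure lborel B"
    using weight_density_bound by blast
  let ?Q = "W * total 0 w"
  have main: "(\<integral>\<^sup>+x. coll lossK (\<kappa> x) g \<partial>lborel) \<le> c * ?Q"
    if s: "0 < s" "ereal s < T" and \<kappa>: "is_disintegration E (\<mu> s) \<kappa>"
      and g: "g \<in> borel_measurable E" "\<And>y. y \<in> space E \<Longrightarrow> g y \<le> c" for s \<kappa> g c
  proof -
    have st: "\<mu> s \<in> state_space E" using s by (auto intro: state)
    note int = nn_integral_disintegration[OF st \<kappa>]
    note fk = is_disintegration_finite_kernel[OF \<kappa>]
    have \<kappa>x: "sets (\<kappa> x) = sets E" "finite_measure (\<kappa> x)" "space (\<kappa> x) = space E" for x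
      using finite_kernelD[OF fk] by auto
    define W' where "W' x = (\<integral>\<^sup>+y. ennreal (w y) \<partial>\<kappa> x)" for x
    have "(\<lambda>x. \<integral>\<^sup>+y. ennreal (w y) \<partial>\<kappa> x) \<in> borel_measurable lborel"
      by (rule measurable_nn_integral_finite_kernel[OF fk]) measurable
    then have W'[measurable]: "W' \<in> borel_measurable borel" by (simp add: W'_def[abs_def])
    have "AE x in lborel. W' x \<le> W"
    proof (rule AE_le_of_average_le[OF W' W])
      fix B :: "'x set" assume B[measurable]: "B \<in> sets borel"
      have "(\<integral>\<^sup>+x\<in>B. W' x \<partial>lborel) = (\<integral>\<^sup>+x. \<integral>\<^sup>+y. indicator B x * ennreal (w y) \<partial>\<kappa> x \<partial>lborel)"
        by (intro nn_integral_cong) (auto simp: W'_def split: split_indicator)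
      also have "\<dots> = (\<integral>\<^sup>+p. indicator B (fst p) * ennreal (w (snd p)) \<partial>\<mu> s)"
        by (subst int) auto
      also have "\<dots> \<le> W * emeasure lborel B" using s B by (rule dens)
      finally show "(\<integral>\<^sup>+x\<in>B. W' x \<partial>lborel) \<le> W * emeasure lborel B" .
    qed
    then have "AE x in lborel. coll lossK (\<kappa> x) g \<le> c * W * W' x"
    proof eventually_elim
      fix x assume x: "W' x \<le> W"
      have wm: "(\<lambda>y. ennreal (w y)) \<in> borel_measurable (\<kappa> x)"
        by (simp add: measurable_cong_sets[OF \<kappa>x(1) refl])
      have "coll lossK (\<kappa> x) g \<le> (\<integral>\<^sup>+y. \<integral>\<^sup>+y'. c * ennreal (w y) * ennreal (w y') \<partial>\<kappa> x \<partial>\<kappa> x)"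
        unfolding coll_loss_kernel[OF kernel \<kappa>x(1) g(1)]
      proof (intro nn_integral_mono)
        fix y y' assume "y \<in> space (\<kappa> x)" "y' \<in> space (\<kappa> x)"
        then have y: "y \<in> space E" "y' \<in> space E" by (simp_all add: \<kappa>x)
        have "0 \<le> w y" using phi_pos[OF m_pos[OF y(1)]] by (simp add: weight_def less_imp_le)
        then have "emeasure (K y y') (space E) \<le> ennreal (w y) * ennreal (w y')"
          using kernel_bound[OF y] by (simp add: ennreal_mult'[symmetric])
        with g(2)[OF y(1)] have "g y * emeasure (K y y') (space E) \<le> c * (ennreal (w y) * ennreal (w y'))"
          by (rule mult_mono) auto
        then show "g y * emeasure (K y y') (space E) \<le> c * ennreal (w y) * ennreal (w y')" by (simp add: mult.assoc)
      qed
      also have "\<dots> = (\<integral>\<^sup>+y. c * ennreal (w y) * W' x \<partial>\<kappa> x)"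
        using wm unfolding W'_def by (intro nn_integral_cong nn_integral_cmult)
      also have "\<dots> = c * W' x * W' x"
        using wm unfolding W'_def by (subst nn_integral_multc, measurable, subst nn_integral_cmult) auto
      also have "\<dots> \<le> c * W * W' x" using x by (intro mult_right_mono mult_left_mono) auto
      finally show "coll lossK (\<kappa> x) g \<le> c * W * W' x" .
    qed
    then have "(\<integral>\<^sup>+x. coll lossK (\<kappa> x) g \<partial>lborel) \<le> (\<integral>\<^sup>+x. c * W * W' x \<partial>lborel)"
      by (rule nn_integral_mono_AE)
    also have "\<dots> = c * W * (\<integral>\<^sup>+x. W' x \<partial>lborel)" by (rule nn_integral_cmult) measurable
    also have "(\<integral>\<^sup>+x. W' x \<partial>lborel) = total s w"
      unfolding W'_def by (subst int) auto
    also have "c * W * \<dots> \<le> c * W * total 0 w" by (intro mult_left_mono weight_integral_bound[OF s]) simp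
    finally show ?thesis by (simp add: mult.assoc)
  qed
  show ?thesis
    using main W w_initial_finite by (intro exI[of _ ?Q]) (auto simp: ennreal_mult_less_top)
qed

section \<open>Monotonicity of subadditive functionals\<close>

text \<open>
  Diffusion does not change the total amount of a quantity that depends on the type only.
\<close>

lemma nn_integral_evolved:
  assumes L: "finite_kernel2 E L" and \<kappa>: "disintegration_upto t \<kappa>" and s: "s < t"
    and g[measurable]: "g \<in> borel_measurable E"
  shows "(\<integral>\<^sup>+x'. evolved L a \<kappa> t s x' g \<partial>lborel) = (\<integral>\<^sup>+x. coll L (\<kappa> (s, x)) g \<partial>lborel)"
proof -
  let ?X = "(lborel :: 'x measure) \<Otimes>\<^sub>M (lborel :: 'x measure)"
  let ?h = "\<lambda>x x' z. ennreal (heat_kernel (a z * (t - s)) x x') * g z"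
  have Pair: "Pair s \<in> borel \<rightarrow>\<^sub>M (borel :: (real \<times> 'x) measure)"
    by (intro borel_measurable_continuous_onI continuous_intros)
  have "(\<lambda>p. (s, fst p)) \<in> ?X \<rightarrow>\<^sub>M (borel :: (real \<times> 'x) measure)"
    by (rule measurable_compose[OF _ Pair]) measurable
  then have k: "finite_kernel ?X E (\<lambda>p. \<kappa> (s, fst p))"
    by (rule finite_kernel_compose[OF disintegration_uptoD(1)[OF \<kappa>]])
  have "(\<lambda>q. ennreal (heat_kernel (a (snd q) * (t - s)) (fst (fst q)) (snd (fst q))) * g (snd q)) \<in> borel_measurable (?X \<Otimes>\<^sub>M E)"
    by measurable
  then have "(\<lambda>p. coll L (\<kappa> (s, fst p)) (?h (fst p) (snd p))) \<in> borel_measurable ?X"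
    using measurable_coll[OF L k] by (simp add: split_beta')
  then have "(\<integral>\<^sup>+x'. evolved L a \<kappa> t s x' g \<partial>lborel) = (\<integral>\<^sup>+x. \<integral>\<^sup>+x'. coll L (\<kappa> (s, x)) (?h x x') \<partial>lborel \<partial>lborel)"
    unfolding evolved_def by (intro nn_integral_swap lborel.sigma_finite_measure_axioms) (simp add: split_beta')
  also have "\<dots> = (\<integral>\<^sup>+x. coll L (\<kappa> (s, x)) g \<partial>lborel)"
  proof (rule nn_integral_cong)
    fix x
    note \<kappa>x = disintegration_uptoD(2,3)[OF \<kappa>, of "(s, x)"]
    have "(\<integral>\<^sup>+x'. coll L (\<kappa> (s, x)) (?h x x') \<partial>lborel) = coll L (\<kappa> (s, x)) (\<lambda>z. \<integral>\<^sup>+x'. ?h x x' z \<partial>lborel)"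
      by (intro coll_swap[OF L \<kappa>x lborel.sigma_finite_measure_axioms]) measurable
    also have "\<dots> = coll L (\<kappa> (s, x)) g"
    proof (rule coll_cong[OF L \<kappa>x(1)])
      fix z assume "z \<in> space E"
      then have "0 < a z * (t - s)" using a_pos s by simp
      then show "(\<integral>\<^sup>+x'. ?h x x' z \<partial>lborel) = g z"
        by (subst nn_integral_multc) (auto simp: nn_integral_heat_kernel)
    qed
    finally show "(\<integral>\<^sup>+x'. coll L (\<kappa> (s, x)) (?h x x') \<partial>lborel) = coll L (\<kappa> (s, x)) g" .
  qed
  finally show ?thesis .
qed

lemma subadditive_bounded_nonincreasing:
  assumes t: "0 \<le> t" "ereal t < T" and g[measurable]: "g \<in> borel_measurable E"
    and bound: "\<And>y. y \<in> space E \<Longrightarrow> g y \<le> c" and c: "c < \<infinity>"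
    and sub: "\<And>y y'. y \<in> space E \<Longrightarrow> y' \<in> space E \<Longrightarrow> AE z in K y y'. g z \<le> g y + g y'"
  shows "(\<integral>\<^sup>+p. g (snd p) \<partial>\<mu> t) \<le> (\<integral>\<^sup>+p. g (snd p) \<partial>\<mu> 0)"
proof (cases "t = 0")
  case False
  then have t: "0 < t" "ereal t < T" using t by auto
  obtain \<kappa> where \<kappa>: "disintegration_upto t \<kappa>" using ex_disintegration_upto[OF t(2)] by blast
  have st0: "\<mu> 0 \<in> state_space E" using t by (auto intro: state_before[OF t(2)])
  note st0 = state_spaceD[OF st0]
  note \<kappa>D = disintegration_uptoD[OF \<kappa>]
  obtain Q where Q: "Q < \<infinity>" and loss: "\<And>s \<kappa>. 0 < s \<Longrightarrow> ereal s < T \<Longrightarrow> is_disintegration E (\<mu> s) \<kappa> \<Longrightarrow>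
     (\<integral>\<^sup>+x. coll lossK (\<kappa> x) g \<partial>lborel) \<le> c * Q"
    using total_loss_bound g bound by blast
  let ?G = "\<lambda>s. \<integral>\<^sup>+x. coll gainK (\<kappa> (s, x)) g \<partial>lborel" and ?L = "\<lambda>s. \<integral>\<^sup>+x. coll lossK (\<kappa> (s, x)) g \<partial>lborel"
  have GL: "?G s \<le> ?L s" for s
    by (intro nn_integral_mono gain_le_loss[OF kernel \<kappa>D(2,3) kernel_symmetric g sub])
  have G: "(\<integral>\<^sup>+s\<in>{0..<t}. (\<integral>\<^sup>+x'. evolved gainK a \<kappa> t s x' g \<partial>lborel) \<partial>lborel) = (\<integral>\<^sup>+s\<in>{0..<t}. ?G s \<partial>lborel)"
    by (intro nn_integral_cong) (auto split: split_indicator intro!: nn_integral_evolved[OF gainK \<kappa> _ g])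
  have L: "(\<integral>\<^sup>+s\<in>{0..<t}. (\<integral>\<^sup>+x'. evolved lossK a \<kappa> t s x' g \<partial>lborel) \<partial>lborel) = (\<integral>\<^sup>+s\<in>{0..<t}. ?L s \<partial>lborel)"
    by (intro nn_integral_cong) (auto split: split_indicator intro!: nn_integral_evolved[OF lossK \<kappa> _ g])
  show ?thesis
  proof (rule ennreal_cancel_balance)
    show "(\<integral>\<^sup>+p. g (snd p) \<partial>\<mu> t) + (\<integral>\<^sup>+s\<in>{0..<t}. ?L s \<partial>lborel) = (\<integral>\<^sup>+p. g (snd p) \<partial>\<mu> 0) + (\<integral>\<^sup>+s\<in>{0..<t}. ?G s \<partial>lborel)"
      using mild_integral[OF t \<kappa>, of "\<lambda>p. g (snd p)"] G L nn_integral_heat_initial[OF t g] by simp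
    show "(\<integral>\<^sup>+s\<in>{0..<t}. ?G s \<partial>lborel) \<le> (\<integral>\<^sup>+s\<in>{0..<t}. ?L s \<partial>lborel)"
      by (intro nn_integral_mono mult_right_mono GL) simp
    have "(\<integral>\<^sup>+p. g (snd p) \<partial>\<mu> 0) \<le> (\<integral>\<^sup>+p. c \<partial>\<mu> 0)"
      by (intro nn_integral_mono bound) (auto simp: st0(3))
    also have "\<dots> < \<infinity>"
      using c finite_measure.emeasure_finite[OF st0(2)] by (simp add: ennreal_mult_less_top less_top)
    finally show "(\<integral>\<^sup>+p. g (snd p) \<partial>\<mu> 0) < \<infinity>" .
    have "AE s in lborel. ?G s * indicator {0..<t} s \<le> c * Q * indicator {0..<t} s"
      using \<kappa>D(4) AE_lborel_singleton[of "0::real"]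
    proof eventually_elim
      fix s :: real assume dis: "0 \<le> s \<and> s < t \<longrightarrow> is_disintegration E (\<mu> s) (\<lambda>x. \<kappa> (s, x))" and "s \<noteq> 0"
      show "?G s * indicator {0..<t} s \<le> c * Q * indicator {0..<t} s"
      proof (cases "s \<in> {0..<t}")
        case True
        then have s: "0 < s" "s < t" using \<open>s \<noteq> 0\<close> by auto
        then have sT: "ereal s < T" using t by (auto intro: less_trans[of "ereal s" "ereal t"])
        have "?L s \<le> c * Q" using dis s sT by (intro loss) auto
        then show ?thesis using True order_trans[OF GL] by simp
      qed simp
    qed
    then have "(\<integral>\<^sup>+s\<in>{0..<t}. ?G s \<partial>lborel) \<le> (\<integral>\<^sup>+s. c * Q * indicator {0..<t} s \<partial>lborel)"
      by (rule nn_integral_mono_AE)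
    also have "\<dots> = c * Q * ennreal t"
      using t by (subst nn_integral_cmult_indicator) auto
    also have "\<dots> < \<infinity>" using c Q by (simp add: ennreal_mult_less_top)
    finally show "(\<integral>\<^sup>+s\<in>{0..<t}. ?G s \<partial>lborel) < \<infinity>" .
  qed
qed simp

lemma subadditive_nonincreasing:
  assumes t: "0 \<le> t" "ereal t < T" and g[measurable]: "g \<in> borel_measurable E"
    and sub: "\<And>y y'. y \<in> space E \<Longrightarrow> y' \<in> space E \<Longrightarrow> AE z in K y y'. g z \<le> g y + g y'"
  shows "(\<integral>\<^sup>+p. g (snd p) \<partial>\<mu> t) \<le> (\<integral>\<^sup>+p. g (snd p) \<partial>\<mu> 0)"
proof -
  have st: "sets (\<mu> t) = sets (borel \<Otimes>\<^sub>M E)" using state_spaceD(1)[OF state] t by auto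
  have sup: "r = (SUP k::nat. min r (of_nat k))" for r :: ennreal
  proof (rule antisym)
    show "r \<le> (SUP k::nat. min r (of_nat k))"
    proof (cases "r = \<infinity>")
      case True then show ?thesis by (simp add: ennreal_SUP_of_nat_eq_top)
    next
      case False
      then obtain k :: nat where "r < of_nat k" using ennreal_Ex_less_of_nat[of r] by (auto simp: less_top)
      then show ?thesis by (intro SUP_upper2[of k]) (auto simp: less_imp_le)
    qed
  qed (auto intro: SUP_least)
  have "(\<integral>\<^sup>+p. g (snd p) \<partial>\<mu> t) = (\<integral>\<^sup>+p. (SUP k::nat. min (g (snd p)) (of_nat k)) \<partial>\<mu> t)"
    by (subst sup) (rule refl)
  also have "\<dots> = (SUP k::nat. \<integral>\<^sup>+p. min (g (snd p)) (of_nat k) \<partial>\<mu> t)"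
  proof (rule nn_integral_monotone_convergence_SUP)
    show "incseq (\<lambda>k p. min (g (snd p)) (of_nat k))"
      by (auto simp: incseq_def le_fun_def min.coboundedI2)
    show "(\<lambda>p. min (g (snd p)) (of_nat k)) \<in> borel_measurable (\<mu> t)" for k
      unfolding measurable_cong_sets[OF st refl] by measurable
  qed
  also have "\<dots> \<le> (\<integral>\<^sup>+p. g (snd p) \<partial>\<mu> 0)"
  proof (rule SUP_least)
    fix k :: nat
    have "(\<integral>\<^sup>+p. min (g (snd p)) (of_nat k) \<partial>\<mu> t) \<le> (\<integral>\<^sup>+p. min (g (snd p)) (of_nat k) \<partial>\<mu> 0)"
    proof (rule subadditive_bounded_nonincreasing[OF t, of "\<lambda>y. min (g y) (of_nat k)" "of_nat k"])
      fix y y' assume "y \<in> space E" "y' \<in> space E"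
      from sub[OF this] show "AE z in K y y'. min (g z) (of_nat k) \<le> min (g y) (of_nat k) + min (g y') (of_nat k)"
      proof eventually_elim
        fix z assume z: "g z \<le> g y + g y'"
        \<comment> \<open>The minimum of a subadditive function and a constant is subadditive.\<close>
        consider "of_nat k \<le> g y" | "of_nat k \<le> g y'" | "g y \<le> of_nat k" "g y' \<le> of_nat k" by fastforce
        then show "min (g z) (of_nat k) \<le> min (g y) (of_nat k) + min (g y') (of_nat k)"
          by cases (auto simp: min.absorb1 min.absorb2 z intro: min.coboundedI1 min.coboundedI2 add_increasing add_increasing2)
      qed
    qed (auto intro: of_nat_less_top)
    also have "\<dots> \<le> (\<integral>\<^sup>+p. g (snd p) \<partial>\<mu> 0)" by (intro nn_integral_mono) simp
    finally show "(\<integral>\<^sup>+p. min (g (snd p)) (of_nat k) \<partial>\<mu> t) \<le> (\<integral>\<^sup>+p. g (snd p) \<partial>\<mu> 0)" .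
  qed
  finally show ?thesis .
qed

section \<open>Comparison of two mass functions\<close>

text \<open>
  The positive part of \<open>k n1 - n2\<close> is subadditive with finite initial total, and its sum
  with \<open>min n2 (k n1)\<close> is the conserved quantity \<open>k n1\<close>. Hence the total of the minimum cannot
  decrease. Its initial value tends to the initial total of \<open>n2\<close> as \<open>k \<rightarrow> \<infinity>\<close>.
\<close>

lemma mass_function_conserved:
  assumes t: "0 \<le> t" "ereal t < T"
    and n1: "mass_function E K n1" and n2: "mass_function E K n2"
    and fin: "total 0 n1 < \<infinity>" 
    and conserved: "total t n1 = total 0 n1"
  shows "total t n2 = total 0 n2"
proof (rule antisym)
  have n1D: "n1 \<in> borel_measurable E" "\<And>y. y \<in> space E \<Longrightarrow> 0 < n1 y"
    "\<And>y y'. y \<in> space E \<Longrightarrow> y' \<in> space E \<Longrightarrow> AE z in K y y'. n1 z = n1 y + n1 y'"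
    using n1 by (auto simp: mass_function_def)
  have n2D: "n2 \<in> borel_measurable E" "\<And>y. y \<in> space E \<Longrightarrow> 0 < n2 y"
    "\<And>y y'. y \<in> space E \<Longrightarrow> y' \<in> space E \<Longrightarrow> AE z in K y y'. n2 z = n2 y + n2 y'"
    using n2 by (auto simp: mass_function_def)
  note [measurable] = n1D(1) n2D(1)
  have st: "\<mu> r \<in> state_space E" if "r = t \<or> r = 0" for r
    using that t by (auto intro: state dest: le_less_trans[of "ereal 0" "ereal t", rotated] simp: zero_ereal_def[symmetric])
  note stD = state_spaceD[OF st]
  show "total t n2 \<le> total 0 n2"
  proof (rule subadditive_nonincreasing[OF t])
    fix y y' assume y: "y \<in> space E" "y' \<in> space E"
    show "AE z in K y y'. ennreal (n2 z) \<le> ennreal (n2 y) + ennreal (n2 y')"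
      using n2D(3)[OF y] by eventually_elim (use y n2D(2) in \<open>simp add: less_imp_le\<close>)
  qed measurable
  let ?min = "\<lambda>k y. min (n2 y) (real k * n1 y)" and ?pos = "\<lambda>k y. real k * n1 y - n2 y"
  have le: "total 0 (?min k) \<le> total t (?min k)" for k :: nat
  proof -
    have split: "total r (?min k) + total r (?pos k) =
        ennreal (real k) * total r n1" if r: "r = t \<or> r = 0" for r
    proof -
      note ms = measurable_cong_sets[OF stD(1)[OF r] refl]
      have "total r (?min k) + total r (?pos k) = (\<integral>\<^sup>+p. ennreal (?min k (snd p)) + ennreal (?pos k (snd p)) \<partial>\<mu> r)"
        by (intro nn_integral_add[symmetric]) (unfold ms, measurable)
      also have "\<dots> = (\<integral>\<^sup>+p. ennreal (real k) * ennreal (n1 (snd p)) \<partial>\<mu> r)"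
      proof (rule nn_integral_cong)
        fix p assume "p \<in> space (\<mu> r)"
        then have p: "snd p \<in> space E" by (simp add: stD(3)[OF r] mem_Times_iff)
        then have nonneg: "0 \<le> n1 (snd p)" "0 \<le> n2 (snd p)" "0 \<le> real k * n1 (snd p)"
          using n1D(2)[OF p] n2D(2)[OF p] by simp_all
        have "ennreal (?pos k (snd p)) = ennreal (max 0 (real k * n1 (snd p) - n2 (snd p)))"
          by (simp add: max_def ennreal_neg)
        then have "ennreal (?min k (snd p)) + ennreal (?pos k (snd p)) =
            ennreal (min (n2 (snd p)) (real k * n1 (snd p)) + max 0 (real k * n1 (snd p) - n2 (snd p)))"
          using ennreal_plus[of "min (n2 (snd p)) (real k * n1 (snd p))" "max 0 (real k * n1 (snd p) - n2 (snd p))"] nonneg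
          by (simp del: ennreal_plus)
        also have "min (n2 (snd p)) (real k * n1 (snd p)) + max 0 (real k * n1 (snd p) - n2 (snd p)) = real k * n1 (snd p)"
          by (simp add: min_def max_def)
        also have "ennreal \<dots> = ennreal (real k) * ennreal (n1 (snd p))"
          using nonneg by (intro ennreal_mult) auto
        finally show "ennreal (?min k (snd p)) + ennreal (?pos k (snd p)) = ennreal (real k) * ennreal (n1 (snd p))" .
      qed
      also have "\<dots> = ennreal (real k) * total r n1"
        by (intro nn_integral_cmult) (unfold ms, measurable)
      finally show ?thesis .
    qed
    have pos: "total t (?pos k) \<le> total 0 (?pos k)"
    proof (rule subadditive_nonincreasing[OF t])
      fix y y' assume y: "y \<in> space E" "y' \<in> space E"
      show "AE z in K y y'. ennreal (?pos k z) \<le> ennreal (?pos k y) + ennreal (?pos k y')"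
        using n1D(3)[OF y] n2D(3)[OF y]
      proof eventually_elim
        fix z assume "n1 z = n1 y + n1 y'" "n2 z = n2 y + n2 y'"
        then have "ennreal (?pos k z) \<le> ennreal (max 0 (real k * n1 y - n2 y) + max 0 (real k * n1 y' - n2 y'))"
          by (intro ennreal_leI) (simp add: algebra_simps)
        also have "\<dots> = ennreal (?pos k y) + ennreal (?pos k y')" by (subst ennreal_plus) (auto simp: max_def ennreal_neg)
        finally show "ennreal (?pos k z) \<le> ennreal (?pos k y) + ennreal (?pos k y')" .
      qed
    qed measurable
    have split0: "total 0 (?pos k) + total 0 (?min k) =
        ennreal (real k) * total 0 n1"
      by (subst add.commute) (rule split, simp)
    have "total 0 (?pos k) \<le> ennreal (real k) * total 0 n1"
      unfolding split0[symmetric] by simp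
    also have "\<dots> < \<infinity>" using fin by (simp add: ennreal_mult_less_top)
    finally have pos_fin: "total 0 (?pos k) \<noteq> \<infinity>" by simp
    note split0
    also have "ennreal (real k) * total 0 n1 = total t (?min k) + total t (?pos k)"
      unfolding conserved[symmetric] by (rule split[symmetric]) simp
    also have "\<dots> \<le> total t (?min k) + total 0 (?pos k)"
      using pos by (rule add_left_mono)
    also have "\<dots> = total 0 (?pos k) + total t (?min k)"
      by (rule add.commute)
    finally have "total 0 (?pos k) + total 0 (?min k) \<le>
        total 0 (?pos k) + total t (?min k)" .
    then show ?thesis using pos_fin ennreal_add_left_cancel_le by blast
  qed
  note ms0 = measurable_cong_sets[OF stD(1)[of 0] refl]
  have "total 0 n2 = (\<integral>\<^sup>+p. (SUP k. ennreal (?min k (snd p))) \<partial>\<mu> 0)"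
  proof (rule nn_integral_cong, rule antisym)
    fix p assume "p \<in> space (\<mu> 0)"
    then have p: "snd p \<in> space E" by (simp add: stD(3)[of 0] mem_Times_iff)
    obtain k :: nat where "n2 (snd p) / n1 (snd p) \<le> real k" using real_arch_simple by blast
    then have "n2 (snd p) \<le> real k * n1 (snd p)" using n1D(2)[OF p] by (simp add: field_simps)
    then show "ennreal (n2 (snd p)) \<le> (SUP k. ennreal (?min k (snd p)))" by (intro SUP_upper2[of k]) (auto simp: min.absorb1)
    show "(SUP k. ennreal (?min k (snd p))) \<le> ennreal (n2 (snd p))" by (intro SUP_least ennreal_leI) simp
  qed
  also have "\<dots> = (SUP k. \<integral>\<^sup>+p. ennreal (?min k (snd p)) \<partial>\<mu> 0)"
  proof (rule nn_integral_monotone_convergence_SUP_AE)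
    show "AE p in \<mu> 0. ennreal (?min k (snd p)) \<le> ennreal (?min (Suc k) (snd p))" for k
    proof (rule AE_I2)
      fix p assume "p \<in> space (\<mu> 0)"
      then have "snd p \<in> space E" by (simp add: stD(3)[of 0] mem_Times_iff)
      then have "0 < n1 (snd p)" by (rule n1D(2))
      then have "real k * n1 (snd p) \<le> real (Suc k) * n1 (snd p)" by (simp add: distrib_right)
      then show "ennreal (?min k (snd p)) \<le> ennreal (?min (Suc k) (snd p))" by (intro ennreal_leI min.mono) auto
    qed
    show "(\<lambda>p. ennreal (?min k (snd p))) \<in> borel_measurable (\<mu> 0)" for k by (subst ms0) (auto, measurable)
  qed
  also have "\<dots> \<le> total t n2"
  proof (rule SUP_least)
    fix k
    have "total t (?min k) \<le> total t n2"
      by (intro nn_integral_mono ennreal_leI) simp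
    with le[of k] show "total 0 (?min k) \<le> total t n2" by (rule order_trans)
  qed
  finally show "total 0 n2 \<le> total t n2" .
qed

lemma L1_norm_pairing:
  assumes t: "0 \<le> t" "ereal t < T" and n[measurable]: "n \<in> borel_measurable E"
  shows "L1_norm (pairing E n (\<mu> t)) = total t n"
  unfolding L1_norm_def pairing_def
  using nn_integral_disintegration[OF state[OF t] is_disintegration_disintegration[OF standard state[OF t]],
      of "\<lambda>p. ennreal (n (snd p))"] by simp

end

theorem proposition2p4:
  fixes E :: "'e measure"
    and m a n :: "'e \<Rightarrow> real"
    and K :: "'e \<Rightarrow> 'e \<Rightarrow> 'e measure"
    and \<phi> :: "real \<Rightarrow> real"
    and T :: ereal
    and \<mu> :: "real \<Rightarrow> ('x::euclidean_space \<times> 'e) measure"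
  assumes "coagulation_setting DIM('x) E m a K \<phi>"
    and "0 < T"
    and "solution E m a K \<phi> T \<mu>"
    and "L1_norm (pairing E m (\<mu> 0)) < \<infinity>"
    and "mass_function E K n"
    and "L1_norm (pairing E n (\<mu> 0)) < \<infinity>"
  shows "conservative E m T \<mu> \<longleftrightarrow>
    (\<forall>t. 0 \<le> t \<and> ereal t < T \<longrightarrow>
       L1_norm (pairing E n (\<mu> t)) = L1_norm (pairing E n (\<mu> 0)))"
proof -
  interpret coagulation_setting "DIM('x)" E m a K \<phi> by fact
  interpret coagulation_solution "DIM('x)" E m a K \<phi> T \<mu>
    using assms(3) by unfold_locales simp
  have n: "n \<in> borel_measurable E" and m: "m \<in> borel_measurable E"
    using assms(5) mass by (auto simp: mass_function_def)
  have T: "ereal 0 < T" using assms(2) by (simp add: zero_ereal_def)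
  note L1 = L1_norm_pairing
  have fin: "(\<integral>\<^sup>+p. ennreal (m (snd p)) \<partial>\<mu> 0) < \<infinity>" "(\<integral>\<^sup>+p. ennreal (n (snd p)) \<partial>\<mu> 0) < \<infinity>"
    using assms(4,6) L1[OF order_refl T] m n by auto
  show ?thesis
  proof (intro iffI allI impI)
    fix t assume cons: "conservative E m T \<mu>" and "0 \<le> t \<and> ereal t < T"
    then have t: "0 \<le> t" "ereal t < T" by blast+
    have "(\<integral>\<^sup>+p. ennreal (m (snd p)) \<partial>\<mu> t) = (\<integral>\<^sup>+p. ennreal (m (snd p)) \<partial>\<mu> 0)"
      using cons t unfolding conservative_def L1[OF t m, symmetric] L1[OF order_refl T m, symmetric] by blast
    from mass_function_conserved[OF t mass assms(5) fin(1) this]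
    show "L1_norm (pairing E n (\<mu> t)) = L1_norm (pairing E n (\<mu> 0))"
      by (simp only: L1[OF t n] L1[OF order_refl T n])
  next
    assume cons: "\<forall>t. 0 \<le> t \<and> ereal t < T \<longrightarrow> L1_norm (pairing E n (\<mu> t)) = L1_norm (pairing E n (\<mu> 0))"
    show "conservative E m T \<mu>"
      unfolding conservative_def
    proof (intro allI impI conjI assms(4))
      fix t assume "0 \<le> t \<and> ereal t < T"
      then have t: "0 \<le> t" "ereal t < T" by blast+
      have "(\<integral>\<^sup>+p. ennreal (n (snd p)) \<partial>\<mu> t) = (\<integral>\<^sup>+p. ennreal (n (snd p)) \<partial>\<mu> 0)"
        using cons t unfolding L1[OF t n, symmetric] L1[OF order_refl T n, symmetric] by blast
      from mass_function_conserved[OF t assms(5) mass fin(2) this]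
      show "L1_norm (pairing E m (\<mu> t)) = L1_norm (pairing E m (\<mu> 0))"
        by (simp only: L1[OF t m] L1[OF order_refl T m])
    qed
  qed
qed

end
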